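(* Let $\Gamma$ be a finitely generated group, and let $A$ be a finitely generated abelian group. Suppose that one of the following holds: 1. $A$ is torsion-free; 2. $\Gamma$ is sofic; 3. $\Gamma$ is bi-orderable; 4. $A$ is cyclic and $\Gamma$ has the unique product property. Then $A \wr \Gamma$ is Hopfian if and only if $\Gamma$ is Hopfian.
   Context: The (standard, restricted) wreath product is $A \wr \Gamma := \left(\bigoplus_\Gamma A\right) \rtimes \Gamma$, where $\bigoplus_\Gamma A$ is the group of finitely supported functions $f\colon\Gamma \to A$ and $\Gamma$ acts by $({}_\gamma f)(x) = f(\gamma^{-1}x)$. A group is Hopfian if every surjective endomorphism of it is an automorphism. Sofic: let $d_H(\sigma,\tau) = \frac1n \#\{i : \sigma(i)\neq\tau(i)\}$ be the Hamming distance on the symmetric group $S_n$. A group $\Gamma$ is sofic if for every $0<\varepsilon<1$ and every finite subset $F\subset\Gamma$ there exist $n\ge 1$ and a map $\varphi\colon F\to S_n$ such that (i) for all $g,h\in F$ with $gh\in F$, $d_H(\varphi(gh),\varphi(g)\varphi(h))\le\varepsilon$; and (ii) for all $g\in F$ with $g \neq 1_\Gamma$, $d_H(\varphi(g),\mathrm{id})\ge 1-\varepsilon$. A group is bi-orderable if it admits a total order invariant under both left and right translations. A group $\Gamma$ has the unique product property if for every pair of nonempty finite subsets $S,T\subset\Gamma$ there exists an element $g\in\Gamma$ that can be expressed in exactly one way as a product $g = st$ with $s\in S$, $t\in T$. *)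

theory Defs
  imports "HOL-Algebra.Algebra"
begin

text \<open>The semidirect product \<open>N \<rtimes> H\<close> with respect to an action \<open>\<phi>\<close> of \<open>H\<close> on \<open>N\<close>;
  it is a group when \<open>\<phi>\<close> is an action by automorphisms.\<close>

definition semidirect_product ::
    "('n, 'x) monoid_scheme \<Rightarrow> ('h, 'y) monoid_scheme \<Rightarrow> ('h \<Rightarrow> 'n \<Rightarrow> 'n) \<Rightarrow> ('n \<times> 'h) monoid"
  where "semidirect_product N H \<phi> =
    \<lparr>carrier = carrier N \<times> carrier H,
     monoid.mult = (\<lambda>(n, h) (n', h'). (n \<otimes>\<^bsub>N\<^esub> \<phi> h n', h \<otimes>\<^bsub>H\<^esub> h')),
     one = (\<one>\<^bsub>N\<^esub>, \<one>\<^bsub>H\<^esub>)\<rparr>"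

definition shift :: "('g, 'x) monoid_scheme \<Rightarrow> 'g \<Rightarrow> ('g \<Rightarrow> 'a) \<Rightarrow> ('g \<Rightarrow> 'a)"
  where "shift \<Gamma> \<gamma> f = (\<lambda>x \<in> carrier \<Gamma>. f (inv\<^bsub>\<Gamma>\<^esub> \<gamma> \<otimes>\<^bsub>\<Gamma>\<^esub> x))"

definition wreath_product ::
    "('a, 'x) monoid_scheme \<Rightarrow> ('g, 'y) monoid_scheme \<Rightarrow> (('g \<Rightarrow> 'a) \<times> 'g) monoid"
  where "wreath_product A \<Gamma> =
    semidirect_product (sum_group (carrier \<Gamma>) (\<lambda>_. A)) \<Gamma> (shift \<Gamma>)"

definition finitely_generated :: "('a, 'x) monoid_scheme \<Rightarrow> bool"
  where "finitely_generated G \<longleftrightarrow>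
    (\<exists>S. finite S \<and> S \<subseteq> carrier G \<and> generate G S = carrier G)"

definition hopfian :: "('a, 'x) monoid_scheme \<Rightarrow> bool"
  where "hopfian G \<longleftrightarrow> (\<forall>h \<in> epi G G. h \<in> iso G G)"

definition torsion_free :: "('a, 'x) monoid_scheme \<Rightarrow> bool"
  where "torsion_free G \<longleftrightarrow>
    (\<forall>x \<in> carrier G. \<forall>n::nat. 0 < n \<and> x [^]\<^bsub>G\<^esub> n = \<one>\<^bsub>G\<^esub> \<longrightarrow> x = \<one>\<^bsub>G\<^esub>)"

definition hamming_dist :: "nat \<Rightarrow> (nat \<Rightarrow> nat) \<Rightarrow> (nat \<Rightarrow> nat) \<Rightarrow> real"
  where "hamming_dist n \<sigma> \<tau> = real (card {i \<in> {1..n}. \<sigma> i \<noteq> \<tau> i}) / real n"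

definition sofic :: "('a, 'x) monoid_scheme \<Rightarrow> bool"
  where "sofic G \<longleftrightarrow>
    (\<forall>\<epsilon>::real. \<forall>F. 0 < \<epsilon> \<and> \<epsilon> < 1 \<and> finite F \<and> F \<subseteq> carrier G \<longrightarrow>
      (\<exists>n \<ge> 1. \<exists>\<phi> \<in> F \<rightarrow> carrier (sym_group n).
        (\<forall>g \<in> F. \<forall>h \<in> F. g \<otimes>\<^bsub>G\<^esub> h \<in> F \<longrightarrow>
           hamming_dist n (\<phi> (g \<otimes>\<^bsub>G\<^esub> h)) (\<phi> g \<otimes>\<^bsub>sym_group n\<^esub> \<phi> h) \<le> \<epsilon>) \<and>
        (\<forall>g \<in> F. g \<noteq> \<one>\<^bsub>G\<^esub> \<longrightarrow>
           hamming_dist n (\<phi> g) \<one>\<^bsub>sym_group n\<^esub> \<ge> 1 - \<epsilon>)))"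

definition bi_orderable :: "('a, 'x) monoid_scheme \<Rightarrow> bool"
  where "bi_orderable G \<longleftrightarrow>
    (\<exists>r. linear_order_on (carrier G) r \<and>
      (\<forall>x \<in> carrier G. \<forall>y \<in> carrier G. \<forall>z \<in> carrier G. (x, y) \<in> r \<longrightarrow>
         (z \<otimes>\<^bsub>G\<^esub> x, z \<otimes>\<^bsub>G\<^esub> y) \<in> r \<and> (x \<otimes>\<^bsub>G\<^esub> z, y \<otimes>\<^bsub>G\<^esub> z) \<in> r))"

definition unique_product_property :: "('a, 'x) monoid_scheme \<Rightarrow> bool"
  where "unique_product_property G \<longleftrightarrow>
    (\<forall>S T. finite S \<and> S \<noteq> {} \<and> S \<subseteq> carrier G \<and> finite T \<and> T \<noteq> {} \<and> T \<subseteq> carrier G \<longrightarrow>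
      (\<exists>g \<in> carrier G. \<exists>!p. p \<in> S \<times> T \<and> g = fst p \<otimes>\<^bsub>G\<^esub> snd p))"

lemma group_semidirect_product:
  assumes N: "group N" and H: "group H"
    and hom: "\<And>h. h \<in> carrier H \<Longrightarrow> \<phi> h \<in> hom N N"
    and one: "\<And>n. n \<in> carrier N \<Longrightarrow> \<phi> \<one>\<^bsub>H\<^esub> n = n"
    and mult: "\<And>h h' n. \<lbrakk>h \<in> carrier H; h' \<in> carrier H; n \<in> carrier N\<rbrakk>
                 \<Longrightarrow> \<phi> (h \<otimes>\<^bsub>H\<^esub> h') n = \<phi> h (\<phi> h' n)"
  shows "group (semidirect_product N H \<phi>)"
proof -
  interpret N: group N by (rule N)
  interpret H: group H by (rule H)
  have cl: "\<phi> h n \<in> carrier N" if "h \<in> carrier H" "n \<in> carrier N" for h n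
    using hom[OF that(1)] that(2) by (rule hom_in_carrier)
  have hm: "\<phi> h (n \<otimes>\<^bsub>N\<^esub> n') = \<phi> h n \<otimes>\<^bsub>N\<^esub> \<phi> h n'"
    if "h \<in> carrier H" "n \<in> carrier N" "n' \<in> carrier N" for h n n'
    using hom[OF that(1)] that(2,3) by (rule hom_mult)
  have h1: "\<phi> h \<one>\<^bsub>N\<^esub> = \<one>\<^bsub>N\<^esub>" if "h \<in> carrier H" for h
    using hom_one[OF hom[OF that] N N] .
  show ?thesis
  proof (rule groupI)
    fix x assume "x \<in> carrier (semidirect_product N H \<phi>)"
    then obtain n h where x: "x = (n, h)" "n \<in> carrier N" "h \<in> carrier H"
      by (auto simp: semidirect_product_def)
    let ?y = "(\<phi> (inv\<^bsub>H\<^esub> h) (inv\<^bsub>N\<^esub> n), inv\<^bsub>H\<^esub> h)"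
    have "?y \<in> carrier (semidirect_product N H \<phi>)"
      using x cl by (simp add: semidirect_product_def)
    moreover have "?y \<otimes>\<^bsub>semidirect_product N H \<phi>\<^esub> x = \<one>\<^bsub>semidirect_product N H \<phi>\<^esub>"
      using x cl h1 by (simp add: semidirect_product_def flip: hm)
    ultimately show "\<exists>y \<in> carrier (semidirect_product N H \<phi>).
        y \<otimes>\<^bsub>semidirect_product N H \<phi>\<^esub> x = \<one>\<^bsub>semidirect_product N H \<phi>\<^esub>"
      by blast
  qed (auto simp: semidirect_product_def cl hm one mult N.m_assoc H.m_assoc)
qed

lemma group_wreath_product:
  assumes A: "group A" and G: "group \<Gamma>"
  shows "group (wreath_product A \<Gamma>)"
proof -
  interpret A: group A by (rule A)
  interpret G: group \<Gamma> by (rule G)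
  note carr = carrier_sum_group[of "carrier \<Gamma>" "\<lambda>_. A", OF A]
  have mem: "shift \<Gamma> \<gamma> f \<in> carrier (sum_group (carrier \<Gamma>) (\<lambda>_. A))"
    if \<gamma>: "\<gamma> \<in> carrier \<Gamma>" and f: "f \<in> carrier (sum_group (carrier \<Gamma>) (\<lambda>_. A))" for \<gamma> f
  proof -
    have fin: "finite {x \<in> carrier \<Gamma>. f x \<noteq> \<one>\<^bsub>A\<^esub>}"
      and fC: "f \<in> carrier \<Gamma> \<rightarrow>\<^sub>E carrier A"
      using f carr by auto
    have "{x \<in> carrier \<Gamma>. shift \<Gamma> \<gamma> f x \<noteq> \<one>\<^bsub>A\<^esub>}
        \<subseteq> (\<lambda>x. \<gamma> \<otimes>\<^bsub>\<Gamma>\<^esub> x) ` {x \<in> carrier \<Gamma>. f x \<noteq> \<one>\<^bsub>A\<^esub>}"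
    proof
      fix x assume "x \<in> {x \<in> carrier \<Gamma>. shift \<Gamma> \<gamma> f x \<noteq> \<one>\<^bsub>A\<^esub>}"
      then have x: "x \<in> carrier \<Gamma>" "f (inv\<^bsub>\<Gamma>\<^esub> \<gamma> \<otimes>\<^bsub>\<Gamma>\<^esub> x) \<noteq> \<one>\<^bsub>A\<^esub>"
        by (auto simp: shift_def)
      have "x = \<gamma> \<otimes>\<^bsub>\<Gamma>\<^esub> (inv\<^bsub>\<Gamma>\<^esub> \<gamma> \<otimes>\<^bsub>\<Gamma>\<^esub> x)"
        using x \<gamma> by (simp flip: G.m_assoc)
      then show "x \<in> (\<lambda>x. \<gamma> \<otimes>\<^bsub>\<Gamma>\<^esub> x) ` {x \<in> carrier \<Gamma>. f x \<noteq> \<one>\<^bsub>A\<^esub>}"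
        using x \<gamma> by blast
    qed
    then have "finite {x \<in> carrier \<Gamma>. shift \<Gamma> \<gamma> f x \<noteq> \<one>\<^bsub>A\<^esub>}"
      using fin by (meson finite_imageI finite_subset)
    moreover have "shift \<Gamma> \<gamma> f \<in> carrier \<Gamma> \<rightarrow>\<^sub>E carrier A"
      using fC \<gamma> by (auto simp: shift_def)
    ultimately show ?thesis using carr by auto
  qed
  show ?thesis
    unfolding wreath_product_def
  proof (rule group_semidirect_product)
    show "group (sum_group (carrier \<Gamma>) (\<lambda>_. A))"
      by (simp add: A)
    show "group \<Gamma>" by (rule G)
    show "shift \<Gamma> \<gamma> \<in> hom (sum_group (carrier \<Gamma>) (\<lambda>_. A)) (sum_group (carrier \<Gamma>) (\<lambda>_. A))"
      if "\<gamma> \<in> carrier \<Gamma>" for \<gamma>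
    proof (rule homI)
      fix f g
      show "shift \<Gamma> \<gamma> (f \<otimes>\<^bsub>sum_group (carrier \<Gamma>) (\<lambda>_. A)\<^esub> g) =
          shift \<Gamma> \<gamma> f \<otimes>\<^bsub>sum_group (carrier \<Gamma>) (\<lambda>_. A)\<^esub> shift \<Gamma> \<gamma> g"
        using that by (auto simp: shift_def fun_eq_iff)
    qed (rule mem[OF that])
    show "shift \<Gamma> \<one>\<^bsub>\<Gamma>\<^esub> f = f" if "f \<in> carrier (sum_group (carrier \<Gamma>) (\<lambda>_. A))" for f
      using that carr by (auto simp: shift_def fun_eq_iff PiE_def extensional_def)
    show "shift \<Gamma> (\<gamma> \<otimes>\<^bsub>\<Gamma>\<^esub> \<delta>) f = shift \<Gamma> \<gamma> (shift \<Gamma> \<delta> f)"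
      if "\<gamma> \<in> carrier \<Gamma>" "\<delta> \<in> carrier \<Gamma>" for \<gamma> \<delta> f
      using that by (auto simp: shift_def fun_eq_iff G.inv_mult_group G.m_assoc)
  qed
qed

end

theory Submission
  imports Defs
begin

text \<open>Write \<open>M\<close> for the base group of \<open>A \<wr> \<Gamma>\<close>, the finitely supported functions from \<open>\<Gamma>\<close> to
\<open>A\<close>, on which \<open>\<Gamma>\<close> acts by translation.

If \<open>A \<wr> \<Gamma>\<close> is Hopfian, so is \<open>\<Gamma>\<close>: a surjective endomorphism \<open>f\<close> of \<open>\<Gamma>\<close> pushes functions
forward, multiplying the values on each fibre, and \<open>(m, g) \<mapsto> (f\<^sub>* m, f g)\<close> is a surjective endomorphism
of the wreath product that is injective only if \<open>f\<close> is (\<open>hopfian_factor_of_wreath\<close>).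

Conversely let \<open>\<Gamma>\<close> be Hopfian and \<open>h\<close> a surjective endomorphism of \<open>A \<wr> \<Gamma>\<close>. Suppose first that \<open>h\<close> maps
\<open>M\<close> into \<open>M\<close>. Then \<open>h\<close> induces a surjective, hence bijective, endomorphism \<open>\<eta>\<close> of \<open>\<Gamma>\<close>; it follows that
\<open>h\<close> maps \<open>M\<close> onto \<open>M\<close>, and up to a twist by \<open>\<eta>\<close> this restriction commutes with translations. As
\<open>A\<close> is finitely generated, a translation-invariant endomorphism of \<open>M\<close> is a linear cellular
automaton: each value of the image depends through fixed homomorphisms on finitely many values of the
argument (\<open>equivariant_hom_is_automaton\<close>). So everything reduces to the statement that surjective linear
cellular automata on \<open>M\<close> are injective, which is called \<open>hopfian_automata\<close> below.

The other case, where \<open>h M\<close> is an abelian normal subgroup not contained in \<open>M\<close>, is very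
restrictive. Commutators with point masses show that \<open>A\<close> has exponent two and that the second
coordinates occurring in \<open>h M\<close> are \<open>\<one>\<close> and a central involution \<open>z\<close>. For infinite \<open>\<Gamma>\<close> this
contradicts the Hopf property of \<open>\<Gamma>\<close> (\<open>epi_preserves_base\<close>); for finite \<open>\<Gamma>\<close> the wreath
product is finite, and there is nothing to prove.

The four hypotheses serve to prove \<open>hopfian_automata\<close>. Finitely generated abelian groups are
residually finite through their quotients by \<open>N\<close>-th powers, and automata descend to these quotients, so
except in the torsion-free case \<open>A\<close> may be taken to be finite (\<open>hopfian_automata_residual\<close>).

\<^item> If \<open>\<Gamma>\<close> is sofic, the automaton has finite models on \<open>A\<^sup>n\<close>. There, surjectivity makes the image
of the model almost everything and a nontrivial kernel element makes the kernel exponentially large in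
\<open>n\<close>, against the homomorphism theorem (\<open>sofic_imp_hopfian_automata\<close>).

\<^item> If \<open>\<Gamma>\<close> is bi-ordered, the automaton extends to functions with well-ordered support and stays onto.
A nontrivial kernel would make the kernels of its powers a strictly increasing chain; but the kernels are
determined by their leading coefficients, which lie in the finite group \<open>A\<close>
(\<open>bi_orderable_imp_hopfian_automata\<close>).

\<^item> If \<open>A\<close> is cyclic, the automaton is convolution with an integer-valued function on \<open>\<Gamma>\<close>. Modulo a
suitable prime, unique products exclude zero divisors (\<open>unique_product_imp_hopfian_automata\<close>).

\<^item> If \<open>A\<close> is torsion-free, it embeds into a real vector space, the automaton becomes a matrix over the
real group algebra with a right inverse, and Kaplansky's trace argument, in the elementary form found by
Passman, shows that such a matrix is injective (\<open>right_inverse_is_injective\<close>).\<close>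

section \<open>Linear cellular automata\<close>

lemma (in comm_monoid) finprod_swap:
  assumes "finite I" "finite J" "\<And>i j. i \<in> I \<Longrightarrow> j \<in> J \<Longrightarrow> f i j \<in> carrier G"
  shows "(\<Otimes>i\<in>I. \<Otimes>j\<in>J. f i j) = (\<Otimes>j\<in>J. \<Otimes>i\<in>I. f i j)"
  using assms(1,3)
proof (induction I rule: finite_induct)
  case (insert i I)
  then have "(\<Otimes>j\<in>J. \<Otimes>i\<in>insert i I. f i j) = (\<Otimes>j\<in>J. f i j \<otimes> (\<Otimes>i\<in>I. f i j))"
    by (intro finprod_cong') (auto simp: Pi_def)
  also have "\<dots> = (\<Otimes>j\<in>J. f i j) \<otimes> (\<Otimes>j\<in>J. \<Otimes>i\<in>I. f i j)"
    using insert by (intro finprod_multf) auto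
  finally show ?case using insert by (simp add: Pi_def)
qed simp

lemma hom_finprod:
  assumes "h \<in> hom A B" "comm_group A" "comm_group B" "f \<in> I \<rightarrow> carrier A"
  shows "h (finprod A f I) = finprod B (\<lambda>i. h (f i)) I"
proof -
  interpret A: comm_group A by fact
  interpret B: comm_group B by fact
  interpret h: group_hom A B h by unfold_locales (rule assms)
  show ?thesis
    using assms(4)
  proof (induction I rule: infinite_finite_induct)
    case (insert i I)
    then show ?case by (simp add: Pi_def)
  qed auto
qed

lemma (in group) kernel_of_generators:
  assumes "h \<in> hom G H" "group H" "S \<subseteq> carrier G" "generate G S = carrier G"
    and "\<And>s. s \<in> S \<Longrightarrow> h s = \<one>\<^bsub>H\<^esub>" and "a \<in> carrier G"
  shows "h a = \<one>\<^bsub>H\<^esub>"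
proof -
  interpret h: group_hom G H h
    using assms by (simp add: group_hom.intro group_hom_axioms_def is_group)
  have "generate G S \<subseteq> kernel G H h"
    using assms by (intro generate_subgroup_incl h.subgroup_kernel) (auto simp: kernel_def)
  then show ?thesis using assms by (auto simp: kernel_def)
qed

text \<open>If \<open>A\<close> is the additive group of a ring and \<open>k t\<close> is multiplication by \<open>r\<^sub>t\<close>, this is right
multiplication by \<open>\<Sum>r\<^sub>t t\<close> in the group ring of \<open>G\<close>. The inverse on the right of \<open>x\<close> makes the map
commute with the left translations \<open>shift\<close>.\<close>

definition cellular_automaton ::
    "('a, 'y) monoid_scheme \<Rightarrow> ('g, 'x) monoid_scheme \<Rightarrow> 'g set \<Rightarrow> ('g \<Rightarrow> 'a \<Rightarrow> 'a) \<Rightarrow>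
      ('g \<Rightarrow> 'a) \<Rightarrow> 'g \<Rightarrow> 'a"
  where "cellular_automaton A G S k u =
    (\<lambda>x\<in>carrier G. \<Otimes>\<^bsub>A\<^esub>t\<in>S. k t (u (x \<otimes>\<^bsub>G\<^esub> inv\<^bsub>G\<^esub> t)))"

text \<open>The Hopf property of \<open>\<Oplus>\<^sub>G A\<close> as a group with \<open>G\<close>-action, for the endomorphisms given by cellular
automata. The kernel condition is injectivity, since automata are homomorphisms.\<close>

definition hopfian_automata :: "('a, 'y) monoid_scheme \<Rightarrow> ('g, 'x) monoid_scheme \<Rightarrow> bool"
  where "hopfian_automata A G \<longleftrightarrow>
    (\<forall>S k. finite S \<and> S \<subseteq> carrier G \<and> (\<forall>t\<in>S. k t \<in> hom A A) \<and>
       cellular_automaton A G S k ` carrier (sum_group (carrier G) (\<lambda>_. A))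
         = carrier (sum_group (carrier G) (\<lambda>_. A)) \<longrightarrow>
       (\<forall>u \<in> carrier (sum_group (carrier G) (\<lambda>_. A)).
          cellular_automaton A G S k u = (\<lambda>x\<in>carrier G. \<one>\<^bsub>A\<^esub>) \<longrightarrow> u = (\<lambda>x\<in>carrier G. \<one>\<^bsub>A\<^esub>)))"

definition point_mass ::
    "('a, 'y) monoid_scheme \<Rightarrow> ('g, 'x) monoid_scheme \<Rightarrow> 'a \<Rightarrow> 'g \<Rightarrow> 'g \<Rightarrow> 'a"
  where "point_mass A G a y = (\<lambda>x\<in>carrier G. if x = y then a else \<one>\<^bsub>A\<^esub>)"

locale wreath_factors = A: comm_group A + G: group G
  for A :: "('a, 'y) monoid_scheme" and G :: "('g, 'x) monoid_scheme"
begin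

abbreviation base where "base \<equiv> sum_group (carrier G) (\<lambda>_. A)"

abbreviation zero where "zero \<equiv> (\<lambda>x\<in>carrier G. \<one>\<^bsub>A\<^esub>)"

abbreviation supp where "supp u \<equiv> {x \<in> carrier G. u x \<noteq> \<one>\<^bsub>A\<^esub>}"

lemma base_carrier: "carrier base = {u \<in> carrier G \<rightarrow>\<^sub>E carrier A. finite (supp u)}"
  by (rule carrier_sum_group) (rule A.is_group)

lemma base_group: "group base" by (simp add: A.is_group)

lemma base_value: "u \<in> carrier base \<Longrightarrow> x \<in> carrier G \<Longrightarrow> u x \<in> carrier A"
  by (auto simp: base_carrier)

lemma base_ext:
  assumes "u \<in> carrier base" "v \<in> carrier base" "\<And>x. x \<in> carrier G \<Longrightarrow> u x = v x"
  shows "u = v"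
  using assms by (auto simp: base_carrier intro: PiE_ext)

lemma zero_base: "zero \<in> carrier base"
  by (auto simp: base_carrier)

lemma base_comm: "comm_group base"
proof (rule group.group_comm_groupI[OF base_group])
  fix u v assume "u \<in> carrier base" "v \<in> carrier base"
  then show "u \<otimes>\<^bsub>base\<^esub> v = v \<otimes>\<^bsub>base\<^esub> u"
    by (auto simp: fun_eq_iff A.m_comm base_value)
qed

lemma point_mass_base:
  assumes "a \<in> carrier A"
  shows "point_mass A G a y \<in> carrier base"
proof -
  have "supp (point_mass A G a y) \<subseteq> {y}" by (auto simp: point_mass_def)
  then have "finite (supp (point_mass A G a y))" by (meson finite.emptyI finite_insert finite_subset)
  then show ?thesis using assms by (auto simp: base_carrier point_mass_def)
qed

text \<open>Finitely supported functions are products of point masses, so homomorphisms are compared on point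
masses.\<close>

lemma base_induct [consumes 1, case_names zero point]:
  assumes "u \<in> carrier base" and "P zero"
    and step: "\<And>a y u. \<lbrakk>a \<in> carrier A; y \<in> carrier G; u \<in> carrier base; P u\<rbrakk>
              \<Longrightarrow> P (point_mass A G a y \<otimes>\<^bsub>base\<^esub> u)"
  shows "P u"
  using assms(1)
proof (induction "card (supp u)" arbitrary: u)
  case 0
  then have "supp u = {}" by (auto simp: base_carrier)
  then have "u = zero" using 0 zero_base by (auto intro!: base_ext)
  then show ?case using assms(2) by (simp only:)
next
  case (Suc n)
  then obtain y where y: "y \<in> supp u" by (metis card.empty ex_in_conv nat.distinct(1))
  define v where "v = (\<lambda>x\<in>carrier G. if x = y then \<one>\<^bsub>A\<^esub> else u x)"
  have sv: "supp v = supp u - {y}" by (auto simp: v_def)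
  have fu: "finite (supp u)" using Suc by (auto simp: base_carrier)
  then have v: "v \<in> carrier base"
    using Suc by (auto simp: base_carrier sv) (auto simp: v_def)
  have "card (supp v) = n" using y Suc(2) fu by (simp add: sv)
  then have "P v" using Suc(1) v by blast
  then have "P (point_mass A G (u y) y \<otimes>\<^bsub>base\<^esub> v)"
    using y v Suc by (intro step) (auto simp: base_value)
  moreover have "point_mass A G (u y) y \<otimes>\<^bsub>base\<^esub> v = u"
  proof
    fix x show "(point_mass A G (u y) y \<otimes>\<^bsub>base\<^esub> v) x = u x"
      using Suc(3) y by (cases "x \<in> carrier G")
        (auto simp: point_mass_def v_def base_carrier PiE_def extensional_def Pi_def)
  qed
  ultimately show ?case by simp
qed

lemma inv_shift_eq_iff:
  assumes "x \<in> carrier G" "y \<in> carrier G" "t \<in> carrier G"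
  shows "x \<otimes>\<^bsub>G\<^esub> inv\<^bsub>G\<^esub> t = y \<longleftrightarrow> inv\<^bsub>G\<^esub> y \<otimes>\<^bsub>G\<^esub> x = t"
    and "x \<otimes>\<^bsub>G\<^esub> inv\<^bsub>G\<^esub> t = y \<longleftrightarrow> x = y \<otimes>\<^bsub>G\<^esub> t"
  using assms G.inv_solve_right[of y x t] G.inv_solve_left[of t y x] by auto

lemma shift_base:
  assumes g: "g \<in> carrier G" and u: "u \<in> carrier base"
  shows "shift G g u \<in> carrier base"
proof -
  have "supp (shift G g u) \<subseteq> (\<lambda>x. g \<otimes>\<^bsub>G\<^esub> x) ` supp u"
  proof
    fix x assume x: "x \<in> supp (shift G g u)"
    then have "x = g \<otimes>\<^bsub>G\<^esub> (inv\<^bsub>G\<^esub> g \<otimes>\<^bsub>G\<^esub> x)" using g by (simp flip: G.m_assoc)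
    moreover have "inv\<^bsub>G\<^esub> g \<otimes>\<^bsub>G\<^esub> x \<in> supp u" using x g by (auto simp: shift_def)
    ultimately show "x \<in> (\<lambda>x. g \<otimes>\<^bsub>G\<^esub> x) ` supp u" by blast
  qed
  moreover have "finite (supp u)" using u by (auto simp: base_carrier)
  ultimately have "finite (supp (shift G g u))" by (meson finite_imageI finite_subset)
  then show ?thesis using u g by (auto simp: base_carrier shift_def)
qed

lemma shift_point_mass:
  assumes "g \<in> carrier G" "y \<in> carrier G"
  shows "shift G g (point_mass A G a y) = point_mass A G a (g \<otimes>\<^bsub>G\<^esub> y)"
proof
  fix x
  show "shift G g (point_mass A G a y) x = point_mass A G a (g \<otimes>\<^bsub>G\<^esub> y) x"
  proof (cases "x \<in> carrier G")
    case True
    have "inv\<^bsub>G\<^esub> g \<otimes>\<^bsub>G\<^esub> x = y \<longleftrightarrow> x = g \<otimes>\<^bsub>G\<^esub> y"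
      using assms True by (metis G.inv_closed G.inv_solve_left G.m_closed)
    then show ?thesis using assms True by (auto simp: shift_def point_mass_def)
  qed (simp add: shift_def point_mass_def)
qed

end

locale automaton = wreath_factors A G
  for A :: "('a, 'y) monoid_scheme" and G :: "('g, 'x) monoid_scheme" +
  fixes S :: "'g set" and k :: "'g \<Rightarrow> 'a \<Rightarrow> 'a"
  assumes finite_S: "finite S" and S_sub: "S \<subseteq> carrier G"
    and k_hom: "\<And>t. t \<in> S \<Longrightarrow> k t \<in> hom A A"
begin

abbreviation ca where "ca \<equiv> cellular_automaton A G S k"

lemma k_closed: "t \<in> S \<Longrightarrow> a \<in> carrier A \<Longrightarrow> k t a \<in> carrier A"
  using k_hom by (auto simp: hom_def)

lemma k_one: "t \<in> S \<Longrightarrow> k t \<one>\<^bsub>A\<^esub> = \<one>\<^bsub>A\<^esub>"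
  using k_hom hom_one A.is_group by blast

lemma k_mult: "t \<in> S \<Longrightarrow> a \<in> carrier A \<Longrightarrow> b \<in> carrier A \<Longrightarrow> k t (a \<otimes>\<^bsub>A\<^esub> b) = k t a \<otimes>\<^bsub>A\<^esub> k t b"
  using k_hom by (auto simp: hom_def)

lemma S_carrier: "t \<in> S \<Longrightarrow> t \<in> carrier G" using S_sub by auto

lemma ca_apply:
  "x \<in> carrier G \<Longrightarrow> ca u x = (\<Otimes>\<^bsub>A\<^esub>t\<in>S. k t (u (x \<otimes>\<^bsub>G\<^esub> inv\<^bsub>G\<^esub> t)))"
  by (simp add: cellular_automaton_def)

lemma ca_PiE:
  assumes "u \<in> carrier G \<rightarrow> carrier A"
  shows "ca u \<in> carrier G \<rightarrow>\<^sub>E carrier A"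
  using assms by (auto simp: cellular_automaton_def S_carrier intro!: A.finprod_closed k_closed)

lemma ca_zero: "ca zero = zero"
  by (auto simp: cellular_automaton_def fun_eq_iff S_carrier k_one intro!: A.finprod_one_eqI)

lemma ca_mult:
  assumes "u \<in> carrier G \<rightarrow> carrier A" "v \<in> carrier G \<rightarrow> carrier A"
  shows "ca (\<lambda>x\<in>carrier G. u x \<otimes>\<^bsub>A\<^esub> v x) = (\<lambda>x\<in>carrier G. ca u x \<otimes>\<^bsub>A\<^esub> ca v x)"
proof
  fix x
  show "ca (\<lambda>x\<in>carrier G. u x \<otimes>\<^bsub>A\<^esub> v x) x = (\<lambda>x\<in>carrier G. ca u x \<otimes>\<^bsub>A\<^esub> ca v x) x"
  proof (cases "x \<in> carrier G")
    case True
    have "(\<Otimes>\<^bsub>A\<^esub>t\<in>S. k t ((\<lambda>x\<in>carrier G. u x \<otimes>\<^bsub>A\<^esub> v x) (x \<otimes>\<^bsub>G\<^esub> inv\<^bsub>G\<^esub> t)))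
       = (\<Otimes>\<^bsub>A\<^esub>t\<in>S. k t (u (x \<otimes>\<^bsub>G\<^esub> inv\<^bsub>G\<^esub> t)) \<otimes>\<^bsub>A\<^esub> k t (v (x \<otimes>\<^bsub>G\<^esub> inv\<^bsub>G\<^esub> t)))"
      using assms True by (intro A.finprod_cong') (auto simp: S_carrier k_mult k_closed Pi_def)
    also have "\<dots> = ca u x \<otimes>\<^bsub>A\<^esub> ca v x"
      unfolding ca_apply[OF True]
      using assms True by (intro A.finprod_multf) (auto simp: S_carrier k_closed Pi_def)
    finally show ?thesis using True by (simp add: ca_apply)
  qed (simp add: cellular_automaton_def)
qed

text \<open>A value of the image is trivial unless one of the finitely many values entering it is not. This bound
works for any support condition that is stable under right translations and finite unions.\<close>

lemma ca_support:
  assumes "u \<in> carrier G \<rightarrow> carrier A"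
  shows "supp (ca u) \<subseteq> (\<Union>t\<in>S. (\<lambda>y. y \<otimes>\<^bsub>G\<^esub> t) ` supp u)"
proof
  fix x assume x: "x \<in> supp (ca u)"
  have "\<exists>t\<in>S. u (x \<otimes>\<^bsub>G\<^esub> inv\<^bsub>G\<^esub> t) \<noteq> \<one>\<^bsub>A\<^esub>"
  proof (rule ccontr)
    assume "\<not> ?thesis"
    then have "ca u x = \<one>\<^bsub>A\<^esub>" using x by (auto simp: ca_apply k_one intro!: A.finprod_one_eqI)
    then show False using x by simp
  qed
  then obtain t where t: "t \<in> S" "u (x \<otimes>\<^bsub>G\<^esub> inv\<^bsub>G\<^esub> t) \<noteq> \<one>\<^bsub>A\<^esub>" by blast
  then have "x = (x \<otimes>\<^bsub>G\<^esub> inv\<^bsub>G\<^esub> t) \<otimes>\<^bsub>G\<^esub> t" using x by (simp add: G.m_assoc S_carrier)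
  then show "x \<in> (\<Union>t\<in>S. (\<lambda>y. y \<otimes>\<^bsub>G\<^esub> t) ` supp u)"
    using t x by (auto simp: S_carrier intro!: bexI[of _ t] image_eqI)
qed

lemma ca_base:
  assumes "u \<in> carrier base"
  shows "ca u \<in> carrier base"
proof -
  have u: "u \<in> carrier G \<rightarrow> carrier A" and f: "finite (supp u)" using assms by (auto simp: base_carrier)
  have "finite (\<Union>t\<in>S. (\<lambda>y. y \<otimes>\<^bsub>G\<^esub> t) ` supp u)" using finite_S f by auto
  then have "finite (supp (ca u))" using ca_support[OF u] finite_subset by blast
  then show ?thesis using ca_PiE[OF u] by (auto simp: base_carrier)
qed

lemma ca_shift:
  assumes "g \<in> carrier G" "u \<in> carrier G \<rightarrow> carrier A"
  shows "ca (shift G g u) = shift G g (ca u)"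
proof
  fix x
  show "ca (shift G g u) x = shift G g (ca u) x"
    using assms by (cases "x \<in> carrier G")
      (auto simp: cellular_automaton_def shift_def S_carrier G.m_assoc Pi_def k_closed
            intro!: A.finprod_cong')
qed

lemma ca_point_mass:
  assumes "a \<in> carrier A" "y \<in> carrier G" "x \<in> carrier G"
  shows "ca (point_mass A G a y) x =
    (if inv\<^bsub>G\<^esub> y \<otimes>\<^bsub>G\<^esub> x \<in> S then k (inv\<^bsub>G\<^esub> y \<otimes>\<^bsub>G\<^esub> x) a else \<one>\<^bsub>A\<^esub>)"
proof -
  have "ca (point_mass A G a y) x = (\<Otimes>\<^bsub>A\<^esub>t\<in>S. if inv\<^bsub>G\<^esub> y \<otimes>\<^bsub>G\<^esub> x = t then k t a else \<one>\<^bsub>A\<^esub>)"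
    unfolding ca_apply[OF assms(3)] using assms
    by (intro A.finprod_cong')
       (auto simp: point_mass_def S_carrier k_one k_closed inv_shift_eq_iff(1))
  also have "\<dots> = (if inv\<^bsub>G\<^esub> y \<otimes>\<^bsub>G\<^esub> x \<in> S then k (inv\<^bsub>G\<^esub> y \<otimes>\<^bsub>G\<^esub> x) a else \<one>\<^bsub>A\<^esub>)"
    using finite_S assms by (auto simp: k_closed Pi_def intro!: A.finprod_singleton A.finprod_one_eqI)
  finally show ?thesis .
qed

end

text \<open>An equivariant \<open>\<theta>\<close> is determined by its values on point masses at the identity, so \<open>k t a\<close> has to be the
value at \<open>t\<close> of the image of the point mass \<open>a\<close>. Finite generation of \<open>A\<close> provides one finite
neighbourhood for all \<open>a\<close>: outside the supports of the images of the generators, the homomorphism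
\<open>k t\<close> kills all generators, hence is trivial.\<close>

lemma (in wreath_factors) equivariant_hom_is_automaton:
  assumes th: "\<theta> \<in> hom base base"
    and eqv: "\<And>g u. g \<in> carrier G \<Longrightarrow> u \<in> carrier base \<Longrightarrow> \<theta> (shift G g u) = shift G g (\<theta> u)"
    and fg: "finitely_generated A"
  obtains S k where "automaton A G S k"
    and "\<And>u. u \<in> carrier base \<Longrightarrow> \<theta> u = cellular_automaton A G S k u"
proof -
  obtain T where T: "finite T" "T \<subseteq> carrier A" "generate A T = carrier A"
    using fg by (auto simp: finitely_generated_def)
  define \<iota> where "\<iota> = (\<lambda>a. point_mass A G a \<one>\<^bsub>G\<^esub>)"
  define k where "k = (\<lambda>t a. \<theta> (\<iota> a) t)"
  define S where "S = (\<Union>s\<in>T. supp (\<theta> (\<iota> s)))"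
  have iota: "\<iota> a \<in> carrier base" if "a \<in> carrier A" for a
    using that by (simp add: \<iota>_def point_mass_base)
  have th_base: "\<theta> u \<in> carrier base" if "u \<in> carrier base" for u
    using th that by (auto simp: hom_def)
  have kh: "k t \<in> hom A A" if t: "t \<in> carrier G" for t
  proof (rule homI)
    fix a b assume ab: "a \<in> carrier A" "b \<in> carrier A"
    show "k t a \<in> carrier A" using t ab by (simp add: k_def base_value th_base iota)
    have "\<iota> (a \<otimes>\<^bsub>A\<^esub> b) = \<iota> a \<otimes>\<^bsub>base\<^esub> \<iota> b"
      by (auto simp: \<iota>_def point_mass_def fun_eq_iff)
    then have "\<theta> (\<iota> (a \<otimes>\<^bsub>A\<^esub> b)) = \<theta> (\<iota> a) \<otimes>\<^bsub>base\<^esub> \<theta> (\<iota> b)"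
      using ab iota hom_mult[OF th] by simp
    then show "k t (a \<otimes>\<^bsub>A\<^esub> b) = k t a \<otimes>\<^bsub>A\<^esub> k t b" using t by (simp add: k_def)
  qed
  have "automaton A G S k"
  proof unfold_locales
    show "finite S" using T th_base iota by (auto simp: S_def base_carrier)
    show "S \<subseteq> carrier G" by (auto simp: S_def)
    show "k t \<in> hom A A" if "t \<in> S" for t using kh that by (auto simp: S_def)
  qed
  interpret automaton A G S k by fact
  have outside: "k t a = \<one>\<^bsub>A\<^esub>" if "t \<in> carrier G" "t \<notin> S" "a \<in> carrier A" for t a
    using A.kernel_of_generators[OF kh[OF that(1)] A.is_group T(2,3) _ that(3)] that
    by (auto simp: S_def k_def)
  have "\<theta> u = ca u" if "u \<in> carrier base" for u
    using that
  proof (induction rule: base_induct)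
    case zero
    show ?case unfolding ca_zero using hom_one[OF th base_group base_group] by (simp only: one_sum_group)
  next
    case (point a y u)
    have "\<theta> (point_mass A G a y) = ca (point_mass A G a y)"
    proof (rule base_ext)
      fix x assume x: "x \<in> carrier G"
      have "\<theta> (point_mass A G a y) = shift G y (\<theta> (\<iota> a))"
        using eqv[of y "\<iota> a"] shift_point_mass[of y "\<one>\<^bsub>G\<^esub>" a] point iota by (simp add: \<iota>_def)
      then have "\<theta> (point_mass A G a y) x = k (inv\<^bsub>G\<^esub> y \<otimes>\<^bsub>G\<^esub> x) a"
        using x point by (simp add: shift_def k_def)
      then show "\<theta> (point_mass A G a y) x = ca (point_mass A G a y) x"
        using x point outside by (auto simp: ca_point_mass)
    qed (use point in \<open>auto simp: th_base ca_base point_mass_base\<close>)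
    moreover have "\<theta> (point_mass A G a y \<otimes>\<^bsub>base\<^esub> u) = \<theta> (point_mass A G a y) \<otimes>\<^bsub>base\<^esub> \<theta> u"
      using point by (intro hom_mult[OF th] point_mass_base)
    moreover have "ca (point_mass A G a y \<otimes>\<^bsub>base\<^esub> u) = ca (point_mass A G a y) \<otimes>\<^bsub>base\<^esub> ca u"
      unfolding mult_sum_group
      using point point_mass_base[of a y] by (intro ca_mult) (auto simp: base_carrier)
    ultimately show ?case using point by (simp only:)
  qed
  then show thesis using that \<open>automaton A G S k\<close> by blast
qed

section \<open>Abelian normal subgroups of a wreath product\<close>

text \<open>With these rules every product in the base group would be unfolded into a function; the pointwise rules
below keep group expressions intact until they are evaluated at a point.\<close>

declare mult_sum_group [simp del] one_sum_group [simp del] inv_sum_group [simp del]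

context wreath_factors
begin

sublocale B: comm_group base by (rule base_comm)

abbreviation wreath where "wreath \<equiv> wreath_product A G"

lemma base_one: "\<one>\<^bsub>base\<^esub> = zero" by (simp add: one_sum_group)

lemma base_one_apply [simp]: "x \<in> carrier G \<Longrightarrow> \<one>\<^bsub>base\<^esub> x = \<one>\<^bsub>A\<^esub>" by (simp add: base_one)

lemma base_mult_apply [simp]:
  "x \<in> carrier G \<Longrightarrow> (u \<otimes>\<^bsub>base\<^esub> v) x = u x \<otimes>\<^bsub>A\<^esub> v x"
  by (simp add: mult_sum_group)

lemma base_inv_apply [simp]:
  "u \<in> carrier base \<Longrightarrow> x \<in> carrier G \<Longrightarrow> (inv\<^bsub>base\<^esub> u) x = inv\<^bsub>A\<^esub> (u x)"
  by (simp add: inv_sum_group A.is_group)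

lemma shift_apply [simp]:
  "x \<in> carrier G \<Longrightarrow> shift G g u x = u (inv\<^bsub>G\<^esub> g \<otimes>\<^bsub>G\<^esub> x)"
  by (simp add: shift_def)

lemma shift_one [simp]: "u \<in> carrier base \<Longrightarrow> shift G \<one>\<^bsub>G\<^esub> u = u"
  by (rule base_ext) (auto simp: shift_base)

lemma shift_mult:
  "\<lbrakk>g \<in> carrier G; h \<in> carrier G; u \<in> carrier base\<rbrakk>
    \<Longrightarrow> shift G (g \<otimes>\<^bsub>G\<^esub> h) u = shift G g (shift G h u)"
  by (rule base_ext) (auto simp: shift_base G.inv_mult_group G.m_assoc)

lemma shift_base_mult:
  "\<lbrakk>g \<in> carrier G; u \<in> carrier base; v \<in> carrier base\<rbrakk>
    \<Longrightarrow> shift G g (u \<otimes>\<^bsub>base\<^esub> v) = shift G g u \<otimes>\<^bsub>base\<^esub> shift G g v"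
  by (rule base_ext) (auto simp: shift_base)

lemma shift_base_inv:
  "\<lbrakk>g \<in> carrier G; u \<in> carrier base\<rbrakk> \<Longrightarrow> shift G g (inv\<^bsub>base\<^esub> u) = inv\<^bsub>base\<^esub> (shift G g u)"
  by (rule base_ext) (auto simp: shift_base)

lemma shift_base_one [simp]: "g \<in> carrier G \<Longrightarrow> shift G g \<one>\<^bsub>base\<^esub> = \<one>\<^bsub>base\<^esub>"
  by (rule base_ext) (auto simp: shift_base)

lemma wreath_group: "group wreath"
  by (rule group_wreath_product) (rule A.is_group G.is_group)+

sublocale W: group wreath by (rule wreath_group)

lemma wreath_carrier: "carrier wreath = carrier base \<times> carrier G"
  by (simp add: wreath_product_def semidirect_product_def)

lemma wreath_mult:
  "(m, g) \<otimes>\<^bsub>wreath\<^esub> (n, h) = (m \<otimes>\<^bsub>base\<^esub> shift G g n, g \<otimes>\<^bsub>G\<^esub> h)"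
  by (simp add: wreath_product_def semidirect_product_def)

lemma wreath_one: "\<one>\<^bsub>wreath\<^esub> = (\<one>\<^bsub>base\<^esub>, \<one>\<^bsub>G\<^esub>)"
  by (simp add: wreath_product_def semidirect_product_def)

lemma wreath_mem [simp]: "(m, g) \<in> carrier wreath \<longleftrightarrow> m \<in> carrier base \<and> g \<in> carrier G"
  by (simp add: wreath_carrier)

lemma wreath_split:
  "\<lbrakk>m \<in> carrier base; g \<in> carrier G\<rbrakk> \<Longrightarrow> (m, g) = (m, \<one>\<^bsub>G\<^esub>) \<otimes>\<^bsub>wreath\<^esub> (\<one>\<^bsub>base\<^esub>, g)"
  by (simp add: wreath_mult)

text \<open>Conjugation by any \<open>(n, g)\<close> acts on the base group as translation by \<open>g\<close>, because the base group is
commutative.\<close>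

lemma wreath_conj_base:
  assumes "m \<in> carrier base" "n \<in> carrier base" "g \<in> carrier G"
  shows "(n, g) \<otimes>\<^bsub>wreath\<^esub> (m, \<one>\<^bsub>G\<^esub>) = (shift G g m, \<one>\<^bsub>G\<^esub>) \<otimes>\<^bsub>wreath\<^esub> (n, g)"
  using assms by (simp add: wreath_mult shift_base B.m_comm)

lemma wreath_inv_base:
  "m \<in> carrier base \<Longrightarrow> inv\<^bsub>wreath\<^esub> (m, \<one>\<^bsub>G\<^esub>) = (inv\<^bsub>base\<^esub> m, \<one>\<^bsub>G\<^esub>)"
  by (rule W.inv_equality) (auto simp: wreath_mult wreath_one)

lemma snd_hom: "snd \<in> hom wreath G"
  by (rule homI) (auto simp: wreath_mult)

lemma point_mass_eval_one:
  assumes "g \<in> carrier G"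
  shows "point_mass A G a g \<one>\<^bsub>G\<^esub> = (if g = \<one>\<^bsub>G\<^esub> then a else \<one>\<^bsub>A\<^esub>)"
  using assms by (auto simp: point_mass_def)

text \<open>In additive notation the hypothesis is \<open>(\<gamma> - 1)(\<beta> - 1) m = 0\<close> for the point mass \<open>m\<close> with value \<open>a\<close> at
the identity. Its four terms sit at \<open>\<gamma>\<beta>\<close>, \<open>\<gamma>\<close>, \<open>\<beta>\<close> and \<open>\<one>\<close>; evaluated at \<open>\<one>\<close>, the term \<open>a\<close> from
\<open>m\<close> itself can only be cancelled by the one at \<open>\<gamma>\<beta>\<close>.\<close>

lemma double_shift_relation:
  assumes ab: "\<beta> \<in> carrier G" "\<gamma> \<in> carrier G" "\<beta> \<noteq> \<one>\<^bsub>G\<^esub>" "\<gamma> \<noteq> \<one>\<^bsub>G\<^esub>"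
    and a: "a \<in> carrier A" "a \<noteq> \<one>\<^bsub>A\<^esub>" and m: "m = point_mass A G a \<one>\<^bsub>G\<^esub>"
    and fixed: "shift G \<gamma> (shift G \<beta> m \<otimes>\<^bsub>base\<^esub> inv\<^bsub>base\<^esub> m) = shift G \<beta> m \<otimes>\<^bsub>base\<^esub> inv\<^bsub>base\<^esub> m"
  shows "\<gamma> \<otimes>\<^bsub>G\<^esub> \<beta> = \<one>\<^bsub>G\<^esub>" and "a \<otimes>\<^bsub>A\<^esub> a = \<one>\<^bsub>A\<^esub>"
proof -
  have mb: "m \<in> carrier base" using a m by (simp add: point_mass_base)
  have mB: "shift G \<beta> m = point_mass A G a \<beta>" and mC: "shift G \<gamma> m = point_mass A G a \<gamma>"
    and mD: "shift G \<gamma> (shift G \<beta> m) = point_mass A G a (\<gamma> \<otimes>\<^bsub>G\<^esub> \<beta>)"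
    unfolding m using ab by (simp_all add: shift_point_mass)
  have e: "shift G \<gamma> (shift G \<beta> m \<otimes>\<^bsub>base\<^esub> inv\<^bsub>base\<^esub> m)
      = shift G \<gamma> (shift G \<beta> m) \<otimes>\<^bsub>base\<^esub> inv\<^bsub>base\<^esub> (shift G \<gamma> m)"
    using ab mb by (simp add: shift_base_mult shift_base_inv shift_base)
  have "shift G \<gamma> (shift G \<beta> m) \<otimes>\<^bsub>base\<^esub> inv\<^bsub>base\<^esub> (shift G \<gamma> m)
      = shift G \<beta> m \<otimes>\<^bsub>base\<^esub> inv\<^bsub>base\<^esub> m"
    by (rule trans[OF e[symmetric] fixed])
  then have "(point_mass A G a (\<gamma> \<otimes>\<^bsub>G\<^esub> \<beta>) \<otimes>\<^bsub>base\<^esub> inv\<^bsub>base\<^esub> (point_mass A G a \<gamma>)) \<one>\<^bsub>G\<^esub>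
      = (point_mass A G a \<beta> \<otimes>\<^bsub>base\<^esub> inv\<^bsub>base\<^esub> m) \<one>\<^bsub>G\<^esub>"
    by (metis mB mC mD)
  moreover have "m \<one>\<^bsub>G\<^esub> = a" by (simp add: m point_mass_eval_one)
  ultimately have *: "(if \<gamma> \<otimes>\<^bsub>G\<^esub> \<beta> = \<one>\<^bsub>G\<^esub> then a else \<one>\<^bsub>A\<^esub>) = inv\<^bsub>A\<^esub> a"
    using ab a mb by (simp add: point_mass_base point_mass_eval_one)
  show "\<gamma> \<otimes>\<^bsub>G\<^esub> \<beta> = \<one>\<^bsub>G\<^esub>" using * a by (metis A.inv_eq_1_iff)
  then have "a = inv\<^bsub>A\<^esub> a" using * by simp
  then show "a \<otimes>\<^bsub>A\<^esub> a = \<one>\<^bsub>A\<^esub>" using a by (metis A.r_inv)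
qed

end

text \<open>The configuration that has to be excluded when an endomorphism does not preserve the base group: \<open>N\<close>
is then the image of the base group, and \<open>(n0, z)\<close> a member of \<open>N\<close> outside the base group.\<close>

locale abelian_normal_in_wreath = wreath_factors A G
  for A :: "('a, 'y) monoid_scheme" and G :: "('g, 'x) monoid_scheme" +
  fixes N and n0 and z
  assumes normal_N: "N \<lhd> wreath"
    and N_comm: "\<And>x y. x \<in> N \<Longrightarrow> y \<in> N \<Longrightarrow> x \<otimes>\<^bsub>wreath\<^esub> y = y \<otimes>\<^bsub>wreath\<^esub> x"
    and z_in: "(n0, z) \<in> N" and z_ne: "z \<noteq> \<one>\<^bsub>G\<^esub>"
    and A_nontrivial: "\<exists>a\<in>carrier A. a \<noteq> \<one>\<^bsub>A\<^esub>"
begin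

sublocale N: normal N wreath by (rule normal_N)

lemma N_carrier: "(n, g) \<in> N \<Longrightarrow> n \<in> carrier base \<and> g \<in> carrier G"
  using N.subset by auto

lemma N_conj: "x \<in> carrier wreath \<Longrightarrow> y \<in> N \<Longrightarrow> x \<otimes>\<^bsub>wreath\<^esub> y \<otimes>\<^bsub>wreath\<^esub> inv\<^bsub>wreath\<^esub> x \<in> N"
  using W.normal_inv_iff normal_N by blast

text \<open>Elements of \<open>N\<close> commute, and commuting with \<open>(x, \<one>)\<close> means that translation by \<open>g\<close> fixes \<open>x\<close>.\<close>

lemma base_part_fixed:
  assumes "(x, \<one>\<^bsub>G\<^esub>) \<in> N" "(n, g) \<in> N"
  shows "shift G g x = x"
proof -
  have c: "x \<in> carrier base" "n \<in> carrier base" "g \<in> carrier G" using assms N_carrier by auto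
  have "(n, g) \<otimes>\<^bsub>wreath\<^esub> (x, \<one>\<^bsub>G\<^esub>) = (x, \<one>\<^bsub>G\<^esub>) \<otimes>\<^bsub>wreath\<^esub> (n, g)"
    using assms N_comm by blast
  then have "(shift G g x, \<one>\<^bsub>G\<^esub>) \<otimes>\<^bsub>wreath\<^esub> (n, g) = (x, \<one>\<^bsub>G\<^esub>) \<otimes>\<^bsub>wreath\<^esub> (n, g)"
    using c wreath_conj_base by simp
  then show ?thesis using c by (simp add: shift_base)
qed

text \<open>The commutator of \<open>(n, g) \<in> N\<close> with the base element \<open>m\<close> lies in the normal subgroup \<open>N\<close>, and it does
not depend on \<open>n\<close>.\<close>

lemma commutator_in:
  assumes "(n, g) \<in> N" "m \<in> carrier base"
  shows "(shift G g m \<otimes>\<^bsub>base\<^esub> inv\<^bsub>base\<^esub> m, \<one>\<^bsub>G\<^esub>) \<in> N"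
proof -
  have c: "n \<in> carrier base" "g \<in> carrier G" using assms N_carrier by auto
  let ?b = "(n, g)" and ?w = "(m, \<one>\<^bsub>G\<^esub>)"
  have "?b \<otimes>\<^bsub>wreath\<^esub> (?w \<otimes>\<^bsub>wreath\<^esub> inv\<^bsub>wreath\<^esub> ?b \<otimes>\<^bsub>wreath\<^esub> inv\<^bsub>wreath\<^esub> ?w) \<in> N"
    using assms c by (intro N.m_closed N_conj N.m_inv_closed) auto
  moreover have "?b \<otimes>\<^bsub>wreath\<^esub> (?w \<otimes>\<^bsub>wreath\<^esub> inv\<^bsub>wreath\<^esub> ?b \<otimes>\<^bsub>wreath\<^esub> inv\<^bsub>wreath\<^esub> ?w)
      = (?b \<otimes>\<^bsub>wreath\<^esub> ?w) \<otimes>\<^bsub>wreath\<^esub> inv\<^bsub>wreath\<^esub> ?b \<otimes>\<^bsub>wreath\<^esub> inv\<^bsub>wreath\<^esub> ?w"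
    using assms c by (simp add: W.m_assoc)
  moreover have "\<dots> = (shift G g m, \<one>\<^bsub>G\<^esub>) \<otimes>\<^bsub>wreath\<^esub> inv\<^bsub>wreath\<^esub> ?w"
    using assms c by (simp add: wreath_conj_base W.m_assoc shift_base)
  moreover have "\<dots> = (shift G g m \<otimes>\<^bsub>base\<^esub> inv\<^bsub>base\<^esub> m, \<one>\<^bsub>G\<^esub>)"
    using assms c by (simp add: wreath_inv_base wreath_mult shift_base)
  ultimately show ?thesis by simp
qed

lemma z_carrier: "z \<in> carrier G" and n0_carrier: "n0 \<in> carrier base"
  using z_in N_carrier by auto

text \<open>For a point mass \<open>m\<close> the commutator \<open>(\<beta> - 1) m\<close> belongs to \<open>N\<close>, so it is fixed by \<open>\<gamma>\<close>. All restrictions on \<open>A\<close> and on the second coordinates of \<open>N\<close> come from this.\<close>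

lemma product_of_parts:
  assumes "(n, \<beta>) \<in> N" "(n', \<gamma>) \<in> N" "\<beta> \<noteq> \<one>\<^bsub>G\<^esub>" "\<gamma> \<noteq> \<one>\<^bsub>G\<^esub>" "a \<in> carrier A" "a \<noteq> \<one>\<^bsub>A\<^esub>"
  shows "\<gamma> \<otimes>\<^bsub>G\<^esub> \<beta> = \<one>\<^bsub>G\<^esub>" "a \<otimes>\<^bsub>A\<^esub> a = \<one>\<^bsub>A\<^esub>"
  using double_shift_relation[OF _ _ assms(3-6) refl
      base_part_fixed[OF commutator_in[OF assms(1)] assms(2)]] assms(1,2,5) N_carrier
  by (auto simp: point_mass_base)

lemma A_exponent_two: "a \<in> carrier A \<Longrightarrow> a \<otimes>\<^bsub>A\<^esub> a = \<one>\<^bsub>A\<^esub>"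
  using product_of_parts(2)[OF z_in z_in z_ne z_ne] by (cases "a = \<one>\<^bsub>A\<^esub>") auto

lemma z_square: "z \<otimes>\<^bsub>G\<^esub> z = \<one>\<^bsub>G\<^esub>"
  using product_of_parts(1)[OF z_in z_in z_ne z_ne] A_nontrivial by auto

lemma inv_z: "inv\<^bsub>G\<^esub> z = z"
  using z_square z_carrier G.inv_equality by blast

text \<open>The projection of \<open>N\<close> to \<open>G\<close> is a group of order two: any two nontrivial members are inverse to each
other, so each of them equals \<open>inv z = z\<close>.\<close>

lemma parts:
  assumes "(n, g) \<in> N" shows "g = \<one>\<^bsub>G\<^esub> \<or> g = z"
proof (rule ccontr)
  assume ne: "\<not> ?thesis"
  then have "z \<otimes>\<^bsub>G\<^esub> g = \<one>\<^bsub>G\<^esub>"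
    using product_of_parts(1)[OF assms z_in _ z_ne] A_nontrivial by auto
  then show False
    using ne G.inv_equality inv_z z_carrier N_carrier[OF assms] G.inv_comm by metis
qed

lemma z_central:
  assumes "g \<in> carrier G" shows "g \<otimes>\<^bsub>G\<^esub> z = z \<otimes>\<^bsub>G\<^esub> g"
proof -
  have "(\<one>\<^bsub>base\<^esub>, g) \<otimes>\<^bsub>wreath\<^esub> (n0, z) \<otimes>\<^bsub>wreath\<^esub> inv\<^bsub>wreath\<^esub> (\<one>\<^bsub>base\<^esub>, g) \<in> N"
    using assms z_in by (intro N_conj) auto
  then have "snd ((\<one>\<^bsub>base\<^esub>, g) \<otimes>\<^bsub>wreath\<^esub> (n0, z) \<otimes>\<^bsub>wreath\<^esub> inv\<^bsub>wreath\<^esub> (\<one>\<^bsub>base\<^esub>, g)) \<in> {\<one>\<^bsub>G\<^esub>, z}"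
    using parts by (metis insertI1 insertI2 prod.collapse)
  moreover interpret s: group_hom wreath G snd
    using snd_hom by (simp add: group_hom.intro group_hom_axioms_def wreath_group)
  have "snd ((\<one>\<^bsub>base\<^esub>, g) \<otimes>\<^bsub>wreath\<^esub> (n0, z) \<otimes>\<^bsub>wreath\<^esub> inv\<^bsub>wreath\<^esub> (\<one>\<^bsub>base\<^esub>, g))
      = g \<otimes>\<^bsub>G\<^esub> z \<otimes>\<^bsub>G\<^esub> inv\<^bsub>G\<^esub> g"
    using assms n0_carrier z_carrier by simp
  ultimately have "g \<otimes>\<^bsub>G\<^esub> z \<otimes>\<^bsub>G\<^esub> inv\<^bsub>G\<^esub> g = \<one>\<^bsub>G\<^esub> \<or> g \<otimes>\<^bsub>G\<^esub> z \<otimes>\<^bsub>G\<^esub> inv\<^bsub>G\<^esub> g = z"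
    by auto
  then show ?thesis
  proof
    assume "g \<otimes>\<^bsub>G\<^esub> z \<otimes>\<^bsub>G\<^esub> inv\<^bsub>G\<^esub> g = \<one>\<^bsub>G\<^esub>"
    then have "g \<otimes>\<^bsub>G\<^esub> z = g" using assms z_carrier
      by (simp add: G.inv_solve_right')
    then show ?thesis using assms z_carrier z_ne by simp
  next
    assume "g \<otimes>\<^bsub>G\<^esub> z \<otimes>\<^bsub>G\<^esub> inv\<^bsub>G\<^esub> g = z"
    then show ?thesis using assms z_carrier by (simp add: G.inv_solve_right')
  qed
qed

text \<open>A converse of \<open>base_part_fixed\<close>: as left multiplication by the involution \<open>z\<close> has no fixed points and \<open>A\<close> has exponent
two, a \<open>z\<close>-invariant function is \<open>z y - y\<close> for its restriction \<open>y\<close> to a set of representatives of the orbits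
of \<open>z\<close>; this is the base part of a commutator with \<open>(n0, z)\<close>.\<close>

lemma fixed_in_N:
  assumes x: "x \<in> carrier base" and fixed: "shift G z x = x"
  shows "(x, \<one>\<^bsub>G\<^esub>) \<in> N"
proof -
  \<comment> \<open>Representatives of the orbits of \<open>z\<close>: the choice depends only on the set \<open>{t, z t}\<close>.\<close>
  define R where "R = {t. t = (SOME s. s \<in> {t, z \<otimes>\<^bsub>G\<^esub> t})}"
  have zz: "z \<otimes>\<^bsub>G\<^esub> (z \<otimes>\<^bsub>G\<^esub> t) = t" if "t \<in> carrier G" for t
    using that z_carrier z_square by (simp flip: G.m_assoc)
  have zt: "z \<otimes>\<^bsub>G\<^esub> t \<noteq> t" if "t \<in> carrier G" for t
    using that z_carrier z_ne by (simp add: G.l_cancel_one')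
  have R: "z \<otimes>\<^bsub>G\<^esub> t \<in> R \<longleftrightarrow> t \<notin> R" if "t \<in> carrier G" for t
  proof -
    have "(SOME s. s \<in> {t, z \<otimes>\<^bsub>G\<^esub> t}) \<in> {t, z \<otimes>\<^bsub>G\<^esub> t}" by (rule someI[of _ t]) simp
    moreover have "{z \<otimes>\<^bsub>G\<^esub> t, z \<otimes>\<^bsub>G\<^esub> (z \<otimes>\<^bsub>G\<^esub> t)} = {t, z \<otimes>\<^bsub>G\<^esub> t}" using that zz by auto
    ultimately show ?thesis using zt[OF that] unfolding R_def mem_Collect_eq by auto
  qed
  define y where "y = (\<lambda>t\<in>carrier G. if t \<in> R then x t else \<one>\<^bsub>A\<^esub>)"
  have "supp y \<subseteq> supp x" by (auto simp: y_def)
  then have "finite (supp y)" using x by (auto simp: base_carrier intro: finite_subset)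
  then have y: "y \<in> carrier base" using x by (auto simp: base_carrier y_def)
  have ii: "inv\<^bsub>A\<^esub> a = a" if "a \<in> carrier A" for a
    using that A_exponent_two A.inv_equality by blast
  have "x = shift G z y \<otimes>\<^bsub>base\<^esub> inv\<^bsub>base\<^esub> y"
  proof (rule base_ext)
    fix t assume t: "t \<in> carrier G"
    have "x (z \<otimes>\<^bsub>G\<^esub> t) = x t" using fun_cong[OF fixed, of t] t by (simp add: inv_z)
    then show "x t = (shift G z y \<otimes>\<^bsub>base\<^esub> inv\<^bsub>base\<^esub> y) t"
      using t y x z_carrier R[OF t] by (simp add: inv_z) (auto simp: y_def ii base_value)
  qed (use x y z_carrier in \<open>auto simp: shift_base\<close>)
  then show ?thesis using commutator_in[OF z_in y] by simp
qed

lemma A_exchange: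
  assumes "p \<in> carrier A" "q \<in> carrier A" "r \<in> carrier A" "s \<in> carrier A"
    and "p \<otimes>\<^bsub>A\<^esub> inv\<^bsub>A\<^esub> q = r \<otimes>\<^bsub>A\<^esub> inv\<^bsub>A\<^esub> s"
  shows "q \<otimes>\<^bsub>A\<^esub> inv\<^bsub>A\<^esub> s = p \<otimes>\<^bsub>A\<^esub> inv\<^bsub>A\<^esub> r"
proof -
  have "p = r \<otimes>\<^bsub>A\<^esub> inv\<^bsub>A\<^esub> s \<otimes>\<^bsub>A\<^esub> q"
    using assms by (metis A.inv_closed A.inv_solve_right A.m_closed)
  moreover have "inv\<^bsub>A\<^esub> r \<otimes>\<^bsub>A\<^esub> (r \<otimes>\<^bsub>A\<^esub> (inv\<^bsub>A\<^esub> s \<otimes>\<^bsub>A\<^esub> q)) = inv\<^bsub>A\<^esub> s \<otimes>\<^bsub>A\<^esub> q"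
    using assms(1-4) by (simp flip: A.m_assoc)
  ultimately show ?thesis
    using assms(1-4) by (simp add: A.m_comm[of _ "inv\<^bsub>A\<^esub> r"] A.m_comm[of q] A.m_assoc)
qed

text \<open>In additive notation, each \<open>n - g n\<close> is fixed by \<open>z\<close>, and as \<open>z\<close>
is central this says that \<open>z n - n\<close> is fixed by every \<open>g\<close>. A \<open>G\<close>-invariant function is constant, hence
trivial if its support is finite and \<open>G\<close> is not. So \<open>z n = n\<close>, and \<open>fixed_in_N\<close> applies.\<close>

lemma invariant_modulo_N_in_N:
  assumes inf: "infinite (carrier G)" and n: "n \<in> carrier base"
    and c: "\<And>g. g \<in> carrier G \<Longrightarrow> (n \<otimes>\<^bsub>base\<^esub> inv\<^bsub>base\<^esub> (shift G g n), \<one>\<^bsub>G\<^esub>) \<in> N"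
  shows "(n, \<one>\<^bsub>G\<^esub>) \<in> N"
proof (rule fixed_in_N[OF n])
  define y where "y = shift G z n \<otimes>\<^bsub>base\<^esub> inv\<^bsub>base\<^esub> n"
  have y: "y \<in> carrier base" using n z_carrier by (simp add: y_def shift_base)
  have inva: "shift G g y = y" if g: "g \<in> carrier G" for g
  proof -
    have "shift G z (n \<otimes>\<^bsub>base\<^esub> inv\<^bsub>base\<^esub> (shift G g n)) = n \<otimes>\<^bsub>base\<^esub> inv\<^bsub>base\<^esub> (shift G g n)"
      by (rule base_part_fixed[OF c[OF g] z_in])
    then have e: "shift G z n \<otimes>\<^bsub>base\<^esub> inv\<^bsub>base\<^esub> (shift G z (shift G g n))
        = n \<otimes>\<^bsub>base\<^esub> inv\<^bsub>base\<^esub> (shift G g n)"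
      using n g z_carrier by (simp add: shift_base_mult shift_base_inv shift_base)
    have sw: "shift G z (shift G g n) = shift G g (shift G z n)"
      using n g z_carrier z_central by (simp flip: shift_mult)
    have cl: "shift G z n \<in> carrier base" "shift G g n \<in> carrier base"
      "shift G g (shift G z n) \<in> carrier base"
      using n g z_carrier by (auto simp: shift_base)
    have "shift G g y = shift G g (shift G z n) \<otimes>\<^bsub>base\<^esub> inv\<^bsub>base\<^esub> (shift G g n)"
      using n g z_carrier by (simp add: y_def shift_base_mult shift_base_inv shift_base)
    also have "\<dots> = shift G z n \<otimes>\<^bsub>base\<^esub> inv\<^bsub>base\<^esub> n"
    proof (rule base_ext)
      fix t assume t: "t \<in> carrier G"
      have v: "n t \<in> carrier A" "shift G z n t \<in> carrier A" "shift G g n t \<in> carrier A"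
        "shift G g (shift G z n) t \<in> carrier A"
        using cl n t base_value by blast+
      have "shift G z n t \<otimes>\<^bsub>A\<^esub> inv\<^bsub>A\<^esub> (shift G g (shift G z n) t) = n t \<otimes>\<^bsub>A\<^esub> inv\<^bsub>A\<^esub> (shift G g n t)"
        using fun_cong[OF e, of t] cl n t sw by (simp del: shift_apply)
      then have "shift G g (shift G z n) t \<otimes>\<^bsub>A\<^esub> inv\<^bsub>A\<^esub> (shift G g n t) = shift G z n t \<otimes>\<^bsub>A\<^esub> inv\<^bsub>A\<^esub> (n t)"
        by (rule A_exchange[OF v(2,4,1,3)])
      then show "(shift G g (shift G z n) \<otimes>\<^bsub>base\<^esub> inv\<^bsub>base\<^esub> (shift G g n)) t
          = (shift G z n \<otimes>\<^bsub>base\<^esub> inv\<^bsub>base\<^esub> n) t"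
        using cl n t by (simp del: shift_apply)
    qed (use cl n in auto)
    finally show ?thesis by (simp add: y_def)
  qed
  have const: "y x = y \<one>\<^bsub>G\<^esub>" if "x \<in> carrier G" for x
    using fun_cong[OF inva[OF that], of x] that by simp
  have "y \<one>\<^bsub>G\<^esub> = \<one>\<^bsub>A\<^esub>"
  proof (rule ccontr)
    assume "y \<one>\<^bsub>G\<^esub> \<noteq> \<one>\<^bsub>A\<^esub>"
    then have "supp y = carrier G" using const by (metis (mono_tags, lifting) Collect_cong Collect_mem_eq)
    then show False using y inf by (simp add: base_carrier)
  qed
  then have "y x = \<one>\<^bsub>A\<^esub>" if "x \<in> carrier G" for x using const[OF that] by simp
  then have y1: "shift G z n \<otimes>\<^bsub>base\<^esub> inv\<^bsub>base\<^esub> n = \<one>\<^bsub>base\<^esub>"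
    using y unfolding y_def by (intro base_ext) auto
  have "shift G z n = inv\<^bsub>base\<^esub> (inv\<^bsub>base\<^esub> n)"
    using y1 n z_carrier by (intro B.inv_equality[symmetric]) (auto simp: shift_base)
  then show "shift G z n = n" using n by simp
qed

end

section \<open>Surjective endomorphisms and the base group\<close>

lemma (in group) surj_finite_iso:
  assumes "h \<in> epi G G" "finite (carrier G)"
  shows "h \<in> iso G G"
proof -
  have h: "h \<in> hom G G" "h ` carrier G = carrier G" using assms(1) by (auto simp: epi_def)
  then have "inj_on h (carrier G)" using assms(2) by (simp add: eq_card_imp_inj_on)
  then show ?thesis using h by (simp add: iso_def bij_betw_def)
qed

text \<open>Products of powers of the generators form a subgroup, and only the exponents modulo \<open>N\<close> matter.\<close>

lemma (in comm_group) finite_of_bounded_exponent: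
  assumes S: "finite S" "S \<subseteq> carrier G" and N: "0 < (N::nat)" "\<And>s. s \<in> S \<Longrightarrow> s [^] N = \<one>"
  shows "finite (generate G S)"
proof -
  define P where "P = (\<lambda>e::'a \<Rightarrow> nat. \<Otimes>s\<in>S. s [^] e s)"
  have Pc: "P e \<in> carrier G" for e unfolding P_def using S by (intro finprod_closed) auto
  have Pm: "P e \<otimes> P e' = P (\<lambda>s. e s + e' s)" for e e'
    unfolding P_def using S
    by (subst finprod_multf[symmetric]) (auto simp: nat_pow_mult intro!: finprod_cong')
  have mod: "P e = P (\<lambda>s\<in>S. e s mod N)" for e
  proof -
    have "s [^] e s = s [^] (e s mod N)" if "s \<in> S" for s
    proof -
      have s: "s \<in> carrier G" using that S by auto
      have "s [^] e s = s [^] (N * (e s div N) + e s mod N)" by simp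
      also have "\<dots> = (s [^] N) [^] (e s div N) \<otimes> s [^] (e s mod N)"
        using s by (simp only: nat_pow_mult[symmetric] nat_pow_pow)
      finally show ?thesis using that N s by simp
    qed
    then show ?thesis unfolding P_def using S by (intro finprod_cong') auto
  qed
  have "subgroup (range P) G"
  proof (rule subgroupI)
    show "range P \<subseteq> carrier G" using Pc by auto
    show "range P \<noteq> {}" by simp
    show "x \<otimes> y \<in> range P" if "x \<in> range P" "y \<in> range P" for x y
      using that Pm by auto
    show "inv x \<in> range P" if x: "x \<in> range P" for x
    proof -
      obtain e where e: "x = P e" using x by blast
      have "P (\<lambda>s. (N - 1) * e s) \<otimes> x = P (\<lambda>s. N * e s)"
        unfolding e Pm using N by (intro arg_cong[where f = P] ext) (cases N; simp)
      also have "\<dots> = P (\<lambda>s\<in>S. 0)" by (subst mod) simp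
      also have "\<dots> = \<one>" by (auto simp: P_def intro: finprod_one_eqI)
      finally have "inv x = P (\<lambda>s. (N - 1) * e s)" using Pc e by (intro inv_equality) auto
      then show ?thesis by simp
    qed
  qed
  moreover have "S \<subseteq> range P"
  proof
    fix s assume s: "s \<in> S"
    have "P (\<lambda>t. if t = s then 1 else 0) = (\<Otimes>t\<in>S. if t = s then t else \<one>)"
      unfolding P_def using S by (intro finprod_cong') auto
    also have "\<dots> = s" using S s by (intro finprod_singleton_swap) auto
    finally show "s \<in> range P" by (metis rangeI)
  qed
  ultimately have "generate G S \<subseteq> range P" by (simp add: generate_subgroup_incl)
  moreover have "range P \<subseteq> P ` (S \<rightarrow>\<^sub>E {..<N})"
  proof
    fix x assume "x \<in> range P"
    then obtain e where "x = P e" by auto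
    then show "x \<in> P ` (S \<rightarrow>\<^sub>E {..<N})"
      using mod[of e] N by (auto intro!: image_eqI[of _ _ "\<lambda>s\<in>S. e s mod N"])
  qed
  moreover have "finite (P ` (S \<rightarrow>\<^sub>E {..<N}))" using S by (intro finite_imageI finite_PiE) auto
  ultimately show ?thesis by (meson finite_subset)
qed

context wreath_factors
begin

text \<open>Since \<open>h\<close> is onto, every conjugation of the target is the image of a conjugation of the source, under
which the base group is stable.\<close>

lemma epi_image_of_base_normal:
  assumes h: "h \<in> epi wreath wreath"
  shows "(\<lambda>m. h (m, \<one>\<^bsub>G\<^esub>)) ` carrier base \<lhd> wreath"
proof -
  have hh: "h \<in> hom wreath wreath" and onto: "h ` carrier wreath = carrier wreath"
    using h by (auto simp: epi_def)
  interpret h: group_hom wreath wreath h by unfold_locales (rule hh)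
  let ?N = "(\<lambda>m. h (m, \<one>\<^bsub>G\<^esub>)) ` carrier base"
  have mult: "h (m, \<one>\<^bsub>G\<^esub>) \<otimes>\<^bsub>wreath\<^esub> h (n, \<one>\<^bsub>G\<^esub>) = h (m \<otimes>\<^bsub>base\<^esub> n, \<one>\<^bsub>G\<^esub>)"
    if "m \<in> carrier base" "n \<in> carrier base" for m n
    using that by (simp add: wreath_mult flip: h.hom_mult)
  have inv: "inv\<^bsub>wreath\<^esub> h (m, \<one>\<^bsub>G\<^esub>) = h (inv\<^bsub>base\<^esub> m, \<one>\<^bsub>G\<^esub>)" if "m \<in> carrier base" for m
    using that by (simp add: wreath_inv_base flip: h.hom_inv)
  have "subgroup ?N wreath"
  proof (rule W.subgroupI)
    show "?N \<subseteq> carrier wreath" by auto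
    show "?N \<noteq> {}" using B.one_closed by blast
    show "inv\<^bsub>wreath\<^esub> x \<in> ?N" if "x \<in> ?N" for x using that inv by auto
    show "x \<otimes>\<^bsub>wreath\<^esub> y \<in> ?N" if "x \<in> ?N" "y \<in> ?N" for x y using that mult by auto
  qed
  moreover have "x \<otimes>\<^bsub>wreath\<^esub> y \<otimes>\<^bsub>wreath\<^esub> inv\<^bsub>wreath\<^esub> x \<in> ?N"
    if x: "x \<in> carrier wreath" and y: "y \<in> ?N" for x y
  proof -
    obtain n g where ng: "x = h (n, g)" "n \<in> carrier base" "g \<in> carrier G"
      using x onto by (metis (no_types, lifting) imageE wreath_mem surj_pair)
    obtain m where m: "y = h (m, \<one>\<^bsub>G\<^esub>)" "m \<in> carrier base" using y by auto
    have "x \<otimes>\<^bsub>wreath\<^esub> y = h ((n, g) \<otimes>\<^bsub>wreath\<^esub> (m, \<one>\<^bsub>G\<^esub>))" using ng m by simp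
    also have "\<dots> = h (shift G g m, \<one>\<^bsub>G\<^esub>) \<otimes>\<^bsub>wreath\<^esub> x"
      using ng m by (simp add: wreath_conj_base shift_base)
    finally have "x \<otimes>\<^bsub>wreath\<^esub> y \<otimes>\<^bsub>wreath\<^esub> inv\<^bsub>wreath\<^esub> x = h (shift G g m, \<one>\<^bsub>G\<^esub>)"
      using ng m x by (simp add: W.m_assoc shift_base)
    then show ?thesis using ng m shift_base by auto
  qed
  ultimately show ?thesis using W.normal_inv_iff by blast
qed

lemma epi_image_of_base_abelian_normal:
  assumes h: "h \<in> epi wreath wreath" and m0: "m0 \<in> carrier base"
    and ne: "snd (h (m0, \<one>\<^bsub>G\<^esub>)) \<noteq> \<one>\<^bsub>G\<^esub>" and z: "h (m0, \<one>\<^bsub>G\<^esub>) = (n0, z)"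
    and N_def: "N = (\<lambda>m. h (m, \<one>\<^bsub>G\<^esub>)) ` carrier base"
  shows "abelian_normal_in_wreath A G N n0 z"
proof -
  have hh: "h \<in> hom wreath wreath" using h by (auto simp: epi_def)
  interpret h: group_hom wreath wreath h by unfold_locales (rule hh)
  show ?thesis
  proof (intro abelian_normal_in_wreath.intro abelian_normal_in_wreath_axioms.intro)
    show "wreath_factors A G" by unfold_locales
    show "N \<lhd> wreath" unfolding N_def by (rule epi_image_of_base_normal[OF h])
    show "x \<otimes>\<^bsub>wreath\<^esub> y = y \<otimes>\<^bsub>wreath\<^esub> x" if xy: "x \<in> N" "y \<in> N" for x y
    proof -
      obtain m n where "x = h (m, \<one>\<^bsub>G\<^esub>)" "m \<in> carrier base" "y = h (n, \<one>\<^bsub>G\<^esub>)" "n \<in> carrier base"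
        using xy by (auto simp: N_def)
      then show ?thesis by (simp add: wreath_mult B.m_comm flip: h.hom_mult)
    qed
    show "(n0, z) \<in> N" using z m0 unfolding N_def by (metis imageI)
    show "z \<noteq> \<one>\<^bsub>G\<^esub>" using ne z by simp
    have "m0 \<noteq> \<one>\<^bsub>base\<^esub>" using ne h.hom_one by (auto simp: wreath_one)
    then show "\<exists>a\<in>carrier A. a \<noteq> \<one>\<^bsub>A\<^esub>"
      using m0 base_ext[OF m0 B.one_closed] base_value by fastforce
  qed
qed

text \<open>Suppose the abelian normal subgroup \<open>N = h M\<close> is not inside the base group \<open>M\<close>. Modulo \<open>N\<close> the map
\<open>h\<close> only depends on the second coordinate, so \<open>c = h (\<one>, z)\<close> is central modulo \<open>N\<close>. The lemmas
above then show \<open>c \<in> N\<close>. Let \<open>\<eta>\<close> be the induced endomorphism of \<open>G\<close>. On the one hand \<open>\<eta> z\<close> is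
\<open>\<one>\<close> or \<open>z\<close>; on the other hand a preimage of a point mass, which is not in \<open>N\<close>, yields some \<open>\<gamma>\<close> other than
\<open>\<one>\<close> and \<open>z\<close> with \<open>\<eta> \<gamma>\<close> equal to \<open>\<one>\<close> or \<open>z\<close>.

If \<open>\<eta>\<close> is onto, it is injective because \<open>G\<close> is Hopfian, and three different elements cannot be mapped
to two. If it is not onto, its image \<open>H\<close> is a complement of \<open>{\<one>, z}\<close>; multiplying \<open>\<eta>\<close> by \<open>z\<close> outside
\<open>H\<close> gives a surjective endomorphism of \<open>G\<close>, which is injective but maps \<open>\<gamma>\<close> or \<open>z \<gamma>\<close> to \<open>\<one>\<close>.\<close>

lemma epi_preserves_base:
  assumes hop: "hopfian G" and inf: "infinite (carrier G)" and h: "h \<in> epi wreath wreath"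
    and m0: "m0 \<in> carrier base"
  shows "snd (h (m0, \<one>\<^bsub>G\<^esub>)) = \<one>\<^bsub>G\<^esub>"
proof (rule ccontr)
  assume ne: "snd (h (m0, \<one>\<^bsub>G\<^esub>)) \<noteq> \<one>\<^bsub>G\<^esub>"
  have hh: "h \<in> hom wreath wreath" and onto: "h ` carrier wreath = carrier wreath"
    using h by (auto simp: epi_def)
  interpret h: group_hom wreath wreath h by unfold_locales (rule hh)
  define N where "N = (\<lambda>m. h (m, \<one>\<^bsub>G\<^esub>)) ` carrier base"
  obtain n0 z where z: "h (m0, \<one>\<^bsub>G\<^esub>) = (n0, z)" by (metis surj_pair)
  interpret abelian_normal_in_wreath A G N n0 z
    by (rule epi_image_of_base_abelian_normal[OF h m0 ne z N_def])
  define Q where "Q = wreath_product A G Mod N"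
  define q where "q = (\<lambda>w. N #>\<^bsub>wreath\<^esub> w)"
  have q_hom: "q \<in> hom wreath Q" unfolding q_def Q_def by (rule N.r_coset_hom_Mod)
  interpret Q: group Q unfolding Q_def by (rule N.factorgroup_is_group)
  interpret q: group_hom wreath Q q by unfold_locales (rule q_hom)
  have q_N: "q x = \<one>\<^bsub>Q\<^esub>" if "x \<in> N" for x
    using that N.subset N.rcos_const by (simp add: q_def Q_def FactGroup_def)
  have N_q: "x \<otimes>\<^bsub>wreath\<^esub> inv\<^bsub>wreath\<^esub> y \<in> N" if "x \<in> carrier wreath" "y \<in> carrier wreath" "q x = q y" for x y
  proof -
    have "x \<in> N #>\<^bsub>wreath\<^esub> y"
      using that W.rcos_self[OF that(1) N.subgroup_axioms] by (simp add: q_def)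
    then obtain n where "n \<in> N" "x = n \<otimes>\<^bsub>wreath\<^esub> y" by (auto simp: r_coset_def)
    then show ?thesis using that N.subset by (simp add: W.m_assoc subset_iff)
  qed
  have N_q1: "x \<in> N" if "x \<in> carrier wreath" "q x = \<one>\<^bsub>Q\<^esub>" for x
    using N_q[of x "\<one>\<^bsub>wreath\<^esub>"] that by simp
  define c where "c = h (\<one>\<^bsub>base\<^esub>, z)"
  have c: "c \<in> carrier wreath" using z_carrier by (simp add: c_def)
  have q_h: "q (h (m, g)) = q (h (\<one>\<^bsub>base\<^esub>, g))" if "m \<in> carrier base" "g \<in> carrier G" for m g
  proof -
    have "q (h (m, g)) = q (h (m, \<one>\<^bsub>G\<^esub>)) \<otimes>\<^bsub>Q\<^esub> q (h (\<one>\<^bsub>base\<^esub>, g))"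
      using that by (subst wreath_split) auto
    moreover have "h (m, \<one>\<^bsub>G\<^esub>) \<in> N" using that by (auto simp: N_def)
    ultimately show ?thesis using q_N that by simp
  qed
  have central: "q (c \<otimes>\<^bsub>wreath\<^esub> w) = q (w \<otimes>\<^bsub>wreath\<^esub> c)" if w: "w \<in> carrier wreath" for w
  proof -
    obtain m g where mg: "w = h (m, g)" "m \<in> carrier base" "g \<in> carrier G"
      using w onto by (metis (no_types, lifting) imageE wreath_mem surj_pair)
    have "q (c \<otimes>\<^bsub>wreath\<^esub> w) = q (h (\<one>\<^bsub>base\<^esub>, z) \<otimes>\<^bsub>wreath\<^esub> h (\<one>\<^bsub>base\<^esub>, g))"
      using mg z_carrier q_h[of m g] by (simp add: c_def)
    also have "\<dots> = q (h (\<one>\<^bsub>base\<^esub>, g) \<otimes>\<^bsub>wreath\<^esub> h (\<one>\<^bsub>base\<^esub>, z))"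
      using mg z_carrier z_central[of g] by (simp add: wreath_mult flip: h.hom_mult)
    also have "\<dots> = q (w \<otimes>\<^bsub>wreath\<^esub> c)"
      using mg z_carrier q_h[of m g] by (simp add: c_def)
    finally show ?thesis .
  qed
  have c_in: "c \<in> N"
  proof -
    obtain n \<zeta> where n: "c = (n, \<zeta>)" "n \<in> carrier base" "\<zeta> \<in> carrier G" using c by (metis surj_pair wreath_mem)
    obtain a where a: "a \<in> carrier A" "a \<noteq> \<one>\<^bsub>A\<^esub>" using A_nontrivial by blast
    define p where "p = point_mass A G a \<one>\<^bsub>G\<^esub>"
    have p: "p \<in> carrier base" using a by (simp add: p_def point_mass_base)
    \<comment> \<open>Centrality puts the commutator \<open>(\<zeta> - 1) p\<close> of \<open>c\<close> with a point mass into \<open>N\<close>, so \<open>z\<close> fixes it.\<close>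
    have "\<zeta> = \<one>\<^bsub>G\<^esub> \<or> \<zeta> = z"
    proof (rule ccontr)
      assume *: "\<not> ?thesis"
      have "(c \<otimes>\<^bsub>wreath\<^esub> (p, \<one>\<^bsub>G\<^esub>)) \<otimes>\<^bsub>wreath\<^esub> inv\<^bsub>wreath\<^esub> ((p, \<one>\<^bsub>G\<^esub>) \<otimes>\<^bsub>wreath\<^esub> c) \<in> N"
        using p c by (intro N_q central) auto
      moreover have "(c \<otimes>\<^bsub>wreath\<^esub> (p, \<one>\<^bsub>G\<^esub>)) \<otimes>\<^bsub>wreath\<^esub> inv\<^bsub>wreath\<^esub> ((p, \<one>\<^bsub>G\<^esub>) \<otimes>\<^bsub>wreath\<^esub> c)
          = (shift G \<zeta> p \<otimes>\<^bsub>base\<^esub> inv\<^bsub>base\<^esub> p, \<one>\<^bsub>G\<^esub>)"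
      proof -
        have "(c \<otimes>\<^bsub>wreath\<^esub> (p, \<one>\<^bsub>G\<^esub>)) \<otimes>\<^bsub>wreath\<^esub> inv\<^bsub>wreath\<^esub> ((p, \<one>\<^bsub>G\<^esub>) \<otimes>\<^bsub>wreath\<^esub> c)
          = (shift G \<zeta> p, \<one>\<^bsub>G\<^esub>) \<otimes>\<^bsub>wreath\<^esub> (c \<otimes>\<^bsub>wreath\<^esub> (inv\<^bsub>wreath\<^esub> c \<otimes>\<^bsub>wreath\<^esub> inv\<^bsub>wreath\<^esub> (p, \<one>\<^bsub>G\<^esub>)))"
          using n p c by (simp add: wreath_conj_base W.inv_mult_group W.m_assoc shift_base)
        also have "\<dots> = (shift G \<zeta> p, \<one>\<^bsub>G\<^esub>) \<otimes>\<^bsub>wreath\<^esub> inv\<^bsub>wreath\<^esub> (p, \<one>\<^bsub>G\<^esub>)"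
          using p c by (simp flip: W.m_assoc)
        also have "\<dots> = (shift G \<zeta> p \<otimes>\<^bsub>base\<^esub> inv\<^bsub>base\<^esub> p, \<one>\<^bsub>G\<^esub>)"
          using n p by (simp add: wreath_inv_base wreath_mult shift_base)
        finally show ?thesis .
      qed
      ultimately have "(shift G \<zeta> p \<otimes>\<^bsub>base\<^esub> inv\<^bsub>base\<^esub> p, \<one>\<^bsub>G\<^esub>) \<in> N" by simp
      then have "shift G z (shift G \<zeta> p \<otimes>\<^bsub>base\<^esub> inv\<^bsub>base\<^esub> p) = shift G \<zeta> p \<otimes>\<^bsub>base\<^esub> inv\<^bsub>base\<^esub> p"
        using base_part_fixed z_in by blast
      then have "z \<otimes>\<^bsub>G\<^esub> \<zeta> = \<one>\<^bsub>G\<^esub>"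
        using double_shift_relation(1)[OF n(3) z_carrier _ z_ne a p_def] * by blast
      then show False using * n z_carrier inv_z by (metis G.inv_equality G.inv_inv)
    qed
    then obtain nb where nb: "(nb, \<zeta>) \<in> N"
      using N.one_closed z_in by (auto simp: wreath_one)
    have nbc: "nb \<in> carrier base" using nb N_carrier by blast
    \<comment> \<open>Removing an element of \<open>N\<close> with the same second coordinate leaves a base element that is central modulo \<open>N\<close>.\<close>
    define n' where "n' = n \<otimes>\<^bsub>base\<^esub> inv\<^bsub>base\<^esub> nb"
    have n': "n' \<in> carrier base" using n nbc by (simp add: n'_def)
    have c_eq: "c = (n', \<one>\<^bsub>G\<^esub>) \<otimes>\<^bsub>wreath\<^esub> (nb, \<zeta>)"
      using n nbc by (simp add: wreath_mult n'_def B.m_assoc)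
    have qc: "q c = q (n', \<one>\<^bsub>G\<^esub>)"
      unfolding c_eq using n' nbc n q_N[OF nb] by simp
    have "(n', \<one>\<^bsub>G\<^esub>) \<in> N"
    proof (rule invariant_modulo_N_in_N[OF inf n'])
      fix g assume g: "g \<in> carrier G"
      let ?w = "(\<one>\<^bsub>base\<^esub>, g)"
      have "q ((n', \<one>\<^bsub>G\<^esub>) \<otimes>\<^bsub>wreath\<^esub> ?w) = q (?w \<otimes>\<^bsub>wreath\<^esub> (n', \<one>\<^bsub>G\<^esub>))"
        using central[of ?w] g n' c qc by simp
      then have "((n', \<one>\<^bsub>G\<^esub>) \<otimes>\<^bsub>wreath\<^esub> ?w) \<otimes>\<^bsub>wreath\<^esub> inv\<^bsub>wreath\<^esub> (?w \<otimes>\<^bsub>wreath\<^esub> (n', \<one>\<^bsub>G\<^esub>)) \<in> N"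
        using g n' by (intro N_q) auto
      moreover have "((n', \<one>\<^bsub>G\<^esub>) \<otimes>\<^bsub>wreath\<^esub> ?w) \<otimes>\<^bsub>wreath\<^esub> inv\<^bsub>wreath\<^esub> (?w \<otimes>\<^bsub>wreath\<^esub> (n', \<one>\<^bsub>G\<^esub>))
         = (n', \<one>\<^bsub>G\<^esub>) \<otimes>\<^bsub>wreath\<^esub> (?w \<otimes>\<^bsub>wreath\<^esub> (inv\<^bsub>wreath\<^esub> ?w \<otimes>\<^bsub>wreath\<^esub> inv\<^bsub>wreath\<^esub> (shift G g n', \<one>\<^bsub>G\<^esub>)))"
        using n' g by (simp add: wreath_conj_base W.inv_mult_group W.m_assoc shift_base)
      moreover have "\<dots> = (n', \<one>\<^bsub>G\<^esub>) \<otimes>\<^bsub>wreath\<^esub> inv\<^bsub>wreath\<^esub> (shift G g n', \<one>\<^bsub>G\<^esub>)"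
        using n' g by (simp add: shift_base flip: W.m_assoc)
      moreover have "\<dots> = (n' \<otimes>\<^bsub>base\<^esub> inv\<^bsub>base\<^esub> (shift G g n'), \<one>\<^bsub>G\<^esub>)"
        using n' g by (simp add: wreath_inv_base wreath_mult shift_base)
      ultimately show "(n' \<otimes>\<^bsub>base\<^esub> inv\<^bsub>base\<^esub> (shift G g n'), \<one>\<^bsub>G\<^esub>) \<in> N" by simp
    qed
    then show ?thesis using N_q1 q_N qc c by simp
  qed
  define \<eta> where "\<eta> = (\<lambda>g. snd (h (\<one>\<^bsub>base\<^esub>, g)))"
  interpret s: group_hom wreath G snd
    using snd_hom by (simp add: group_hom.intro group_hom_axioms_def wreath_group)
  have \<eta>_hom: "\<eta> \<in> hom G G"
  proof (rule homI)
    fix x y assume xy: "x \<in> carrier G" "y \<in> carrier G"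
    show "\<eta> x \<in> carrier G" using xy by (simp add: \<eta>_def)
    have "h (\<one>\<^bsub>base\<^esub>, x \<otimes>\<^bsub>G\<^esub> y) = h (\<one>\<^bsub>base\<^esub>, x) \<otimes>\<^bsub>wreath\<^esub> h (\<one>\<^bsub>base\<^esub>, y)"
      using xy by (simp add: wreath_mult flip: h.hom_mult)
    then show "\<eta> (x \<otimes>\<^bsub>G\<^esub> y) = \<eta> x \<otimes>\<^bsub>G\<^esub> \<eta> y" using xy by (simp add: \<eta>_def)
  qed
  interpret \<eta>: group_hom G G \<eta> by unfold_locales (rule \<eta>_hom)
  have h_N: "snd (h (m, \<one>\<^bsub>G\<^esub>)) = \<one>\<^bsub>G\<^esub> \<or> snd (h (m, \<one>\<^bsub>G\<^esub>)) = z" if "m \<in> carrier base" for m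
    using that parts[of "fst (h (m, \<one>\<^bsub>G\<^esub>))"] by (simp add: N_def)
  have snd_h: "snd (h (m, g)) = snd (h (m, \<one>\<^bsub>G\<^esub>)) \<otimes>\<^bsub>G\<^esub> \<eta> g" if "m \<in> carrier base" "g \<in> carrier G" for m g
    using that by (subst wreath_split) (auto simp: \<eta>_def)
  have cover: "\<exists>g\<in>carrier G. x = \<eta> g \<or> x = z \<otimes>\<^bsub>G\<^esub> \<eta> g" if x: "x \<in> carrier G" for x
  proof -
    have "(\<one>\<^bsub>base\<^esub>, x) \<in> h ` carrier wreath" using x onto by simp
    then obtain m g where mg: "(\<one>\<^bsub>base\<^esub>, x) = h (m, g)" "m \<in> carrier base" "g \<in> carrier G"
      by (auto simp: wreath_carrier)
    then have "x = snd (h (m, \<one>\<^bsub>G\<^esub>)) \<otimes>\<^bsub>G\<^esub> \<eta> g" using snd_h by (metis snd_conv)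
    then show ?thesis using h_N[OF mg(2)] mg by auto
  qed
  have \<eta>_z: "\<eta> z = \<one>\<^bsub>G\<^esub> \<or> \<eta> z = z"
    using c_in parts[of "fst c" "snd c"] by (simp add: \<eta>_def c_def)
  obtain \<gamma> where \<gamma>: "\<gamma> \<in> carrier G" "\<gamma> \<noteq> \<one>\<^bsub>G\<^esub>" "\<gamma> \<noteq> z" "\<eta> \<gamma> = \<one>\<^bsub>G\<^esub> \<or> \<eta> \<gamma> = z"
  proof -
    obtain a where a: "a \<in> carrier A" "a \<noteq> \<one>\<^bsub>A\<^esub>" using A_nontrivial by blast
    define p where "p = point_mass A G a \<one>\<^bsub>G\<^esub>"
    have p: "p \<in> carrier base" using a by (simp add: p_def point_mass_base)
    have pN: "(p, \<one>\<^bsub>G\<^esub>) \<notin> N"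
    proof
      assume "(p, \<one>\<^bsub>G\<^esub>) \<in> N"
      then have "shift G z p = p" using base_part_fixed z_in by blast
      then have "point_mass A G a z \<one>\<^bsub>G\<^esub> = point_mass A G a \<one>\<^bsub>G\<^esub> \<one>\<^bsub>G\<^esub>"
        using z_carrier by (simp add: p_def shift_point_mass)
      then show False using a z_ne z_carrier by (simp add: point_mass_eval_one)
    qed
    have "(p, \<one>\<^bsub>G\<^esub>) \<in> h ` carrier wreath" using p onto by simp
    then obtain m g where mg: "(p, \<one>\<^bsub>G\<^esub>) = h (m, g)" "m \<in> carrier base" "g \<in> carrier G"
      by (auto simp: wreath_carrier)
    have q1: "q (h (\<one>\<^bsub>base\<^esub>, g)) \<noteq> \<one>\<^bsub>Q\<^esub>" using pN mg q_h[OF mg(2,3)] N_q1 p by fastforce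
    have "g \<noteq> \<one>\<^bsub>G\<^esub>" using q1 q_N N.one_closed h.hom_one by (metis wreath_one)
    moreover have "g \<noteq> z" using q1 q_N[OF c_in] by (metis c_def)
    moreover have "\<one>\<^bsub>G\<^esub> = snd (h (m, \<one>\<^bsub>G\<^esub>)) \<otimes>\<^bsub>G\<^esub> \<eta> g" using snd_h mg by (metis snd_conv)
    then have "\<eta> g = \<one>\<^bsub>G\<^esub> \<or> \<eta> g = z"
      using h_N[OF mg(2)] mg z_carrier inv_z by (metis G.inv_equality G.inv_inv G.l_one \<eta>.hom_closed)
    ultimately show thesis using that mg by blast
  qed
  show False
  proof (cases "\<eta> ` carrier G = carrier G")
    case True
    then have "inj_on \<eta> (carrier G)"
      using hop \<eta>_hom by (auto simp: hopfian_def epi_def iso_def bij_betw_def)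
    then have inj: "x = y" if "\<eta> x = \<eta> y" "x \<in> carrier G" "y \<in> carrier G" for x y
      using that by (auto simp: inj_on_def)
    have "\<eta> z \<noteq> \<one>\<^bsub>G\<^esub>" using inj[of z "\<one>\<^bsub>G\<^esub>"] z_carrier z_ne by auto
    then have "\<eta> z = z" using \<eta>_z by simp
    then show False using \<gamma> inj[of \<gamma> z] inj[of \<gamma> "\<one>\<^bsub>G\<^esub>"] z_carrier by auto
  next
    case False
    define H where "H = \<eta> ` carrier G"
    have H_sub: "H \<subseteq> carrier G" by (auto simp: H_def)
    have H_mult: "x \<otimes>\<^bsub>G\<^esub> y \<in> H" if "x \<in> H" "y \<in> H" for x y
      using that by (auto simp: H_def simp flip: \<eta>.hom_mult)
    have zH: "z \<notin> H"
    proof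
      assume "z \<in> H"
      then have "carrier G \<subseteq> H" using cover H_mult by (fastforce simp: H_def)
      then show False using False H_sub by (auto simp: H_def)
    qed
    have \<eta>z: "\<eta> z = \<one>\<^bsub>G\<^esub>" using \<eta>_z zH z_carrier unfolding H_def by (metis imageI)
    have zz: "z \<otimes>\<^bsub>G\<^esub> (z \<otimes>\<^bsub>G\<^esub> x) = x" if "x \<in> carrier G" for x
      using that z_carrier z_square by (simp flip: G.m_assoc)
    have zxy: "z \<otimes>\<^bsub>G\<^esub> (x \<otimes>\<^bsub>G\<^esub> y) = x \<otimes>\<^bsub>G\<^esub> (z \<otimes>\<^bsub>G\<^esub> y)" if "x \<in> carrier G" "y \<in> carrier G" for x y
      using that z_central[of x] z_carrier by (simp flip: G.m_assoc)
    have zxzy: "(z \<otimes>\<^bsub>G\<^esub> x) \<otimes>\<^bsub>G\<^esub> (z \<otimes>\<^bsub>G\<^esub> y) = x \<otimes>\<^bsub>G\<^esub> y" if "x \<in> carrier G" "y \<in> carrier G" for x y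
      using that zz[of "x \<otimes>\<^bsub>G\<^esub> y"] zxy[OF that] z_carrier by (simp add: G.m_assoc)
    have not_both: "z \<otimes>\<^bsub>G\<^esub> x \<notin> H" if x: "x \<in> H" for x
    proof
      assume zx: "z \<otimes>\<^bsub>G\<^esub> x \<in> H"
      have "inv\<^bsub>G\<^esub> x \<in> H" using x by (auto simp: H_def simp flip: \<eta>.hom_inv)
      then have "z \<otimes>\<^bsub>G\<^esub> x \<otimes>\<^bsub>G\<^esub> inv\<^bsub>G\<^esub> x \<in> H" using zx H_mult by blast
      then show False using zH x H_sub z_carrier by (auto simp: G.m_assoc subset_iff)
    qed
    have one_of: "x \<in> H \<or> z \<otimes>\<^bsub>G\<^esub> x \<in> H" if "x \<in> carrier G" for x
      using cover[OF that] zz by (auto simp: H_def)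
    \<comment> \<open>On the direct product of \<open>H\<close> and \<open>{\<one>, z}\<close>, this is \<open>\<eta>\<close> on \<open>H\<close> and the identity on \<open>{\<one>, z}\<close>.\<close>
    define f where "f = (\<lambda>x. if x \<in> H then \<eta> x else z \<otimes>\<^bsub>G\<^esub> \<eta> x)"
    have parity: "x \<otimes>\<^bsub>G\<^esub> y \<in> H \<longleftrightarrow> (x \<in> H \<longleftrightarrow> y \<in> H)"
      if xy: "x \<in> carrier G" "y \<in> carrier G" for x y
    proof -
      have e: "z \<otimes>\<^bsub>G\<^esub> (x \<otimes>\<^bsub>G\<^esub> y) = (z \<otimes>\<^bsub>G\<^esub> x) \<otimes>\<^bsub>G\<^esub> y"
        "z \<otimes>\<^bsub>G\<^esub> (x \<otimes>\<^bsub>G\<^esub> y) = x \<otimes>\<^bsub>G\<^esub> (z \<otimes>\<^bsub>G\<^esub> y)"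
        "x \<otimes>\<^bsub>G\<^esub> y = (z \<otimes>\<^bsub>G\<^esub> x) \<otimes>\<^bsub>G\<^esub> (z \<otimes>\<^bsub>G\<^esub> y)"
        using xy z_carrier zxy[OF xy] zxzy[OF xy] by (simp add: G.m_assoc, metis, metis)
      show ?thesis
        using one_of[OF xy(1)] one_of[OF xy(2)] not_both H_mult e by metis
    qed
    have f_hom: "f \<in> hom G G"
    proof (rule homI)
      fix x y assume xy: "x \<in> carrier G" "y \<in> carrier G"
      show "f x \<in> carrier G" using xy z_carrier by (simp add: f_def)
      have e: "z \<otimes>\<^bsub>G\<^esub> (\<eta> x \<otimes>\<^bsub>G\<^esub> \<eta> y) = \<eta> x \<otimes>\<^bsub>G\<^esub> (z \<otimes>\<^bsub>G\<^esub> \<eta> y)"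
        "\<eta> x \<otimes>\<^bsub>G\<^esub> \<eta> y = z \<otimes>\<^bsub>G\<^esub> \<eta> x \<otimes>\<^bsub>G\<^esub> (z \<otimes>\<^bsub>G\<^esub> \<eta> y)"
        using xy zxy[of "\<eta> x" "\<eta> y"] zxzy[of "\<eta> x" "\<eta> y"] by (metis \<eta>.hom_closed)+
      show "f (x \<otimes>\<^bsub>G\<^esub> y) = f x \<otimes>\<^bsub>G\<^esub> f y"
        using xy e z_carrier parity[OF xy] by (auto simp: f_def G.m_assoc)
    qed
    have "f ` carrier G = carrier G"
    proof
      show "f ` carrier G \<subseteq> carrier G" using f_hom by (auto simp: hom_def)
      show "carrier G \<subseteq> f ` carrier G"
      proof
        fix x assume "x \<in> carrier G"
        then obtain g where g: "g \<in> carrier G" "x = \<eta> g \<or> x = z \<otimes>\<^bsub>G\<^esub> \<eta> g" using cover by blast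
        have zg: "\<eta> (z \<otimes>\<^bsub>G\<^esub> g) = \<eta> g" "z \<otimes>\<^bsub>G\<^esub> g \<in> carrier G" using g z_carrier \<eta>z by auto
        have "x = f g \<or> x = f (z \<otimes>\<^bsub>G\<^esub> g)"
          using g zg one_of[OF g(1)] not_both by (auto simp: f_def)
        then show "x \<in> f ` carrier G" using g zg by blast
      qed
    qed
    then have "inj_on f (carrier G)"
      using hop f_hom by (auto simp: hopfian_def epi_def iso_def bij_betw_def)
    then have inj: "x = y" if "f x = f y" "x \<in> carrier G" "y \<in> carrier G" for x y
      using that by (auto simp: inj_on_def)
    have f1: "f \<one>\<^bsub>G\<^esub> = \<one>\<^bsub>G\<^esub>" using hom_one[OF f_hom G.is_group G.is_group] .
    have \<eta>\<gamma>: "\<eta> \<gamma> = \<one>\<^bsub>G\<^esub>" using \<gamma> zH by (auto simp: H_def)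
    have "f \<gamma> = \<one>\<^bsub>G\<^esub> \<or> f (z \<otimes>\<^bsub>G\<^esub> \<gamma>) = \<one>\<^bsub>G\<^esub>"
      using \<gamma> \<eta>\<gamma> \<eta>z z_carrier one_of[OF \<gamma>(1)] by (auto simp: f_def)
    then have "\<gamma> = \<one>\<^bsub>G\<^esub> \<or> z \<otimes>\<^bsub>G\<^esub> \<gamma> = \<one>\<^bsub>G\<^esub>"
      using inj[of \<gamma> "\<one>\<^bsub>G\<^esub>"] inj[of "z \<otimes>\<^bsub>G\<^esub> \<gamma>" "\<one>\<^bsub>G\<^esub>"] f1 \<gamma> z_carrier by auto
    then have "\<gamma> = z" using \<gamma> z_carrier inv_z by (metis G.inv_equality G.inv_inv)
    then show False using \<gamma> by simp
  qed
qed

end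

section \<open>Hopficity of a wreath product and of its factor\<close>

context wreath_factors
begin

lemma automaton_hopfian:
  assumes "hopfian_automata A G" "automaton A G S k"
    and "cellular_automaton A G S k ` carrier base = carrier base"
    and "u \<in> carrier base" "cellular_automaton A G S k u = \<one>\<^bsub>base\<^esub>"
  shows "u = \<one>\<^bsub>base\<^esub>"
proof -
  interpret automaton A G S k by fact
  show ?thesis using assms finite_S S_sub k_hom unfolding hopfian_automata_def base_one by blast
qed

text \<open>The induced endomorphism \<open>\<eta>\<close> of the Hopfian group \<open>G\<close> is bijective. Injectivity of \<open>\<eta>\<close> shows that preimages
of base elements are base elements, so the restriction \<open>f\<close> of \<open>h\<close> to the base group is onto. It satisfies
\<open>f (g m) = \<eta> g (f m)\<close>; composing with \<open>m \<mapsto> m \<circ> \<eta>\<close> turns this into equivariance, and the resulting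
automaton is injective.\<close>

lemma epi_preserving_base_iso:
  assumes hop: "hopfian G" and au: "hopfian_automata A G" and fg: "finitely_generated A"
    and h: "h \<in> epi wreath wreath"
    and pres: "\<And>m. m \<in> carrier base \<Longrightarrow> snd (h (m, \<one>\<^bsub>G\<^esub>)) = \<one>\<^bsub>G\<^esub>"
  shows "h \<in> iso wreath wreath"
proof -
  have hh: "h \<in> hom wreath wreath" and onto: "h ` carrier wreath = carrier wreath"
    using h by (auto simp: epi_def)
  interpret h: group_hom wreath wreath h by unfold_locales (rule hh)
  interpret s: group_hom wreath G snd
    using snd_hom by (simp add: group_hom.intro group_hom_axioms_def wreath_group)
  define \<eta> where "\<eta> = (\<lambda>g. snd (h (\<one>\<^bsub>base\<^esub>, g)))"
  define f where "f = (\<lambda>m. fst (h (m, \<one>\<^bsub>G\<^esub>)))"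
  have h_base: "h (m, \<one>\<^bsub>G\<^esub>) = (f m, \<one>\<^bsub>G\<^esub>)" if "m \<in> carrier base" for m
    using pres[OF that] by (simp add: f_def prod_eq_iff)
  have f_base: "f m \<in> carrier base" if "m \<in> carrier base" for m
    using h_base[OF that] h.hom_closed[of "(m, \<one>\<^bsub>G\<^esub>)"] that by simp
  have snd_h: "snd (h (m, g)) = \<eta> g" if "m \<in> carrier base" "g \<in> carrier G" for m g
  proof -
    have "snd (h (m, g)) = snd (h (m, \<one>\<^bsub>G\<^esub>)) \<otimes>\<^bsub>G\<^esub> \<eta> g"
      using that by (subst wreath_split) (auto simp: \<eta>_def)
    then show ?thesis using pres that by (simp add: \<eta>_def)
  qed
  have \<eta>_hom: "\<eta> \<in> hom G G"
  proof (rule homI)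
    fix x y assume xy: "x \<in> carrier G" "y \<in> carrier G"
    show "\<eta> x \<in> carrier G" using xy by (simp add: \<eta>_def)
    have "h (\<one>\<^bsub>base\<^esub>, x \<otimes>\<^bsub>G\<^esub> y) = h (\<one>\<^bsub>base\<^esub>, x) \<otimes>\<^bsub>wreath\<^esub> h (\<one>\<^bsub>base\<^esub>, y)"
      using xy by (simp add: wreath_mult flip: h.hom_mult)
    then show "\<eta> (x \<otimes>\<^bsub>G\<^esub> y) = \<eta> x \<otimes>\<^bsub>G\<^esub> \<eta> y" using xy by (simp add: \<eta>_def)
  qed
  interpret \<eta>: group_hom G G \<eta> by unfold_locales (rule \<eta>_hom)
  have "\<eta> ` carrier G = carrier G"
  proof
    show "carrier G \<subseteq> \<eta> ` carrier G"
    proof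
      fix x assume "x \<in> carrier G"
      then have "(\<one>\<^bsub>base\<^esub>, x) \<in> h ` carrier wreath" using onto by simp
      then obtain m g where "(\<one>\<^bsub>base\<^esub>, x) = h (m, g)" "m \<in> carrier base" "g \<in> carrier G"
        by (auto simp: wreath_carrier)
      then show "x \<in> \<eta> ` carrier G" using snd_h by (metis imageI snd_conv)
    qed
  qed auto
  then have bij: "bij_betw \<eta> (carrier G) (carrier G)"
    using hop \<eta>_hom by (auto simp: hopfian_def epi_def iso_def)
  then have \<eta>_one: "g = \<one>\<^bsub>G\<^esub>" if "\<eta> g = \<one>\<^bsub>G\<^esub>" "g \<in> carrier G" for g
    using that by (metis G.one_closed \<eta>.hom_one bij_betw_inv_into_left)
  have f_mult: "f (m \<otimes>\<^bsub>base\<^esub> n) = f m \<otimes>\<^bsub>base\<^esub> f n" if "m \<in> carrier base" "n \<in> carrier base" for m n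
  proof -
    have "h ((m, \<one>\<^bsub>G\<^esub>) \<otimes>\<^bsub>wreath\<^esub> (n, \<one>\<^bsub>G\<^esub>)) = h (m, \<one>\<^bsub>G\<^esub>) \<otimes>\<^bsub>wreath\<^esub> h (n, \<one>\<^bsub>G\<^esub>)"
      using that by simp
    then show ?thesis using that by (simp add: wreath_mult h_base f_base)
  qed
  have f_shift: "f (shift G g m) = shift G (\<eta> g) (f m)" if "m \<in> carrier base" "g \<in> carrier G" for m g
  proof -
    define n where "n = fst (h (\<one>\<^bsub>base\<^esub>, g))"
    have h1: "h (\<one>\<^bsub>base\<^esub>, g) = (n, \<eta> g)" by (simp add: n_def \<eta>_def)
    then have n: "h (\<one>\<^bsub>base\<^esub>, g) = (n, \<eta> g)" "n \<in> carrier base"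
      using h.hom_closed[of "(\<one>\<^bsub>base\<^esub>, g)"] that by simp_all
    have "h ((\<one>\<^bsub>base\<^esub>, g) \<otimes>\<^bsub>wreath\<^esub> (m, \<one>\<^bsub>G\<^esub>)) = h ((shift G g m, \<one>\<^bsub>G\<^esub>) \<otimes>\<^bsub>wreath\<^esub> (\<one>\<^bsub>base\<^esub>, g))"
      using that by (simp add: wreath_conj_base)
    then have "(n, \<eta> g) \<otimes>\<^bsub>wreath\<^esub> (f m, \<one>\<^bsub>G\<^esub>) = (f (shift G g m), \<one>\<^bsub>G\<^esub>) \<otimes>\<^bsub>wreath\<^esub> (n, \<eta> g)"
      using that n by (simp add: h_base shift_base)
    then have "(shift G (\<eta> g) (f m), \<one>\<^bsub>G\<^esub>) \<otimes>\<^bsub>wreath\<^esub> (n, \<eta> g) = (f (shift G g m), \<one>\<^bsub>G\<^esub>) \<otimes>\<^bsub>wreath\<^esub> (n, \<eta> g)"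
      using that n by (simp add: wreath_conj_base f_base)
    then show ?thesis using that n by (simp add: f_base shift_base)
  qed
  have f_onto: "\<exists>m\<in>carrier base. f m = n" if "n \<in> carrier base" for n
  proof -
    have "(n, \<one>\<^bsub>G\<^esub>) \<in> h ` carrier wreath" using onto that by simp
    then obtain m g where mg: "(n, \<one>\<^bsub>G\<^esub>) = h (m, g)" "m \<in> carrier base" "g \<in> carrier G"
      by (auto simp: wreath_carrier)
    then have g: "g = \<one>\<^bsub>G\<^esub>" using snd_h[OF mg(2,3)] \<eta>_one[of g] by (simp flip: mg(1))
    have "f m = n" unfolding f_def mg(1)[unfolded g, symmetric] by simp
    then show ?thesis using mg(2) by blast
  qed
  \<comment> \<open>The twist that compensates for \<open>\<eta>\<close> in \<open>f_shift\<close>.\<close>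
  define tw where "tw = (\<lambda>m :: 'g \<Rightarrow> 'a. \<lambda>x\<in>carrier G. m (\<eta> x))"
  have tw_apply: "tw m x = m (\<eta> x)" if "x \<in> carrier G" for m x using that by (simp add: tw_def)
  have tw_base: "tw m \<in> carrier base" if m: "m \<in> carrier base" for m
  proof -
    have "finite (\<eta> -` supp m \<inter> carrier G)"
      using bij m by (intro finite_vimage_IntI) (auto simp: bij_betw_def base_carrier)
    moreover have "supp (tw m) = \<eta> -` supp m \<inter> carrier G"
      using \<eta>.hom_closed tw_apply by fastforce
    ultimately have "finite (supp (tw m))" by simp
    moreover have "tw m \<in> carrier G \<rightarrow>\<^sub>E carrier A"
      using base_value[OF m] by (simp add: tw_def)
    ultimately show ?thesis by (simp add: base_carrier)
  qed
  have tw_onto: "\<exists>m\<in>carrier base. tw m = n" if n: "n \<in> carrier base" for n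
  proof
    define \<iota> where "\<iota> = inv_into (carrier G) \<eta>"
    have i: "\<iota> x \<in> carrier G" "\<eta> (\<iota> x) = x" "\<iota> (\<eta> x) = x" if "x \<in> carrier G" for x
      using that bij by (auto simp: \<iota>_def bij_betw_def f_inv_into_f inv_into_into)
    let ?m = "\<lambda>x\<in>carrier G. n (\<iota> x)"
    have "supp ?m \<subseteq> \<eta> ` supp n" using i by (force simp: image_iff)
    moreover have "finite (supp n)" using n by (simp add: base_carrier)
    ultimately have "finite (supp ?m)" by (meson finite_imageI finite_subset)
    then show m: "?m \<in> carrier base" using n i by (auto simp: base_carrier)
    show "tw ?m = n" by (rule base_ext[OF tw_base[OF m] n]) (simp add: tw_apply i)
  qed
  let ?\<theta> = "\<lambda>m. tw (f m)"
  have \<theta>_hom: "?\<theta> \<in> hom base base"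
  proof (rule homI)
    fix m n assume mn: "m \<in> carrier base" "n \<in> carrier base"
    show "?\<theta> m \<in> carrier base" using mn by (simp add: tw_base f_base)
    show "?\<theta> (m \<otimes>\<^bsub>base\<^esub> n) = ?\<theta> m \<otimes>\<^bsub>base\<^esub> ?\<theta> n"
      using mn by (intro base_ext) (auto simp: tw_base f_base f_mult tw_apply)
  qed
  have \<theta>_eqv: "?\<theta> (shift G g m) = shift G g (?\<theta> m)" if "g \<in> carrier G" "m \<in> carrier base" for g m
    using that by (intro base_ext) (auto simp: tw_base f_base f_shift shift_base tw_apply)
  obtain S k where ca: "automaton A G S k"
    and eq: "\<And>u. u \<in> carrier base \<Longrightarrow> ?\<theta> u = cellular_automaton A G S k u"
    using equivariant_hom_is_automaton[OF \<theta>_hom \<theta>_eqv fg] by metis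
  have "cellular_automaton A G S k ` carrier base = carrier base"
  proof
    show "cellular_automaton A G S k ` carrier base \<subseteq> carrier base"
      using automaton.ca_base[OF ca] by auto
    show "carrier base \<subseteq> cellular_automaton A G S k ` carrier base"
    proof
      fix n assume "n \<in> carrier base"
      then obtain m m' where "m \<in> carrier base" "n = tw m" "m' \<in> carrier base" "m = f m'"
        using tw_onto f_onto by metis
      then show "n \<in> cellular_automaton A G S k ` carrier base" using eq by (metis image_eqI)
    qed
  qed
  note inj_ca = automaton_hopfian[OF au ca this]
  have f_one: "m = \<one>\<^bsub>base\<^esub>" if m: "m \<in> carrier base" "f m = \<one>\<^bsub>base\<^esub>" for m
  proof -
    have "?\<theta> m = \<one>\<^bsub>base\<^esub>" using m by (intro base_ext) (auto simp: tw_base f_base tw_apply)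
    then show ?thesis using inj_ca eq m by metis
  qed
  have "kernel wreath wreath h = {\<one>\<^bsub>wreath\<^esub>}"
  proof
    show "kernel wreath wreath h \<subseteq> {\<one>\<^bsub>wreath\<^esub>}"
    proof
      fix w assume w: "w \<in> kernel wreath wreath h"
      then obtain m g where mg: "w = (m, g)" "m \<in> carrier base" "g \<in> carrier G" "h (m, g) = \<one>\<^bsub>wreath\<^esub>"
        by (auto simp: kernel_def wreath_carrier)
      then have "g = \<one>\<^bsub>G\<^esub>" using snd_h[of m g] \<eta>_one[of g] by (simp add: wreath_one)
      then show "w \<in> {\<one>\<^bsub>wreath\<^esub>}" using mg h_base f_one by (simp add: wreath_one)
    qed
  qed (auto simp: kernel_def)
  then have "inj_on h (carrier wreath)" by (rule h.trivial_ker_imp_inj)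
  then show ?thesis using hh onto by (simp add: iso_def bij_betw_def)
qed

text \<open>The base group can only fail to be preserved if \<open>G\<close> is finite; in that case \<open>A\<close> is finitely generated of
exponent two, hence finite, and a finite group is Hopfian.\<close>

theorem hopfian_wreath_if:
  assumes hop: "hopfian G" and au: "hopfian_automata A G" and fg: "finitely_generated A"
  shows "hopfian wreath"
  unfolding hopfian_def
proof
  fix h assume h: "h \<in> epi wreath wreath"
  show "h \<in> iso wreath wreath"
  proof (cases "\<forall>m\<in>carrier base. snd (h (m, \<one>\<^bsub>G\<^esub>)) = \<one>\<^bsub>G\<^esub>")
    case True
    then show ?thesis using epi_preserving_base_iso[OF hop au fg h] by blast
  next
    case False
    then obtain m0 where m0: "m0 \<in> carrier base" "snd (h (m0, \<one>\<^bsub>G\<^esub>)) \<noteq> \<one>\<^bsub>G\<^esub>" by blast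
    have G: "finite (carrier G)" using epi_preserves_base[OF hop _ h m0(1)] m0(2) by blast
    obtain n0 z where z: "h (m0, \<one>\<^bsub>G\<^esub>) = (n0, z)" by (metis surj_pair)
    interpret abelian_normal_in_wreath A G "(\<lambda>m. h (m, \<one>\<^bsub>G\<^esub>)) ` carrier base" n0 z
      by (rule epi_image_of_base_abelian_normal[OF h m0 z refl])
    obtain T where T: "finite T" "T \<subseteq> carrier A" "generate A T = carrier A"
      using fg by (auto simp: finitely_generated_def)
    have "finite (generate A T)"
      using A_exponent_two T(2) by (intro A.finite_of_bounded_exponent[OF T(1,2), of 2])
        (auto simp: numeral_2_eq_2 subset_iff)
    then have "finite (carrier G \<rightarrow>\<^sub>E carrier A)" using T G by (simp add: finite_PiE)
    then have "finite (carrier base)" by (rule rev_finite_subset) (auto simp: base_carrier)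
    then have "finite (carrier wreath)" using G by (simp add: wreath_carrier)
    then show ?thesis using W.surj_finite_iso h by blast
  qed
qed

text \<open>The map of \<open>\<Oplus>\<^sub>G A\<close> induced by \<open>f\<close>; for a ring \<open>A\<close> it is the homomorphism of group rings extending
\<open>f\<close>.\<close>

definition push_forward :: "('g \<Rightarrow> 'g) \<Rightarrow> ('g \<Rightarrow> 'a) \<Rightarrow> 'g \<Rightarrow> 'a"
  where "push_forward f u = (\<lambda>x\<in>carrier G. \<Otimes>\<^bsub>A\<^esub>y\<in>supp u. if f y = x then u y else \<one>\<^bsub>A\<^esub>)"

lemma push_forward_superset:
  assumes "u \<in> carrier base" "finite E" "supp u \<subseteq> E" "E \<subseteq> carrier G" "x \<in> carrier G"
  shows "push_forward f u x = (\<Otimes>\<^bsub>A\<^esub>y\<in>E. if f y = x then u y else \<one>\<^bsub>A\<^esub>)"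
  using assms base_value[OF assms(1)] unfolding push_forward_def
  by (auto intro!: A.finprod_mono_neutral_cong_left split: if_splits)

lemma push_forward_base:
  assumes u: "u \<in> carrier base"
  shows "push_forward f u \<in> carrier base"
proof -
  have fin: "finite (supp u)" using u by (simp add: base_carrier)
  have "supp (push_forward f u) \<subseteq> f ` supp u"
  proof
    fix x assume x: "x \<in> supp (push_forward f u)"
    show "x \<in> f ` supp u"
    proof (rule ccontr)
      assume "x \<notin> f ` supp u"
      then have "push_forward f u x = \<one>\<^bsub>A\<^esub>"
        using x by (auto simp: push_forward_def intro!: A.finprod_one_eqI)
      then show False using x by simp
    qed
  qed
  then have "finite (supp (push_forward f u))" using fin by (meson finite_imageI finite_subset)
  then show ?thesis
    using base_value[OF u] by (auto simp: base_carrier push_forward_def intro!: A.finprod_closed)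
qed

lemma push_forward_mult:
  assumes u: "u \<in> carrier base" and v: "v \<in> carrier base"
  shows "push_forward f (u \<otimes>\<^bsub>base\<^esub> v) = push_forward f u \<otimes>\<^bsub>base\<^esub> push_forward f v"
proof (rule base_ext)
  fix x assume x: "x \<in> carrier G"
  let ?E = "supp u \<union> supp v"
  have E: "finite ?E" "?E \<subseteq> carrier G" using u v by (auto simp: base_carrier)
  have "supp (u \<otimes>\<^bsub>base\<^esub> v) \<subseteq> ?E" by auto
  then have "push_forward f (u \<otimes>\<^bsub>base\<^esub> v) x
      = (\<Otimes>\<^bsub>A\<^esub>y\<in>?E. if f y = x then (u \<otimes>\<^bsub>base\<^esub> v) y else \<one>\<^bsub>A\<^esub>)"
    using u v x E by (intro push_forward_superset) auto
  also have "\<dots> = (\<Otimes>\<^bsub>A\<^esub>y\<in>?E. (if f y = x then u y else \<one>\<^bsub>A\<^esub>) \<otimes>\<^bsub>A\<^esub> (if f y = x then v y else \<one>\<^bsub>A\<^esub>))"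
    using base_value[OF u] base_value[OF v] by (intro A.finprod_cong') auto
  also have "\<dots> = push_forward f u x \<otimes>\<^bsub>A\<^esub> push_forward f v x"
    using base_value[OF u] base_value[OF v] E x
    by (subst A.finprod_multf) (auto simp: push_forward_superset[OF u E(1)] push_forward_superset[OF v E(1)])
  finally show "push_forward f (u \<otimes>\<^bsub>base\<^esub> v) x = (push_forward f u \<otimes>\<^bsub>base\<^esub> push_forward f v) x"
    using x by simp
qed (use u v in \<open>auto simp: push_forward_base\<close>)

lemma push_forward_point_mass:
  assumes "a \<in> carrier A" "y \<in> carrier G"
  shows "push_forward f (point_mass A G a y) = point_mass A G a (f y)"
proof (rule ext)
  fix x
  show "push_forward f (point_mass A G a y) x = point_mass A G a (f y) x"
  proof (cases "x \<in> carrier G")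
    case True
    have "push_forward f (point_mass A G a y) x = (\<Otimes>\<^bsub>A\<^esub>t\<in>{y}. if f t = x then point_mass A G a y t else \<one>\<^bsub>A\<^esub>)"
      using assms True by (intro push_forward_superset) (auto simp: point_mass_base, auto simp: point_mass_def split: if_splits)
    then show ?thesis using assms True by (auto simp: point_mass_def)
  qed (simp add: push_forward_def point_mass_def)
qed

lemma push_forward_shift:
  assumes f: "f \<in> hom G G" and u: "u \<in> carrier base" and g: "g \<in> carrier G"
  shows "push_forward f (shift G g u) = shift G (f g) (push_forward f u)"
proof (rule base_ext)
  interpret f: group_hom G G f by unfold_locales (rule f)
  fix x assume x: "x \<in> carrier G"
  let ?E = "(\<lambda>y. g \<otimes>\<^bsub>G\<^esub> y) ` supp u"
  have fin: "finite (supp u)" using u by (simp add: base_carrier)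
  have sub: "supp (shift G g u) \<subseteq> ?E"
  proof
    fix y assume y: "y \<in> supp (shift G g u)"
    then have "y = g \<otimes>\<^bsub>G\<^esub> (inv\<^bsub>G\<^esub> g \<otimes>\<^bsub>G\<^esub> y)" "inv\<^bsub>G\<^esub> g \<otimes>\<^bsub>G\<^esub> y \<in> supp u"
      using g by (auto simp flip: G.m_assoc)
    then show "y \<in> ?E" by blast
  qed
  have "push_forward f (shift G g u) x = (\<Otimes>\<^bsub>A\<^esub>y\<in>?E. if f y = x then shift G g u y else \<one>\<^bsub>A\<^esub>)"
    using fin sub g u x by (intro push_forward_superset) (auto simp: shift_base)
  also have "\<dots> = (\<Otimes>\<^bsub>A\<^esub>y\<in>supp u. if f (g \<otimes>\<^bsub>G\<^esub> y) = x then shift G g u (g \<otimes>\<^bsub>G\<^esub> y) else \<one>\<^bsub>A\<^esub>)"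
    using g base_value[OF shift_base[OF g u]] by (intro A.finprod_reindex) (auto simp: inj_on_def)
  also have "\<dots> = (\<Otimes>\<^bsub>A\<^esub>y\<in>supp u. if f y = inv\<^bsub>G\<^esub> (f g) \<otimes>\<^bsub>G\<^esub> x then u y else \<one>\<^bsub>A\<^esub>)"
    using g x base_value[OF u] f.hom_closed
    by (intro A.finprod_cong') (auto simp: G.inv_solve_left simp flip: G.m_assoc)
  also have "\<dots> = push_forward f u (inv\<^bsub>G\<^esub> (f g) \<otimes>\<^bsub>G\<^esub> x)"
    using g x by (simp add: push_forward_def)
  finally show "push_forward f (shift G g u) x = shift G (f g) (push_forward f u) x"
    using x by simp
next
  have "f g \<in> carrier G" using f g by (auto simp: hom_def)
  then show "shift G (f g) (push_forward f u) \<in> carrier base"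
    using u by (simp add: push_forward_base shift_base)
qed (use u g in \<open>simp add: push_forward_base shift_base\<close>)

lemma push_forward_onto:
  assumes "f ` carrier G = carrier G" "u \<in> carrier base"
  shows "\<exists>v\<in>carrier base. push_forward f v = u"
  using assms(2)
proof (induction rule: base_induct)
  case zero
  have "push_forward f zero = zero" by (auto simp: push_forward_def)
  then show ?case using zero_base by blast
next
  case (point a y u)
  then obtain v where v: "v \<in> carrier base" "push_forward f v = u" by blast
  have "y \<in> f ` carrier G" using assms(1) point(2) by simp
  then obtain y' where y': "y' \<in> carrier G" "f y' = y" by blast
  have "push_forward f (point_mass A G a y' \<otimes>\<^bsub>base\<^esub> v) = push_forward f (point_mass A G a y') \<otimes>\<^bsub>base\<^esub> push_forward f v"
    by (rule push_forward_mult[OF point_mass_base[OF point(1)] v(1)])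
  also have "\<dots> = point_mass A G a y \<otimes>\<^bsub>base\<^esub> u"
    by (simp only: push_forward_point_mass[OF point(1) y'(1)] v(2) y'(2))
  finally have "push_forward f (point_mass A G a y' \<otimes>\<^bsub>base\<^esub> v) = point_mass A G a y \<otimes>\<^bsub>base\<^esub> u" .
  moreover have "point_mass A G a y' \<otimes>\<^bsub>base\<^esub> v \<in> carrier base"
    using v(1) point(1) by (simp add: point_mass_base)
  ultimately show ?case by (rule bexI)
qed

theorem hopfian_factor_of_wreath:
  assumes hop: "hopfian wreath"
  shows "hopfian G"
  unfolding hopfian_def
proof
  fix f assume "f \<in> epi G G"
  then have f: "f \<in> hom G G" and onto: "f ` carrier G = carrier G" by (auto simp: epi_def)
  interpret f: group_hom G G f by unfold_locales (rule f)
  define F where "F = (\<lambda>(m, g). (push_forward f m, f g))"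
  have "F \<in> hom wreath wreath"
  proof (rule homI)
    fix v w assume "v \<in> carrier wreath" "w \<in> carrier wreath"
    then obtain m g n h where vw: "v = (m, g)" "w = (n, h)" "m \<in> carrier base" "n \<in> carrier base"
      "g \<in> carrier G" "h \<in> carrier G" by (auto simp: wreath_carrier)
    then show "F v \<in> carrier wreath" by (simp add: F_def push_forward_base)
    show "F (v \<otimes>\<^bsub>wreath\<^esub> w) = F v \<otimes>\<^bsub>wreath\<^esub> F w"
      using vw by (simp add: F_def wreath_mult push_forward_mult push_forward_shift[OF f] shift_base)
  qed
  moreover have "carrier wreath \<subseteq> F ` carrier wreath"
  proof
    fix w assume "w \<in> carrier wreath"
    then obtain n h where w: "w = (n, h)" "n \<in> carrier base" "h \<in> carrier G" by (auto simp: wreath_carrier)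
    obtain m where m: "m \<in> carrier base" "push_forward f m = n" using push_forward_onto[OF onto w(2)] by blast
    have "h \<in> f ` carrier G" using onto w(3) by simp
    then obtain g where g: "g \<in> carrier G" "f g = h" by blast
    have "w = F (m, g)" using w m g by (simp add: F_def)
    then show "w \<in> F ` carrier wreath" using m g by simp
  qed
  ultimately have "F \<in> epi wreath wreath" by (auto simp: epi_def hom_in_carrier)
  then have inj: "inj_on F (carrier wreath)" using hop by (auto simp: hopfian_def iso_def bij_betw_def)
  have "inj_on f (carrier G)"
  proof (rule inj_onI)
    fix x y assume "x \<in> carrier G" "y \<in> carrier G" "f x = f y"
    then show "x = y" using inj_onD[OF inj, of "(\<one>\<^bsub>base\<^esub>, x)" "(\<one>\<^bsub>base\<^esub>, y)"]
      by (simp add: F_def)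
  qed
  then show "f \<in> iso G G" using f onto by (simp add: iso_def bij_betw_def)
qed

end

section \<open>Kaplansky's theorem on one-sided inverses\<close>

text \<open>The free module of rank \<open>card I\<close> over the real group algebra of \<open>G\<close>, written as finitely supported real
functions on \<open>carrier G \<times> I\<close> with left translations.\<close>

locale real_group_module = group G for G :: "('g, 'x) monoid_scheme" (structure) +
  fixes I :: "'i set"
  assumes finite_I: "finite I"
begin

definition vectors :: "('g \<times> 'i \<Rightarrow> real) set"
  where "vectors = {v. finite {x. v x \<noteq> 0} \<and> {x. v x \<noteq> 0} \<subseteq> carrier G \<times> I}"

definition translate :: "'g \<Rightarrow> ('g \<times> 'i \<Rightarrow> real) \<Rightarrow> 'g \<times> 'i \<Rightarrow> real"
  where "translate g v = (\<lambda>(x, i). if x \<in> carrier G then v (inv g \<otimes> x, i) else 0)"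

definition unit_at :: "'g \<times> 'i \<Rightarrow> 'g \<times> 'i \<Rightarrow> real"
  where "unit_at y = (\<lambda>x. if x = y then 1 else 0)"

definition ip :: "('g \<times> 'i \<Rightarrow> real) \<Rightarrow> ('g \<times> 'i \<Rightarrow> real) \<Rightarrow> real"
  where "ip u v = (\<Sum>x | u x \<noteq> 0. u x * v x)"

definition equivariant_linear :: "(('g \<times> 'i \<Rightarrow> real) \<Rightarrow> 'g \<times> 'i \<Rightarrow> real) \<Rightarrow> bool"
  where "equivariant_linear T \<longleftrightarrow>
    (\<forall>v\<in>vectors. T v \<in> vectors) \<and>
    (\<forall>u\<in>vectors. \<forall>v\<in>vectors. \<forall>c. T (\<lambda>x. u x + c * v x) = (\<lambda>x. T u x + c * T v x)) \<and>
    (\<forall>g\<in>carrier G. \<forall>v\<in>vectors. T (translate g v) = translate g (T v))"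

text \<open>Kaplansky's trace: the sum of the diagonal coefficients at the identity of \<open>G\<close>, for a matrix over the
group algebra.\<close>

definition trace :: "(('g \<times> 'i \<Rightarrow> real) \<Rightarrow> 'g \<times> 'i \<Rightarrow> real) \<Rightarrow> real"
  where "trace T = (\<Sum>i\<in>I. T (unit_at (\<one>, i)) (\<one>, i))"

lemma vectors_outside: "v \<in> vectors \<Longrightarrow> x \<notin> carrier G \<times> I \<Longrightarrow> v x = 0"
  by (auto simp: vectors_def)

lemma vectors_finite: "v \<in> vectors \<Longrightarrow> finite {x. v x \<noteq> 0}"
  by (auto simp: vectors_def)

lemma vectors_comb:
  assumes "u \<in> vectors" "v \<in> vectors"
  shows "(\<lambda>x. u x + c * v x) \<in> vectors"
proof -
  have "{x. u x + c * v x \<noteq> 0} \<subseteq> {x. u x \<noteq> 0} \<union> {x. v x \<noteq> 0}" by auto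
  moreover have "finite ({x. u x \<noteq> 0} \<union> {x. v x \<noteq> 0})" "{x. u x \<noteq> 0} \<union> {x. v x \<noteq> 0} \<subseteq> carrier G \<times> I"
    using assms by (simp_all add: vectors_def)
  ultimately show ?thesis unfolding vectors_def by (simp add: finite_subset subset_trans)
qed

lemma vectors_diff: "u \<in> vectors \<Longrightarrow> v \<in> vectors \<Longrightarrow> (\<lambda>x. u x - v x) \<in> vectors"
  using vectors_comb[of u v "-1"] by simp

lemma vectors_zero: "(\<lambda>x. 0) \<in> vectors" by (simp add: vectors_def)

lemma vectors_sum:
  assumes "\<And>y. y \<in> E \<Longrightarrow> w y \<in> vectors"
  shows "(\<lambda>x. \<Sum>y\<in>E. c y * w y x) \<in> vectors"
  using assms
proof (induction E rule: infinite_finite_induct)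
  case (insert y E)
  then show ?case using vectors_comb[of "\<lambda>x. \<Sum>y\<in>E. c y * w y x" "w y" "c y"]
    by (simp add: add.commute)
qed (auto simp: vectors_zero)

lemma unit_at_vectors: "y \<in> carrier G \<times> I \<Longrightarrow> unit_at y \<in> vectors"
  by (auto simp: unit_at_def vectors_def)

lemma translate_vectors:
  assumes g: "g \<in> carrier G" and v: "v \<in> vectors"
  shows "translate g v \<in> vectors"
proof -
  have "{x. translate g v x \<noteq> 0} \<subseteq> (\<lambda>(x, i). (g \<otimes> x, i)) ` {x. v x \<noteq> 0}"
  proof
    fix xi assume "xi \<in> {x. translate g v x \<noteq> 0}"
    then obtain x i where xi: "xi = (x, i)" "x \<in> carrier G" "v (inv g \<otimes> x, i) \<noteq> 0"
      by (cases xi) (auto simp: translate_def split: if_splits)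
    then have "xi = (\<lambda>(x, i). (g \<otimes> x, i)) (inv g \<otimes> x, i)" using g by (simp flip: m_assoc)
    then show "xi \<in> (\<lambda>(x, i). (g \<otimes> x, i)) ` {x. v x \<noteq> 0}" using xi by blast
  qed
  moreover have "finite ((\<lambda>(x, i). (g \<otimes> x, i)) ` {x. v x \<noteq> 0})"
    using v by (simp add: vectors_def)
  moreover have "{x. translate g v x \<noteq> 0} \<subseteq> carrier G \<times> I"
  proof
    fix xi assume "xi \<in> {x. translate g v x \<noteq> 0}"
    then obtain x i where "xi = (x, i)" "x \<in> carrier G" "v (inv g \<otimes> x, i) \<noteq> 0"
      by (cases xi) (auto simp: translate_def split: if_splits)
    then show "xi \<in> carrier G \<times> I" using vectors_outside[OF v, of "(inv g \<otimes> x, i)"] by auto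
  qed
  ultimately show ?thesis unfolding vectors_def by (simp add: finite_subset)
qed

lemma translate_unit_at:
  assumes "g \<in> carrier G" "y \<in> carrier G"
  shows "translate g (unit_at (y, i)) = unit_at (g \<otimes> y, i)"
proof
  fix xj :: "'g \<times> 'i"
  obtain x j where xj: "xj = (x, j)" by (cases xj)
  have "inv g \<otimes> x = y \<longleftrightarrow> x = g \<otimes> y" if "x \<in> carrier G"
    using that assms by (metis inv_closed inv_solve_left m_closed)
  then show "translate g (unit_at (y, i)) xj = unit_at (g \<otimes> y, i) xj"
    using assms by (auto simp: translate_def unit_at_def xj)
qed

lemma translate_translate:
  assumes "g \<in> carrier G" "h \<in> carrier G" "v \<in> vectors"
  shows "translate g (translate h v) = translate (g \<otimes> h) v"
  using assms by (auto simp: translate_def fun_eq_iff inv_mult_group m_assoc)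

lemma translate_one: "v \<in> vectors \<Longrightarrow> translate \<one> v = v"
  by (auto simp: translate_def fun_eq_iff vectors_outside)

lemma ip_superset:
  assumes "finite E" "{x. u x \<noteq> 0} \<subseteq> E"
  shows "ip u v = (\<Sum>x\<in>E. u x * v x)"
  unfolding ip_def using assms by (intro sum.mono_neutral_left) auto

lemma ip_commute:
  assumes "u \<in> vectors" "v \<in> vectors"
  shows "ip u v = ip v u"
proof -
  let ?E = "{x. u x \<noteq> 0} \<union> {x. v x \<noteq> 0}"
  have "finite ?E" using assms by (simp add: vectors_def)
  then show ?thesis by (simp add: ip_superset[of ?E] mult.commute)
qed

lemma ip_comb_left:
  assumes "u \<in> vectors" "v \<in> vectors"
  shows "ip (\<lambda>x. u x + c * v x) w = ip u w + c * ip v w"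
proof -
  let ?E = "{x. u x \<noteq> 0} \<union> {x. v x \<noteq> 0}"
  have "finite ?E" using assms by (simp add: vectors_def)
  then show ?thesis
    by (subst (1 2 3) ip_superset[of ?E])
       (auto simp: algebra_simps sum.distrib sum_distrib_left)
qed

lemma ip_diff_left:
  "u \<in> vectors \<Longrightarrow> v \<in> vectors \<Longrightarrow> ip (\<lambda>x. u x - v x) w = ip u w - ip v w"
  using ip_comb_left[of u v "-1" w] by simp

lemma ip_self_nonneg: "ip u u \<ge> 0" unfolding ip_def by (intro sum_nonneg) auto

lemma square_le_ip:
  assumes "u \<in> vectors" shows "(u x)\<^sup>2 \<le> ip u u"
proof -
  have "(u x)\<^sup>2 \<le> (\<Sum>x\<in>insert x {x. u x \<noteq> 0}. u x * u x)"
    using assms by (auto simp: power2_eq_square vectors_def intro!: member_le_sum)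
  also have "\<dots> = ip u u" using assms by (subst ip_superset) (auto simp: vectors_def)
  finally show ?thesis .
qed

lemma abs_le_norm: "u \<in> vectors \<Longrightarrow> \<bar>u x\<bar> \<le> sqrt (ip u u)"
  using square_le_ip by (metis real_sqrt_abs real_sqrt_le_mono)

lemma ip_unit_at: "ip (unit_at y) v = v y"
  by (subst ip_superset[of "{y}"]) (auto simp: unit_at_def)

lemma ip_translate:
  assumes g: "g \<in> carrier G" and u: "u \<in> vectors" and v: "v \<in> vectors"
  shows "ip (translate g u) (translate g v) = ip u v"
proof -
  let ?s = "\<lambda>(x, i). (g \<otimes> x, i :: 'i)"
  let ?E = "{x. u x \<noteq> 0}"
  have E: "finite ?E" "\<And>x i. u (x, i) \<noteq> 0 \<Longrightarrow> x \<in> carrier G"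
    using vectors_finite[OF u] vectors_outside[OF u] by auto
  have sub: "{x. translate g u x \<noteq> 0} \<subseteq> ?s ` ?E"
  proof
    fix xi assume "xi \<in> {x. translate g u x \<noteq> 0}"
    then obtain x i where xi: "xi = (x, i)" "x \<in> carrier G" "u (inv g \<otimes> x, i) \<noteq> 0"
      by (cases xi) (auto simp: translate_def split: if_splits)
    then have "xi = ?s (inv g \<otimes> x, i)" using g by (simp flip: m_assoc)
    then show "xi \<in> ?s ` ?E" using xi by blast
  qed
  have "ip (translate g u) (translate g v) = (\<Sum>x\<in>?s ` ?E. translate g u x * translate g v x)"
    using E sub by (intro ip_superset) auto
  also have "\<dots> = (\<Sum>x\<in>?E. translate g u (?s x) * translate g v (?s x))"
    using E g by (subst sum.reindex) (auto simp: inj_on_def)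
  also have "\<dots> = (\<Sum>x\<in>?E. u x * v x)"
    using E g by (intro sum.cong) (auto simp: translate_def simp flip: m_assoc)
  finally show ?thesis by (simp add: ip_def)
qed

lemma linear_comb:
  "equivariant_linear T \<Longrightarrow> u \<in> vectors \<Longrightarrow> v \<in> vectors
    \<Longrightarrow> T (\<lambda>x. u x + c * v x) = (\<lambda>x. T u x + c * T v x)"
  by (simp add: equivariant_linear_def)

text \<open>An equivariant map is a kernel: its values are finite combinations of its values on unit vectors.\<close>

lemma linear_expand:
  assumes T: "equivariant_linear T" and v: "v \<in> vectors" and E: "finite E" "{x. v x \<noteq> 0} \<subseteq> E" "E \<subseteq> carrier G \<times> I"
  shows "T v x = (\<Sum>y\<in>E. v y * T (unit_at y) x)"
  using E v
proof (induction E arbitrary: v x rule: finite_induct)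
  case empty
  then have "v = (\<lambda>x. 0)" by auto
  moreover have "T (\<lambda>x. 0) x = 0"
  proof -
    show ?thesis using fun_cong[OF linear_comb[OF T vectors_zero vectors_zero, of 1], of x] by simp
  qed
  ultimately show ?case by simp
next
  case (insert y E)
  define w where "w = (\<lambda>x. if x = y then 0 else v x)"
  have w: "w \<in> vectors" using insert.prems(3) unfolding vectors_def w_def
    by (auto elim: rev_finite_subset)
  have wE: "{x. w x \<noteq> 0} \<subseteq> E" using insert.prems by (auto simp: w_def)
  have uy: "unit_at y \<in> vectors" using insert.prems by (intro unit_at_vectors) auto
  have "v = (\<lambda>x. w x + v y * unit_at y x)" by (auto simp: w_def unit_at_def)
  then have "T v = (\<lambda>x. T w x + v y * T (unit_at y) x)"
    using T w uy unfolding equivariant_linear_def by metis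
  moreover have "T w x = (\<Sum>z\<in>E. w z * T (unit_at z) x)"
    using insert.IH[OF wE _ w] insert.prems by auto
  moreover have "(\<Sum>z\<in>E. w z * T (unit_at z) x) = (\<Sum>z\<in>E. v z * T (unit_at z) x)"
    using insert.hyps by (intro sum.cong) (auto simp: w_def)
  ultimately show ?case using insert.hyps by simp
qed

lemma linear_diff:
  assumes "equivariant_linear T" "u \<in> vectors" "v \<in> vectors"
  shows "T (\<lambda>x. u x - v x) = (\<lambda>x. T u x - T v x)"
proof -
  show ?thesis using linear_comb[OF assms, of "-1"] by simp
qed

lemma unit_coeff_shift:
  assumes T: "equivariant_linear T" and "h \<in> carrier G" "i \<in> I" "j \<in> I"
  shows "T (unit_at (h, j)) (\<one>, i) = T (unit_at (\<one>, j)) (inv h, i)"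
proof -
  have "T (unit_at (h, j)) = translate h (T (unit_at (\<one>, j)))"
    using assms translate_unit_at[of h "\<one>" j] unit_at_vectors[of "(\<one>, j)"]
    unfolding equivariant_linear_def by (metis SigmaI one_closed r_one)
  then show ?thesis using assms by (simp add: translate_def)
qed

text \<open>Both traces are sums of the products \<open>T\<^sub>j\<^sub>i(h) S\<^sub>i\<^sub>j(h\<inverse>)\<close> of matrix coefficients, and \<open>h \<mapsto> h\<inverse>\<close> exchanges them.
The set \<open>H\<close> is a finite symmetric set carrying all coefficients involved.\<close>

lemma trace_commute:
  assumes S: "equivariant_linear S" and T: "equivariant_linear T"
  shows "trace (\<lambda>v. S (T v)) = trace (\<lambda>v. T (S v))"
proof -
  define J where "J = (\<Union>i\<in>I. fst ` ({x. S (unit_at (\<one>, i)) x \<noteq> 0} \<union> {x. T (unit_at (\<one>, i)) x \<noteq> 0}))"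
  define H where "H = J \<union> (\<lambda>x. inv x) ` J"
  have u: "unit_at (\<one>, i) \<in> vectors" if "i \<in> I" for i using that by (simp add: unit_at_vectors)
  have SV: "S v \<in> vectors" and TV: "T v \<in> vectors" if "v \<in> vectors" for v
    using S T that by (auto simp: equivariant_linear_def)
  have J: "finite J" "J \<subseteq> carrier G"
  proof -
    show "finite J" unfolding J_def using finite_I u SV TV vectors_finite by auto
    show "J \<subseteq> carrier G" unfolding J_def using SV[OF u] TV[OF u] vectors_outside by fastforce
  qed
  have H: "finite H" "H \<subseteq> carrier G" "(\<lambda>x. inv x) ` H = H"
    using J by (auto simp: H_def image_Un image_image subset_iff)
  have expand: "trace (\<lambda>v. A (B v)) = (\<Sum>i\<in>I. \<Sum>j\<in>I. \<Sum>h\<in>H. B (unit_at (\<one>, i)) (h, j) * A (unit_at (\<one>, j)) (inv h, i))"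
    if A: "equivariant_linear A" and B: "equivariant_linear B"
      and sub: "\<And>i. i \<in> I \<Longrightarrow> fst ` {x. B (unit_at (\<one>, i)) x \<noteq> 0} \<subseteq> H" for A B
    unfolding trace_def
  proof (intro sum.cong refl)
    fix i assume i: "i \<in> I"
    have Bi: "B (unit_at (\<one>, i)) \<in> vectors" using B u[OF i] by (auto simp: equivariant_linear_def)
    have "A (B (unit_at (\<one>, i))) (\<one>, i) = (\<Sum>y\<in>H \<times> I. B (unit_at (\<one>, i)) y * A (unit_at y) (\<one>, i))"
    proof (intro linear_expand[OF A Bi])
      show "finite (H \<times> I)" using H finite_I by simp
      show "{x. B (unit_at (\<one>, i)) x \<noteq> 0} \<subseteq> H \<times> I"
        using sub[OF i] Bi by (force simp: vectors_def)
      show "H \<times> I \<subseteq> carrier G \<times> I" using H by auto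
    qed
    also have "\<dots> = (\<Sum>h\<in>H. \<Sum>j\<in>I. B (unit_at (\<one>, i)) (h, j) * A (unit_at (h, j)) (\<one>, i))"
      by (simp add: sum.cartesian_product)
    also have "\<dots> = (\<Sum>j\<in>I. \<Sum>h\<in>H. B (unit_at (\<one>, i)) (h, j) * A (unit_at (h, j)) (\<one>, i))"
      by (rule sum.swap)
    also have "\<dots> = (\<Sum>j\<in>I. \<Sum>h\<in>H. B (unit_at (\<one>, i)) (h, j) * A (unit_at (\<one>, j)) (inv h, i))"
      using H i A by (intro sum.cong refl) (auto simp: unit_coeff_shift)
    finally show "A (B (unit_at (\<one>, i))) (\<one>, i) = \<dots>" .
  qed
  have "trace (\<lambda>v. S (T v)) = (\<Sum>i\<in>I. \<Sum>j\<in>I. \<Sum>h\<in>H. T (unit_at (\<one>, i)) (h, j) * S (unit_at (\<one>, j)) (inv h, i))"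
    by (rule expand[OF S T]) (auto simp: H_def J_def)
  also have "\<dots> = (\<Sum>j\<in>I. \<Sum>i\<in>I. \<Sum>h\<in>H. T (unit_at (\<one>, i)) (h, j) * S (unit_at (\<one>, j)) (inv h, i))"
    by (rule sum.swap)
  also have "\<dots> = (\<Sum>j\<in>I. \<Sum>i\<in>I. \<Sum>h\<in>H. S (unit_at (\<one>, j)) (h, i) * T (unit_at (\<one>, i)) (inv h, j))"
  proof (rule sum.cong[OF refl], rule sum.cong[OF refl])
    fix i j
    have "(\<Sum>h\<in>(\<lambda>x. inv x) ` H. S (unit_at (\<one>, j)) (h, i) * T (unit_at (\<one>, i)) (inv h, j))
        = (\<Sum>h\<in>H. S (unit_at (\<one>, j)) (inv h, i) * T (unit_at (\<one>, i)) (inv (inv h), j))"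
      using H by (subst sum.reindex) (auto simp: inj_on_def subset_iff)
    then show "(\<Sum>h\<in>H. T (unit_at (\<one>, i)) (h, j) * S (unit_at (\<one>, j)) (inv h, i))
        = (\<Sum>h\<in>H. S (unit_at (\<one>, j)) (h, i) * T (unit_at (\<one>, i)) (inv h, j))"
      using H by (auto simp: mult.commute subset_iff intro!: sum.cong)
  qed
  also have "\<dots> = trace (\<lambda>v. T (S v))"
    by (rule expand[OF T S, symmetric]) (auto simp: H_def J_def)
  finally show ?thesis .
qed

text \<open>The unit vectors at the identity form a basis of the free module, so prescribing their images defines an
equivariant linear map.\<close>

definition extend :: "('i \<Rightarrow> 'g \<times> 'i \<Rightarrow> real) \<Rightarrow> ('g \<times> 'i \<Rightarrow> real) \<Rightarrow> 'g \<times> 'i \<Rightarrow> real"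
  where "extend \<alpha> v = (\<lambda>x. \<Sum>z | v z \<noteq> 0. v z * (case z of (g, i) \<Rightarrow> translate g (\<alpha> i)) x)"

lemma extend_unit: "extend \<alpha> (unit_at (g, i)) = translate g (\<alpha> i)"
proof
  fix x
  have "{z. unit_at (g, i) z \<noteq> 0} = {(g, i)}" by (auto simp: unit_at_def)
  then show "extend \<alpha> (unit_at (g, i)) x = translate g (\<alpha> i) x" by (simp add: extend_def unit_at_def)
qed

lemma extend_linear:
  assumes \<alpha>: "\<And>i. i \<in> I \<Longrightarrow> \<alpha> i \<in> vectors"
  shows "equivariant_linear (extend \<alpha>)"
proof -
  define P where "P = extend \<alpha>"
  define p where "p = (\<lambda>(g, i). translate g (\<alpha> i))"
  have P_eq: "P v = (\<lambda>x. \<Sum>z | v z \<noteq> 0. v z * p z x)" for v by (simp add: P_def extend_def p_def)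
  have p_vec: "p z \<in> vectors" if "z \<in> carrier G \<times> I" for z
    using that \<alpha> by (auto simp: p_def translate_vectors)
  have supp: "{z. v z \<noteq> 0} \<subseteq> carrier G \<times> I" "finite {z. v z \<noteq> 0}" if "v \<in> vectors" for v
    using that by (auto simp: vectors_def)
  have P_superset: "P v x = (\<Sum>z\<in>E. v z * p z x)" if "finite E" "{z. v z \<noteq> 0} \<subseteq> E" for v x E
    unfolding P_eq using that by (intro sum.mono_neutral_left) auto
  show "equivariant_linear (extend \<alpha>)"
    unfolding P_def[symmetric]
    unfolding equivariant_linear_def
    proof (intro conjI ballI allI)
      show "P v \<in> vectors" if "v \<in> vectors" for v
        unfolding P_eq using supp[OF that] p_vec by (intro vectors_sum) auto
      fix v assume v: "v \<in> vectors"
      show "P (\<lambda>x. v x + c * w x) = (\<lambda>x. P v x + c * P w x)" if w: "w \<in> vectors" for w c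
      proof
        fix x
        let ?E = "{z. v z \<noteq> 0} \<union> {z. w z \<noteq> 0}"
        have "finite ?E" using supp v w by auto
        then show "P (\<lambda>x. v x + c * w x) x = P v x + c * P w x"
          by (subst (1 2 3) P_superset[of ?E]) (auto simp: algebra_simps sum.distrib sum_distrib_left)
      qed
      fix g assume g: "g \<in> carrier G"
      let ?s = "\<lambda>(x, i). (g \<otimes> x, i :: 'i)"
      let ?E = "{z. v z \<noteq> 0}"
      have Ec: "x \<in> carrier G" if "v (x, i) \<noteq> 0" for x i using vectors_outside[OF v, of "(x, i)"] that by auto
      have sub: "{z. translate g v z \<noteq> 0} \<subseteq> ?s ` ?E"
      proof
        fix xi assume "xi \<in> {z. translate g v z \<noteq> 0}"
        then obtain x i where xi: "xi = (x, i)" "x \<in> carrier G" "v (inv g \<otimes> x, i) \<noteq> 0"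
          by (cases xi) (auto simp: translate_def split: if_splits)
        then have "xi = ?s (inv g \<otimes> x, i)" using g by (simp flip: m_assoc)
        then show "xi \<in> ?s ` ?E" using xi by blast
      qed
      have "inj_on ?s ?E" using g Ec by (auto simp: inj_on_def)
      show "P (translate g v) = translate g (P v)"
      proof
        fix xj :: "'g \<times> 'i"
        obtain x j where xj: "xj = (x, j)" by (cases xj)
        have "P (translate g v) xj = (\<Sum>z\<in>?s ` ?E. translate g v z * p z xj)"
          using sub supp[OF v] by (intro P_superset) auto
        also have "\<dots> = (\<Sum>z\<in>?E. translate g v (?s z) * p (?s z) xj)"
          using \<open>inj_on ?s ?E\<close> by (subst sum.reindex) auto
        also have "\<dots> = (\<Sum>z\<in>?E. v z * translate g (p z) xj)"
        proof (rule sum.cong[OF refl])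
          fix z assume z: "z \<in> ?E"
          obtain h i where hi: "z = (h, i)" by (cases z)
          have h: "h \<in> carrier G" "i \<in> I" using z hi supp[OF v] by auto
          have "translate g v (?s z) = v z" using g h by (simp add: hi translate_def flip: m_assoc)
          moreover have "p (?s z) = translate g (p z)"
            using g h \<alpha> by (simp add: hi p_def translate_translate)
          ultimately show "translate g v (?s z) * p (?s z) xj = v z * translate g (p z) xj" by simp
        qed
        also have "\<dots> = translate g (P v) xj"
          by (simp add: translate_def xj P_eq)
        finally show "P (translate g v) xj = translate g (P v) xj" .
      qed
    qed
qed

text \<open>The space of finitely supported functions is not complete, so the orthogonal projection to \<open>W\<close> need not
exist. A vector of \<open>W\<close> whose squared distance from \<open>d\<close> is within \<open>\<epsilon>\<^sup>2\<close> of the infimum is good enough: moving it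
along \<open>\<beta>\<close> cannot reduce the squared distance by more than \<open>\<epsilon>\<^sup>2\<close>, and the optimal step length bounds the inner
product with \<open>\<beta>\<close>.\<close>

lemma approximate_projection:
  assumes d: "d \<in> vectors" and W: "W \<subseteq> vectors" "(\<lambda>x. 0) \<in> W"
    and comb: "\<And>u v c. u \<in> W \<Longrightarrow> v \<in> W \<Longrightarrow> (\<lambda>x. u x + c * v x) \<in> W" and e: "0 < (\<epsilon>::real)"
  obtains \<alpha> where "\<alpha> \<in> W" "\<And>\<beta>. \<beta> \<in> W \<Longrightarrow> \<bar>ip (\<lambda>x. d x - \<alpha> x) \<beta>\<bar> \<le> \<epsilon> * sqrt (ip \<beta> \<beta>)"
proof -
  let ?q = "\<lambda>\<alpha>. ip (\<lambda>x. d x - \<alpha> x) (\<lambda>x. d x - \<alpha> x)"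
  define m where "m = Inf (?q ` W)"
  have bb: "bdd_below (?q ` W)" by (rule bdd_belowI[of _ 0]) (auto simp: ip_self_nonneg)
  have low: "m \<le> ?q \<alpha>" if "\<alpha> \<in> W" for \<alpha> unfolding m_def using that bb by (intro cInf_lower) auto
  have "Inf (?q ` W) < m + \<epsilon>\<^sup>2" using e by (simp add: m_def)
  then obtain \<alpha> where \<alpha>: "\<alpha> \<in> W" "?q \<alpha> < m + \<epsilon>\<^sup>2"
    using cInf_less_iff[of "?q ` W"] W bb by blast
  define r where "r = (\<lambda>x. d x - \<alpha> x)"
  have r: "r \<in> vectors" unfolding r_def using d W \<alpha> by (intro vectors_diff) auto
  have "\<bar>ip r \<beta>\<bar> \<le> \<epsilon> * sqrt (ip \<beta> \<beta>)" if \<beta>: "\<beta> \<in> W" for \<beta>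
  proof -
    have b: "\<beta> \<in> vectors" using \<beta> W by auto
    have key: "ip r r + (- (2 * t) * ip r \<beta> + t\<^sup>2 * ip \<beta> \<beta>) \<ge> m" for t
    proof -
      have "m \<le> ?q (\<lambda>x. \<alpha> x + t * \<beta> x)" using low comb \<alpha> \<beta> by blast
      also have "(\<lambda>x. d x - (\<alpha> x + t * \<beta> x)) = (\<lambda>x. r x + (- t) * \<beta> x)" by (auto simp: r_def)
      also have "ip (\<lambda>x. r x + (- t) * \<beta> x) (\<lambda>x. r x + (- t) * \<beta> x)
          = ip r (\<lambda>x. r x + (- t) * \<beta> x) + (- t) * ip \<beta> (\<lambda>x. r x + (- t) * \<beta> x)"
        by (rule ip_comb_left[OF r b])
      also have "ip r (\<lambda>x. r x + (- t) * \<beta> x) = ip r r + (- t) * ip \<beta> r"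
        by (simp only: ip_commute[OF r vectors_comb[OF r b]] ip_comb_left[OF r b])
      also have "ip \<beta> (\<lambda>x. r x + (- t) * \<beta> x) = ip r \<beta> + (- t) * ip \<beta> \<beta>"
        by (simp only: ip_commute[OF b vectors_comb[OF r b]] ip_comb_left[OF r b])
      also have "ip \<beta> r = ip r \<beta>" by (rule ip_commute[OF b r])
      finally show ?thesis by (simp add: algebra_simps power2_eq_square)
    qed
    have key2: "2 * t * ip r \<beta> - t\<^sup>2 * ip \<beta> \<beta> \<le> \<epsilon>\<^sup>2" for t
      using key[of t] \<alpha>(2) by (simp add: r_def)
    show ?thesis
    proof (cases "ip \<beta> \<beta> = 0")
      case True
      have "\<beta> x = 0" for x using square_le_ip[OF b, of x] True by simp
      then have "ip r \<beta> = 0" by (simp add: ip_def)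
      then show ?thesis using e True by simp
    next
      case False
      then have pos: "ip \<beta> \<beta> > 0" using ip_self_nonneg[of \<beta>] by simp
      have "(ip r \<beta>)\<^sup>2 \<le> \<epsilon>\<^sup>2 * ip \<beta> \<beta>"
        \<comment> \<open>The optimal step length.\<close>
      using key2[of "ip r \<beta> / ip \<beta> \<beta>"] pos by (simp add: field_simps power2_eq_square)
      then have "sqrt ((ip r \<beta>)\<^sup>2) \<le> sqrt (\<epsilon>\<^sup>2 * ip \<beta> \<beta>)" by (rule real_sqrt_le_mono)
      then show ?thesis using e by (simp add: real_sqrt_mult)
    qed
  qed
  then show thesis using that \<alpha> by (simp add: r_def)
qed

text \<open>Let \<open>W\<close> be the kernel of \<open>T\<close>. The map \<open>f = 1 - S T\<close> is a projection onto \<open>W\<close>, with trace zero because the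
trace of \<open>S T\<close> is that of \<open>T S = 1\<close>. If \<open>P\<close> were the orthogonal projection onto \<open>W\<close>, then
\<open>trace P = trace (f P) = trace (P f) = trace f = 0\<close>, as \<open>f P = P\<close> and \<open>P f = f\<close>; but the trace of
an orthogonal projection is the sum of the squared norms of the images of the unit vectors at \<open>\<one>\<close>,
whence \<open>P = 0\<close> and \<open>W = 0\<close>.

To stay inside the finitely supported functions, \<open>P\<close> is replaced by an equivariant map that sends the unit
vectors at \<open>\<one>\<close> to approximate projections \<open>\<alpha>\<close> with error \<open>\<epsilon>\<close>. All identities then hold up to a constant
times \<open>\<epsilon>\<close>, and the values of a kernel element \<open>u\<close> are bounded by a quantity tending to \<open>0\<close>
with \<open>\<epsilon>\<close>.\<close>

theorem right_inverse_is_injective: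
  assumes S: "equivariant_linear S" and T: "equivariant_linear T"
    and TS: "\<And>v. v \<in> vectors \<Longrightarrow> T (S v) = v"
    and u: "u \<in> vectors" "T u = (\<lambda>x. 0)"
  shows "u = (\<lambda>x. 0)"
proof -
  define W where "W = {v \<in> vectors. T v = (\<lambda>x. 0)}"
  have SV: "S v \<in> vectors" and TV: "T v \<in> vectors" if "v \<in> vectors" for v
    using S T that by (auto simp: equivariant_linear_def)
  have W0: "(\<lambda>x. 0) \<in> W"
    using linear_diff[OF T vectors_zero vectors_zero] by (simp add: W_def vectors_zero)
  have W_sub: "W \<subseteq> vectors" by (auto simp: W_def)
  have W_comb: "(\<lambda>x. v x + c * w x) \<in> W" if "v \<in> W" "w \<in> W" for v w c
    using that linear_comb[OF T] by (simp add: W_def vectors_comb)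
  have W_translate: "translate g v \<in> W" if "g \<in> carrier G" "v \<in> W" for g v
    using that T translate_vectors by (auto simp: W_def equivariant_linear_def translate_def fun_eq_iff)
  define f where "f = (\<lambda>v x. v x - S (T v) x)"
  have STcomb: "S (T (\<lambda>x. v x + c * w x)) = (\<lambda>x. S (T v) x + c * S (T w) x)" if "v \<in> vectors" "w \<in> vectors" for v w c
    using that by (simp add: linear_comb[OF T] linear_comb[OF S] TV)
  have f_lin: "equivariant_linear f"
    unfolding equivariant_linear_def
  proof (intro conjI ballI allI)
    show "f v \<in> vectors" if "v \<in> vectors" for v
      using that SV TV unfolding f_def by (intro vectors_diff) auto
    show "f (\<lambda>x. v x + c * w x) = (\<lambda>x. f v x + c * f w x)" if "v \<in> vectors" "w \<in> vectors" for v w c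
      using STcomb[OF that] by (simp add: f_def algebra_simps)
    fix g v assume gv: "g \<in> carrier G" "v \<in> vectors"
    then have "S (T (translate g v)) = translate g (S (T v))"
      using S T TV by (simp add: equivariant_linear_def)
    then show "f (translate g v) = translate g (f v)" using gv by (auto simp: f_def translate_def fun_eq_iff)
  qed
  have f_W: "f v \<in> W" if v: "v \<in> vectors" for v
  proof -
    have "T (f v) = (\<lambda>x. T v x - T (S (T v)) x)"
      unfolding f_def using v SV TV by (intro linear_diff[OF T]) auto
    then have "T (f v) = (\<lambda>x. 0)" using TS[OF TV[OF v]] by simp
    then show ?thesis using f_lin v by (simp add: W_def equivariant_linear_def)
  qed
  have f_id: "f v = v" if "v \<in> W" for v
  proof -
    have "S (T v) = (\<lambda>x. 0)" using that linear_diff[OF S vectors_zero vectors_zero] by (simp add: W_def)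
    then show ?thesis by (simp add: f_def)
  qed
  have u1: "unit_at (\<one>, i) \<in> vectors" if "i \<in> I" for i using that by (simp add: unit_at_vectors)
  have trace_f: "trace f = 0"
  proof -
    have "trace f = (\<Sum>i\<in>I. 1) - trace (\<lambda>v. S (T v))"
      by (simp add: trace_def f_def sum_subtractf unit_at_def)
    also have "trace (\<lambda>v. S (T v)) = trace (\<lambda>v. T (S v))" by (rule trace_commute[OF S T])
    also have "\<dots> = (\<Sum>i\<in>I. 1)" unfolding trace_def using TS u1 by (intro sum.cong) (auto simp: unit_at_def)
    finally show ?thesis by simp
  qed
  define \<phi> where "\<phi> = (\<lambda>i. f (unit_at (\<one>, i)))"
  have \<phi>: "\<phi> i \<in> W" if "i \<in> I" for i using that f_W u1 by (simp add: \<phi>_def)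
  define len where "len = (\<lambda>v :: 'g \<times> 'i \<Rightarrow> real. \<Sum>x | v x \<noteq> 0. \<bar>v x\<bar>)"
  \<comment> \<open>The squared norms of the \<open>\<alpha>\<close> will add up to at most \<open>\<epsilon> C\<close>: the first part bounds the trace of \<open>P\<close>, the second the error of the \<open>\<alpha>\<close> as projections.\<close>
  define C where "C = (\<Sum>i\<in>I. len (\<phi> i)) + 2 * card I"
  have len_nonneg: "len v \<ge> 0" for v unfolding len_def by (intro sum_nonneg) auto
  have C_nonneg: "C \<ge> 0" unfolding C_def using len_nonneg by (intro add_nonneg_nonneg sum_nonneg) auto
  have uW: "u \<in> W" using u by (simp add: W_def)
  have bound: "\<bar>u y\<bar> \<le> len u * (sqrt (\<epsilon> * C) + \<epsilon>)" if e: "0 < \<epsilon>" "\<epsilon> < 1" for \<epsilon> y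
  proof -
    have "\<forall>i\<in>I. \<exists>\<alpha>\<in>W. \<forall>\<beta>\<in>W. \<bar>ip (\<lambda>x. unit_at (\<one>, i) x - \<alpha> x) \<beta>\<bar> \<le> \<epsilon> * sqrt (ip \<beta> \<beta>)"
      using approximate_projection[OF u1 W_sub W0 W_comb e(1)] by metis
    then obtain \<alpha> where \<alpha>: "\<And>i. i \<in> I \<Longrightarrow> \<alpha> i \<in> W"
      and \<alpha>_close: "\<And>i \<beta>. i \<in> I \<Longrightarrow> \<beta> \<in> W \<Longrightarrow> \<bar>ip (\<lambda>x. unit_at (\<one>, i) x - \<alpha> i x) \<beta>\<bar> \<le> \<epsilon> * sqrt (ip \<beta> \<beta>)"
      by metis
    define p where "p = (\<lambda>(g, i). translate g (\<alpha> i))"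
    have pW: "p z \<in> W" if "z \<in> carrier G \<times> I" for z
      using that W_translate \<alpha> by (auto simp: p_def)
    \<comment> \<open>As \<open>W\<close> is translation-invariant, the approximation is equally good at all unit vectors.\<close>
    have p_close: "\<bar>ip (\<lambda>x. unit_at z x - p z x) \<beta>\<bar> \<le> \<epsilon> * sqrt (ip \<beta> \<beta>)"
      if z: "z \<in> carrier G \<times> I" and \<beta>: "\<beta> \<in> W" for z \<beta>
    proof -
      obtain g i where gi: "z = (g, i)" "g \<in> carrier G" "i \<in> I" using z by auto
      define b where "b = translate (inv g) \<beta>"
      have b: "b \<in> W" using gi \<beta> W_translate by (simp add: b_def)
      have bv: "\<beta> \<in> vectors" "b \<in> vectors" using b \<beta> W_sub by auto
      have gb: "translate g b = \<beta>" using gi bv by (simp add: b_def translate_translate translate_one)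
      define r where "r = (\<lambda>x. unit_at (\<one>, i) x - \<alpha> i x)"
      have rv: "r \<in> vectors" unfolding r_def using gi u1 \<alpha> W_sub by (intro vectors_diff) auto
      have "translate g r = (\<lambda>x. translate g (unit_at (\<one>, i)) x - translate g (\<alpha> i) x)"
        by (auto simp: translate_def fun_eq_iff r_def)
      then have "translate g r = (\<lambda>x. unit_at z x - p z x)"
        using gi translate_unit_at[of g "\<one>" i] by (simp add: p_def)
      then have "ip (\<lambda>x. unit_at z x - p z x) \<beta> = ip r b"
        using ip_translate[OF gi(2) rv bv(2)] gb by simp
      moreover have "ip \<beta> \<beta> = ip b b" using ip_translate[OF gi(2) bv(2) bv(2)] gb by simp
      ultimately show ?thesis using \<alpha>_close[OF gi(3) b] by (simp add: r_def)
    qed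
    define P where "P = extend \<alpha>"
    have P_apply: "P v x = (\<Sum>z | v z \<noteq> 0. v z * p z x)" for v x by (simp add: P_def extend_def p_def)
    have \<alpha>v: "\<alpha> i \<in> vectors" if "i \<in> I" for i using \<alpha>[OF that] W_sub by blast
    have supp: "{z. v z \<noteq> 0} \<subseteq> carrier G \<times> I" "finite {z. v z \<noteq> 0}" if "v \<in> vectors" for v
      using that by (auto simp: vectors_def)
    have W_sum: "(\<lambda>x. \<Sum>z\<in>E. c z * w z x) \<in> W" if "\<And>z. z \<in> E \<Longrightarrow> w z \<in> W" for E c w
      using that
    proof (induction E rule: infinite_finite_induct)
      case (insert z E)
      then show ?case using W_comb[of "\<lambda>x. \<Sum>z\<in>E. c z * w z x" "w z" "c z"] by (simp add: add.commute)
    qed (auto simp: W0)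
    have P_eq: "P v = (\<lambda>x. \<Sum>z | v z \<noteq> 0. v z * p z x)" for v by (rule ext) (rule P_apply)
    have P_W: "P v \<in> W" if v: "v \<in> vectors" for v
      unfolding P_eq using supp[OF v] pW by (intro W_sum) auto
    have P_lin: "equivariant_linear P" unfolding P_def using \<alpha>v by (rule extend_linear)
    have P_unit: "P (unit_at (\<one>, i)) = p (\<one>, i)" if "i \<in> I" for i
      using that \<alpha>v by (simp add: P_def extend_unit p_def)
    \<comment> \<open>On \<open>W\<close> the map \<open>P\<close> is almost the identity: the error \<open>\<beta> = P v - v\<close> lies in \<open>W\<close>, to which the errors at the unit vectors are almost orthogonal.\<close>
    have P_close: "sqrt (ip (\<lambda>x. P v x - v x) (\<lambda>x. P v x - v x)) \<le> \<epsilon> * len v" if v: "v \<in> W" for v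
    proof -
      define \<beta> where "\<beta> = (\<lambda>x. P v x - v x)"
      have vv: "v \<in> vectors" using v W_sub by auto
      let ?E = "{z. v z \<noteq> 0}"
      have \<beta>W: "\<beta> \<in> W" using W_comb[OF P_W[OF vv] v, of "-1"] by (simp add: \<beta>_def)
      have \<beta>v: "\<beta> \<in> vectors" using \<beta>W W_sub by auto
      have \<beta>_eq: "\<beta> x = (\<Sum>z\<in>?E. v z * (p z x - unit_at z x))" for x
      proof -
        have "(\<Sum>z\<in>?E. v z * unit_at z x) = (\<Sum>z\<in>?E. if z = x then v z else 0)"
          by (intro sum.cong) (auto simp: unit_at_def)
        also have "\<dots> = v x" using supp[OF vv] by (simp add: sum.delta)
        finally show ?thesis by (simp add: \<beta>_def P_apply right_diff_distrib sum_subtractf)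
      qed
      have "ip \<beta> \<beta> = (\<Sum>x | \<beta> x \<noteq> 0. (\<Sum>z\<in>?E. v z * (p z x - unit_at z x)) * \<beta> x)"
        unfolding ip_def by (subst \<beta>_eq[symmetric]) simp
      also have "\<dots> = (\<Sum>x | \<beta> x \<noteq> 0. \<Sum>z\<in>?E. v z * (\<beta> x * (p z x - unit_at z x)))"
        by (simp only: sum_distrib_right) (simp add: mult_ac)
      also have "\<dots> = (\<Sum>z\<in>?E. \<Sum>x | \<beta> x \<noteq> 0. v z * (\<beta> x * (p z x - unit_at z x)))"
        by (rule sum.swap)
      also have "\<dots> = (\<Sum>z\<in>?E. v z * ip \<beta> (\<lambda>x. p z x - unit_at z x))"
        by (simp add: ip_def sum_distrib_left)
      also have "\<dots> \<le> (\<Sum>z\<in>?E. \<bar>v z\<bar> * (\<epsilon> * sqrt (ip \<beta> \<beta>)))"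
      proof (rule sum_mono)
        fix z assume z: "z \<in> ?E"
        then have zX: "z \<in> carrier G \<times> I" using supp[OF vv] by auto
        have vec: "p z \<in> vectors" "unit_at z \<in> vectors" using pW[OF zX] W_sub unit_at_vectors[OF zX] by auto
        have "ip \<beta> (\<lambda>x. p z x - unit_at z x) = - ip (\<lambda>x. unit_at z x - p z x) \<beta>"
          using ip_commute[OF \<beta>v vectors_diff[OF vec]] ip_diff_left[OF vec] ip_diff_left[OF vec(2,1)] by simp
        then have "\<bar>ip \<beta> (\<lambda>x. p z x - unit_at z x)\<bar> \<le> \<epsilon> * sqrt (ip \<beta> \<beta>)"
          using p_close[OF zX \<beta>W] by simp
        then have "\<bar>v z * ip \<beta> (\<lambda>x. p z x - unit_at z x)\<bar> \<le> \<bar>v z\<bar> * (\<epsilon> * sqrt (ip \<beta> \<beta>))"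
          by (simp add: abs_mult mult_left_mono)
        then show "v z * ip \<beta> (\<lambda>x. p z x - unit_at z x) \<le> \<bar>v z\<bar> * (\<epsilon> * sqrt (ip \<beta> \<beta>))" by linarith
      qed
      also have "\<dots> = \<epsilon> * len v * sqrt (ip \<beta> \<beta>)" by (simp add: len_def sum_distrib_right sum_distrib_left mult_ac)
      finally have le: "sqrt (ip \<beta> \<beta>) * sqrt (ip \<beta> \<beta>) \<le> \<epsilon> * len v * sqrt (ip \<beta> \<beta>)"
        using ip_self_nonneg by simp
      show ?thesis
      proof (cases "sqrt (ip \<beta> \<beta>) = 0")
        case True
        then show ?thesis using e len_nonneg by (simp add: \<beta>_def)
      next
        case False
        then have "sqrt (ip \<beta> \<beta>) > 0" using ip_self_nonneg[of \<beta>] by (simp add: less_le)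
        then have "sqrt (ip \<beta> \<beta>) \<le> \<epsilon> * len v" using le by (rule mult_right_le_imp_le[rotated])
        then show ?thesis by (simp add: \<beta>_def)
      qed
    qed
    \<comment> \<open>Here \<open>trace P = trace (f P) = trace (P f)\<close>, which is close to \<open>trace f = 0\<close>.\<close>
    have "trace P \<le> \<epsilon> * (\<Sum>i\<in>I. len (\<phi> i))"
    proof -
      have "trace P = trace (\<lambda>v. f (P v))"
        unfolding trace_def using f_id P_W u1 by (intro sum.cong) auto
      also have "\<dots> = trace (\<lambda>v. P (f v))" by (rule trace_commute[OF f_lin P_lin])
      also have "\<dots> = (\<Sum>i\<in>I. P (\<phi> i) (\<one>, i))" by (simp add: trace_def \<phi>_def)
      also have "\<dots> = (\<Sum>i\<in>I. P (\<phi> i) (\<one>, i) - \<phi> i (\<one>, i))"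
        using trace_f by (simp add: trace_def \<phi>_def sum_subtractf)
      also have "\<dots> \<le> (\<Sum>i\<in>I. \<epsilon> * len (\<phi> i))"
      proof (rule sum_mono)
        fix i assume i: "i \<in> I"
        have "(\<lambda>x. P (\<phi> i) x - \<phi> i x) \<in> vectors"
          using \<phi>[OF i] P_W W_sub by (intro vectors_diff) auto
        from abs_le_norm[OF this, of "(\<one>, i)"] P_close[OF \<phi>[OF i]]
        show "P (\<phi> i) (\<one>, i) - \<phi> i (\<one>, i) \<le> \<epsilon> * len (\<phi> i)" by linarith
      qed
      finally show ?thesis by (simp add: sum_distrib_left)
    qed
    moreover have "trace P = (\<Sum>i\<in>I. \<alpha> i (\<one>, i))"
      unfolding trace_def using \<alpha> W_sub
      by (intro sum.cong) (auto simp: P_unit p_def translate_one subset_iff)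
    ultimately have trP: "(\<Sum>i\<in>I. \<alpha> i (\<one>, i)) \<le> \<epsilon> * (\<Sum>i\<in>I. len (\<phi> i))" by simp
    \<comment> \<open>The value \<open>\<alpha> i (\<one>, i)\<close> is the inner product of \<open>\<alpha> i\<close> with the unit vector it approximates. The norm of \<open>\<alpha> i\<close> is at most \<open>1 + \<epsilon>\<close>, hence at most \<open>2\<close>.\<close>
    have \<alpha>_ip: "ip (\<alpha> i) (\<alpha> i) \<le> \<alpha> i (\<one>, i) + 2 * \<epsilon>" if i: "i \<in> I" for i
    proof -
      define n where "n = sqrt (ip (\<alpha> i) (\<alpha> i))"
      have av: "\<alpha> i \<in> vectors" using \<alpha>[OF i] W_sub by auto
      have nn: "ip (\<alpha> i) (\<alpha> i) = n * n" "n \<ge> 0" using ip_self_nonneg by (simp_all add: n_def)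
      have "\<bar>\<alpha> i (\<one>, i) - ip (\<alpha> i) (\<alpha> i)\<bar> \<le> \<epsilon> * n"
        using \<alpha>_close[OF i \<alpha>[OF i]] ip_diff_left[OF u1[OF i] av, of "\<alpha> i"] by (simp add: ip_unit_at n_def)
      then have 1: "n * n \<le> \<alpha> i (\<one>, i) + \<epsilon> * n" using nn by linarith
      have "\<alpha> i (\<one>, i) \<le> n" using abs_le_norm[OF av, of "(\<one>, i)"] by (simp add: n_def)
      then have "n * n \<le> (1 + \<epsilon>) * n" using 1 by (simp add: algebra_simps)
      then have "n \<le> 2" using e nn by (cases "n = 0") auto
      then have "\<epsilon> * n \<le> \<epsilon> * 2" using e by (intro mult_left_mono) auto
      then show ?thesis using 1 nn by simp
    qed
    have \<alpha>_small: "ip (\<alpha> i) (\<alpha> i) \<le> \<epsilon> * C" if i: "i \<in> I" for i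
    proof -
      have "ip (\<alpha> i) (\<alpha> i) \<le> (\<Sum>i\<in>I. ip (\<alpha> i) (\<alpha> i))"
        using i finite_I ip_self_nonneg by (intro member_le_sum) auto
      also have "\<dots> \<le> (\<Sum>i\<in>I. \<alpha> i (\<one>, i) + 2 * \<epsilon>)" by (intro sum_mono \<alpha>_ip)
      also have "\<dots> \<le> \<epsilon> * C" using trP by (simp add: sum.distrib C_def algebra_simps)
      finally show ?thesis .
    qed
    have p_small: "\<bar>p z y\<bar> \<le> sqrt (\<epsilon> * C)" if z: "z \<in> carrier G \<times> I" for z
    proof -
      obtain g i where gi: "z = (g, i)" "g \<in> carrier G" "i \<in> I" using z by auto
      have av: "\<alpha> i \<in> vectors" using \<alpha>[OF gi(3)] W_sub by auto
      have "\<bar>p z y\<bar> \<le> sqrt (ip (p z) (p z))" using pW[OF z] W_sub by (intro abs_le_norm) auto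
      also have "ip (p z) (p z) = ip (\<alpha> i) (\<alpha> i)" using gi av by (simp add: p_def ip_translate)
      also have "sqrt \<dots> \<le> sqrt (\<epsilon> * C)" using \<alpha>_small[OF gi(3)] by simp
      finally show ?thesis .
    qed
    have "\<bar>P u y\<bar> \<le> (\<Sum>z | u z \<noteq> 0. \<bar>u z * p z y\<bar>)" unfolding P_apply by (rule sum_abs)
    also have "\<dots> \<le> (\<Sum>z | u z \<noteq> 0. \<bar>u z\<bar> * sqrt (\<epsilon> * C))"
      using p_small supp(1)[OF u(1)] by (intro sum_mono) (auto simp: abs_mult intro!: mult_left_mono)
    also have "\<dots> = len u * sqrt (\<epsilon> * C)" by (simp add: len_def sum_distrib_right)
    finally have 1: "\<bar>P u y\<bar> \<le> len u * sqrt (\<epsilon> * C)" .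
    have "(\<lambda>x. P u x - u x) \<in> vectors" using u P_W W_sub by (intro vectors_diff) auto
    from abs_le_norm[OF this, of y] P_close[OF uW] have 2: "\<bar>P u y - u y\<bar> \<le> \<epsilon> * len u" by linarith
    have "\<bar>u y\<bar> \<le> \<bar>P u y\<bar> + \<bar>P u y - u y\<bar>" by linarith
    then show ?thesis using 1 2 by (simp add: algebra_simps)
  qed
  show ?thesis
  proof
    fix y
    have "((\<lambda>\<epsilon>. len u * (sqrt (\<epsilon> * C) + \<epsilon>)) \<longlongrightarrow> len u * (sqrt (0 * C) + 0)) (at_right 0)"
      by (intro tendsto_intros)
    moreover have "\<forall>\<^sub>F \<epsilon> in at_right 0. \<bar>u y\<bar> \<le> len u * (sqrt (\<epsilon> * C) + \<epsilon>)"
      unfolding eventually_at_right_field using bound by (intro exI[of _ 1]) auto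
    ultimately have "\<bar>u y\<bar> \<le> len u * (sqrt (0 * C) + 0)"
      by (intro tendsto_lowerbound[of _ _ "at_right 0"]) auto
    then show "u y = 0" by simp
  qed
qed

end

section \<open>Reduction to finite coefficient groups\<close>

context comm_group
begin

definition powers :: "nat \<Rightarrow> 'a set"
  where "powers N = (\<lambda>x. x [^] N) ` carrier G"

lemma pow_hom: "(\<lambda>x. x [^] (N::nat)) \<in> hom G G"
  by (rule homI) (auto simp: nat_pow_distrib)

lemma powers_subgroup: "subgroup (powers N) G"
proof -
  interpret p: group_hom G G "\<lambda>x. x [^] N" by unfold_locales (rule pow_hom)
  show ?thesis unfolding powers_def by (rule p.img_is_subgroup)
qed

text \<open>If the quotient by \<open>B\<close> is torsion and finitely generated abelian, the product of the orders of the generators is an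
exponent of it.\<close>

lemma generate_pow_in_subgroup:
  assumes S: "finite S" "S \<subseteq> carrier G" "generate G S = carrier G" and B: "subgroup B G"
    and tors: "\<And>x. x \<in> S \<Longrightarrow> \<exists>n>0. x [^] (n::nat) \<in> B"
  obtains N :: nat where "0 < N" "powers N \<subseteq> B"
proof -
  obtain n where n: "\<And>s. s \<in> S \<Longrightarrow> 0 < n s" "\<And>s. s \<in> S \<Longrightarrow> s [^] (n s :: nat) \<in> B" using tors by metis
  define N where "N = (\<Prod>s\<in>S. n s)"
  have pos: "0 < N" using n S by (simp add: N_def prod_pos)
  interpret p: group_hom G G "\<lambda>x. x [^] N" by unfold_locales (rule pow_hom)
  have sub: "subgroup {x \<in> carrier G. x [^] N \<in> B} G"
    by (rule subgroupI)
      (auto simp: nat_pow_distrib nat_pow_inv subgroup.one_closed[OF B] subgroup.m_inv_closed[OF B]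
         subgroup.m_closed[OF B] intro!: exI[of _ "\<one>"])
  have "s [^] N \<in> B" if s: "s \<in> S" for s
  proof -
    obtain k where k: "N = n s * k" using S s unfolding N_def by (metis dvd_def dvd_prodI)
    have "s [^] N = (s [^] n s) [^] k" using s S by (simp add: nat_pow_pow k subset_iff)
    moreover have "(s [^] n s) [^] k \<in> B" using n(2)[OF s] B
      by (induction k) (auto simp: subgroup.one_closed subgroup.m_closed)
    ultimately show ?thesis by simp
  qed
  then have "generate G S \<subseteq> {x \<in> carrier G. x [^] N \<in> B}"
    using S by (intro generate_subgroup_incl[OF _ sub]) auto
  then have "powers N \<subseteq> B" using S(3) by (auto simp: powers_def)
  then show thesis using that pos by blast
qed

text \<open>Residual finiteness of finitely generated abelian groups, without their classification. Let \<open>B\<close> be a subgroup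
maximal among those not containing \<open>a\<close>; it suffices that the quotient by \<open>B\<close> is torsion. If \<open>x\<close> had infinite
order modulo \<open>B\<close>, then by maximality \<open>a\<close> would lie in \<open>B\<close> times the group generated by \<open>x\<^sup>j\<close>, for each \<open>j \<noteq> 0\<close>.
For \<open>j = 1\<close> this gives \<open>a \<in> B x\<^sup>k\<close>, and for \<open>j = 2 k\<close> it gives \<open>a \<in> B x\<^sup>2\<^sup>k\<^sup>i\<close>; so the odd multiple \<open>k (1 - 2 i)\<close>
of \<open>k\<close> is the exponent of a power of \<open>x\<close> in \<open>B\<close>.\<close>

theorem avoid_powers:
  assumes S: "finite S" "S \<subseteq> carrier G" "generate G S = carrier G"
    and a: "a \<in> carrier G" "a \<noteq> \<one>"
  obtains N :: nat where "0 < N" "a \<notin> powers N"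
proof -
  define F where "F = {B. subgroup B G \<and> a \<notin> B}"
  have "\<exists>B\<in>F. (\<forall>K\<in>F. (B \<subseteq> K \<longrightarrow> K = B))"
  proof (rule subset_Zorn_nonempty)
    have "{\<one>} \<in> F" using a by (simp add: F_def triv_subgroup)
    then show "F \<noteq> {}" by blast
    fix C assume C: "C \<noteq> {}" "subset.chain F C"
    have CF: "B \<in> F" if "B \<in> C" for B using C(2) that by (auto simp: subset_chain_def)
    have tot: "K \<subseteq> Y \<or> Y \<subseteq> K" if "K \<in> C" "Y \<in> C" for K Y
      using C(2) that unfolding subset_chain_def by blast
    have Csub: "subgroup B G" if "B \<in> C" for B using CF[OF that] by (simp add: F_def)
    have "subgroup (\<Union>C) G"
    proof (rule subgroupI)
      show "\<Union>C \<subseteq> carrier G" using subgroup.subset[OF Csub] by (rule Union_least)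
      obtain K where "K \<in> C" using C(1) by blast
      then show "\<Union>C \<noteq> {}" using subgroup.one_closed[OF Csub] by blast
      show "inv x \<in> \<Union>C" if "x \<in> \<Union>C" for x
        using that subgroup.m_inv_closed[OF Csub] by blast
      fix x y assume "x \<in> \<Union>C" "y \<in> \<Union>C"
      then obtain K Y where KY: "K \<in> C" "Y \<in> C" "x \<in> K" "y \<in> Y" by blast
      from tot[OF KY(1,2)] show "x \<otimes> y \<in> \<Union>C"
      proof
        assume "K \<subseteq> Y"
        then have "x \<otimes> y \<in> Y" using KY by (intro subgroup.m_closed[OF Csub]) auto
        then show ?thesis using KY by blast
      next
        assume "Y \<subseteq> K"
        then have "x \<otimes> y \<in> K" using KY by (intro subgroup.m_closed[OF Csub]) auto
        then show ?thesis using KY by blast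
      qed
    qed
    then show "\<Union>C \<in> F" using CF by (auto simp: F_def)
  qed
  then obtain B where B: "subgroup B G" "a \<notin> B" and max: "\<And>K. \<lbrakk>subgroup K G; a \<notin> K; B \<subseteq> K\<rbrakk> \<Longrightarrow> K = B"
    by (auto simp: F_def)
  note Bc = subgroup.mem_carrier[OF B(1)] and Bm = subgroup.m_closed[OF B(1)]
    and Bi = subgroup.m_inv_closed[OF B(1)] and B1 = subgroup.one_closed[OF B(1)]
  have tors: "\<exists>n>0. x [^] (n::nat) \<in> B" if x: "x \<in> carrier G" for x
  proof (rule ccontr)
    assume no: "\<not> ?thesis"
    have no_int: "x [^] (m::int) \<notin> B" if m: "m \<noteq> 0" for m
    proof
      assume "x [^] m \<in> B"
      moreover from this have "x [^] (- m) \<in> B" using x Bi by (simp add: int_pow_neg)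
      ultimately have "x [^] \<bar>m\<bar> \<in> B" by (simp add: abs_if)
      then have "x [^] (nat \<bar>m\<bar>) \<in> B" by (metis abs_ge_zero int_pow_int nat_0_le)
      moreover have "nat \<bar>m\<bar> > 0" using m by simp
      ultimately show False using no by blast
    qed
    have represent: "\<exists>b\<in>B. \<exists>i::int. a = b \<otimes> x [^] (j * i)" if j: "j \<noteq> 0" for j :: int
    proof (rule ccontr)
      assume na: "\<not> ?thesis"
      define K where "K = {b \<otimes> x [^] (j * i) | b i. b \<in> B}"
      have "subgroup K G"
      proof (rule subgroupI)
        show "K \<subseteq> carrier G" using Bc x by (auto simp: K_def)
        show "K \<noteq> {}" using B1 by (auto simp: K_def)
        fix u assume "u \<in> K"
        then obtain b i where u: "u = b \<otimes> x [^] (j * i)" "b \<in> B" by (auto simp: K_def)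
        have "inv u = inv b \<otimes> x [^] (j * (- i))"
          using u Bc x by (simp add: inv_mult int_pow_neg)
        then show "inv u \<in> K" using Bi[OF u(2)] unfolding K_def by blast
        fix v assume "v \<in> K"
        then obtain c l where v: "v = c \<otimes> x [^] (j * l)" "c \<in> B" by (auto simp: K_def)
        have "u \<otimes> v = (b \<otimes> c) \<otimes> x [^] (j * (i + l))"
          using u v Bc x by (simp add: distrib_left int_pow_mult m_ac)
        then show "u \<otimes> v \<in> K" using Bm[OF u(2) v(2)] unfolding K_def by blast
      qed
      moreover have "a \<notin> K" using na by (auto simp: K_def)
      moreover have "B \<subseteq> K"
      proof
        fix b assume "b \<in> B"
        moreover from this have "b = b \<otimes> x [^] (j * 0)" using Bc by simp
        ultimately show "b \<in> K" unfolding K_def by blast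
      qed
      ultimately have "K = B" by (rule max)
      moreover have "x [^] j \<in> K"
      proof -
        have "x [^] j = \<one> \<otimes> x [^] (j * 1)" using x by simp
        then show ?thesis using B1 unfolding K_def by blast
      qed
      ultimately show False using no_int[OF j] by simp
    qed
    obtain b k where bk: "b \<in> B" "a = b \<otimes> x [^] (1 * k :: int)" using represent[of 1] by auto
    have k: "k \<noteq> 0" using bk B(2) Bc by (metis int_pow_0 mult_zero_right r_one)
    \<comment> \<open>The factor \<open>2\<close> makes the two exponents of \<open>x\<close> differ by an odd multiple of \<open>k\<close>.\<close>
    then obtain c i where ci: "c \<in> B" "a = c \<otimes> x [^] (2 * k * i)" using represent[of "2 * k"] by auto
    have "b \<otimes> x [^] k = c \<otimes> x [^] (2 * k * i)" using bk ci by simp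
    then have "x [^] k = inv b \<otimes> (c \<otimes> x [^] (2 * k * i))"
      using bk(1) ci(1) Bc x by (metis int_pow_closed inv_solve_left m_closed)
    then have "x [^] k \<otimes> inv (x [^] (2 * k * i)) = inv b \<otimes> c"
      using bk(1) ci(1) Bc x by (simp add: m_assoc)
    then have "x [^] (k - 2 * k * i) \<in> B"
      using bk(1) ci(1) Bm Bi x by (simp add: int_pow_diff)
    moreover have "k - 2 * k * i \<noteq> 0"
    proof
      assume "k - 2 * k * i = 0"
      then have "k * (1 - 2 * i) = 0" by (simp add: algebra_simps)
      then have "1 - 2 * i = 0" using k by simp
      then show False by presburger
    qed
    ultimately show False using no_int by blast
  qed
  obtain N where "0 < N" "powers N \<subseteq> B"
    using generate_pow_in_subgroup[OF S B(1)] tors S(2) by blast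
  then show thesis using that B(2) by blast
qed

lemma quotient_by_powers_finite:
  assumes S: "finite S" "S \<subseteq> carrier G" "generate G S = carrier G" and N: "0 < N"
  shows "finite (carrier (G Mod powers N))"
proof -
  interpret P: normal "powers N" G using powers_subgroup normal_iff_subgroup by blast
  interpret Q: comm_group "G Mod powers N" by (rule abelian_FactGroup[OF powers_subgroup])
  interpret q: group_hom G "G Mod powers N" "\<lambda>a. powers N #> a"
    by unfold_locales (rule P.r_coset_hom_Mod)
  have onto: "(\<lambda>a. powers N #> a) ` carrier G = carrier (G Mod powers N)"
    by (auto simp: FactGroup_def RCOSETS_def)
  have "finite (generate (G Mod powers N) ((\<lambda>a. powers N #> a) ` S))"
  proof (rule Q.finite_of_bounded_exponent[OF _ _ N])
    show "finite ((\<lambda>a. powers N #> a) ` S)" using S by simp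
    show "(\<lambda>a. powers N #> a) ` S \<subseteq> carrier (G Mod powers N)" using S onto by blast
    fix c assume "c \<in> (\<lambda>a. powers N #> a) ` S"
    then obtain s where s: "c = powers N #> s" "s \<in> carrier G" using S by auto
    have "s [^] N \<in> powers N" using s by (simp add: powers_def)
    then have "powers N #> (s [^] N) = \<one>\<^bsub>G Mod powers N\<^esub>"
      using P.rcos_const is_group by (simp add: FactGroup_def)
    then show "c [^]\<^bsub>G Mod powers N\<^esub> N = \<one>\<^bsub>G Mod powers N\<^esub>"
      using s q.hom_nat_pow by simp
  qed
  then show ?thesis using q.generate_img[OF S(2)] S(3) onto by simp
qed

end

text \<open>The subgroup of \<open>N\<close>-th powers is stable under every endomorphism, so a surjective automaton descends to a
surjective automaton over the quotient. A kernel element with a nontrivial value can be kept nontrivial in a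
suitable finite quotient.\<close>

theorem (in wreath_factors) hopfian_automata_residual:
  assumes fg: "finitely_generated A"
    and quot: "\<And>N. \<lbrakk>0 < N; finite (carrier (A Mod A.powers N))\<rbrakk> \<Longrightarrow> hopfian_automata (A Mod A.powers N) G"
  shows "hopfian_automata A G"
  unfolding hopfian_automata_def
proof (intro allI impI ballI, elim conjE)
  fix S :: "'g set" and k u
  assume S: "finite S" "S \<subseteq> carrier G" and k: "\<forall>t\<in>S. k t \<in> hom A A"
    and onto: "cellular_automaton A G S k ` carrier base = carrier base"
    and u: "u \<in> carrier base" "cellular_automaton A G S k u = zero"
  interpret automaton A G S k by unfold_locales (use S k in auto)
  obtain T where T: "finite T" "T \<subseteq> carrier A" "generate A T = carrier A"
    using fg by (auto simp: finitely_generated_def)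
  show "u = zero"
  proof (rule ccontr)
    assume "u \<noteq> zero"
    then obtain x0 where x0: "x0 \<in> carrier G" "u x0 \<noteq> \<one>\<^bsub>A\<^esub>"
      using base_ext[OF u(1) zero_base] by auto
    obtain N where N: "0 < N" "u x0 \<notin> A.powers N"
      using A.avoid_powers[OF T base_value[OF u(1) x0(1)] x0(2)] by metis
    let ?P = "A.powers N" and ?Q = "A Mod A.powers N"
    interpret P: normal ?P A using A.powers_subgroup A.normal_iff_subgroup by blast
    interpret Q: comm_group ?Q by (rule A.abelian_FactGroup[OF A.powers_subgroup])
    interpret R: wreath_factors ?Q G by unfold_locales
    define q where "q = (\<lambda>a. ?P #>\<^bsub>A\<^esub> a)"
    have q_hom: "q \<in> hom A ?Q" unfolding q_def by (rule P.r_coset_hom_Mod)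
    interpret q: group_hom A ?Q q by unfold_locales (rule q_hom)
    have q_onto: "\<exists>a\<in>carrier A. c = q a" if "c \<in> carrier ?Q" for c
      using that by (auto simp: FactGroup_def RCOSETS_def q_def)
    have q_one: "q a = \<one>\<^bsub>?Q\<^esub> \<longleftrightarrow> a \<in> ?P" if "a \<in> carrier A" for a
    proof
      assume "q a = \<one>\<^bsub>?Q\<^esub>"
      then show "a \<in> ?P" using A.rcos_self[OF that A.powers_subgroup[of N]] by (simp add: q_def FactGroup_def)
    next
      assume "a \<in> ?P"
      then show "q a = \<one>\<^bsub>?Q\<^esub>" using P.rcos_const A.is_group by (simp add: q_def FactGroup_def)
    qed
    have "\<exists>g. g \<in> hom ?Q ?Q \<and> (\<forall>a\<in>carrier A. g (q a) = q (k t a))" if t: "t \<in> S" for t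
    proof -
      have h: "(\<lambda>a. q (k t a)) \<in> hom A ?Q"
        using hom_compose[OF k_hom[OF t] q_hom] by (simp add: comp_def)
      have "q (k t a) = q (k t b)" if ab: "a \<in> carrier A" "b \<in> carrier A" "?P #>\<^bsub>A\<^esub> a = ?P #>\<^bsub>A\<^esub> b" for a b
      proof -
        have qq: "q a = q b" using ab by (simp add: q_def)
        have "q (a \<otimes>\<^bsub>A\<^esub> inv\<^bsub>A\<^esub> b) = q a \<otimes>\<^bsub>?Q\<^esub> inv\<^bsub>?Q\<^esub> (q b)"
          using ab by (simp only: q.hom_mult q.hom_inv A.inv_closed)
        also have "\<dots> = \<one>\<^bsub>?Q\<^esub>" unfolding qq using ab by (intro Q.r_inv q.hom_closed)
        finally have "a \<otimes>\<^bsub>A\<^esub> inv\<^bsub>A\<^esub> b \<in> ?P"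
          using q_one[of "a \<otimes>\<^bsub>A\<^esub> inv\<^bsub>A\<^esub> b"] ab by (simp only: A.m_closed A.inv_closed)
        then obtain c where c: "c \<in> carrier A" "a \<otimes>\<^bsub>A\<^esub> inv\<^bsub>A\<^esub> b = c [^]\<^bsub>A\<^esub> N"
          by (auto simp: A.powers_def)
        interpret kt: group_hom A A "k t" by unfold_locales (rule k_hom[OF t])
        have "k t (a \<otimes>\<^bsub>A\<^esub> inv\<^bsub>A\<^esub> b) \<in> ?P"
          using c by (simp add: kt.hom_nat_pow A.powers_def)
        moreover have "k t (a \<otimes>\<^bsub>A\<^esub> inv\<^bsub>A\<^esub> b) \<in> carrier A" using ab by (intro kt.hom_closed) simp
        ultimately have "q (k t (a \<otimes>\<^bsub>A\<^esub> inv\<^bsub>A\<^esub> b)) = \<one>\<^bsub>?Q\<^esub>" using q_one by blast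
        moreover have "q (k t (a \<otimes>\<^bsub>A\<^esub> inv\<^bsub>A\<^esub> b)) = q (k t a) \<otimes>\<^bsub>?Q\<^esub> inv\<^bsub>?Q\<^esub> (q (k t b))"
          using ab by (simp only: kt.hom_mult kt.hom_inv kt.hom_closed q.hom_mult q.hom_inv A.inv_closed)
        ultimately show ?thesis
          using ab Q.inv_solve_right'[of "\<one>\<^bsub>?Q\<^esub>" "q (k t a)" "q (k t b)"]
          by (simp only: Q.l_one Q.one_closed q.hom_closed kt.hom_closed)
      qed
      from FactGroup_universal[OF h P.normal_axioms this] obtain g where
        "g \<in> hom ?Q ?Q" "\<And>x. x \<in> carrier A \<Longrightarrow> g (?P #>\<^bsub>A\<^esub> x) = q (k t x)" by blast
      then show ?thesis by (auto simp: q_def)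
    qed
    then obtain k' where k': "\<And>t. t \<in> S \<Longrightarrow> k' t \<in> hom ?Q ?Q"
      "\<And>t a. t \<in> S \<Longrightarrow> a \<in> carrier A \<Longrightarrow> k' t (q a) = q (k t a)" by metis
    interpret C: automaton ?Q G S k' by unfold_locales (use S k' in auto)
    define red where "red = (\<lambda>v :: 'g \<Rightarrow> 'a. \<lambda>x\<in>carrier G. q (v x))"
    have red_base: "red v \<in> carrier R.base" if v: "v \<in> carrier base" for v
    proof -
      have "R.supp (red v) \<subseteq> supp v" by (auto simp: red_def)
      then have "finite (R.supp (red v))" using v by (auto simp: base_carrier intro: finite_subset)
      then show ?thesis using base_value[OF v] by (simp add: R.base_carrier) (auto simp: red_def)
    qed
    have red_ca: "C.ca (red v) = red (ca v)" if v: "v \<in> carrier base" for v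
    proof
      fix x
      show "C.ca (red v) x = red (ca v) x"
      proof (cases "x \<in> carrier G")
        case True
        have c: "k t (v (x \<otimes>\<^bsub>G\<^esub> inv\<^bsub>G\<^esub> t)) \<in> carrier A" if "t \<in> S" for t
          using that True base_value[OF v] by (simp add: k_closed S_carrier)
        have "red (ca v) x = (\<Otimes>\<^bsub>?Q\<^esub>t\<in>S. q (k t (v (x \<otimes>\<^bsub>G\<^esub> inv\<^bsub>G\<^esub> t))))"
          using True c by (simp add: red_def ca_apply)
            (rule hom_finprod[OF q_hom A.comm_group_axioms Q.comm_group_axioms], auto)
        also have "\<dots> = C.ca (red v) x"
          unfolding C.ca_apply[OF True]
          using True base_value[OF v] k'
          by (intro Q.finprod_cong') (auto simp: red_def S_carrier Pi_def intro!: q.hom_closed k_closed)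
        finally show ?thesis by simp
      qed (simp add: red_def cellular_automaton_def)
    qed
    have red_onto: "\<exists>v\<in>carrier base. red v = w" if w: "w \<in> carrier R.base" for w
    proof -
      obtain r where r: "\<And>c. c \<in> carrier ?Q \<Longrightarrow> r c \<in> carrier A" "\<And>c. c \<in> carrier ?Q \<Longrightarrow> q (r c) = c"
        using q_onto by metis
      define v where "v = (\<lambda>x\<in>carrier G. if w x = \<one>\<^bsub>?Q\<^esub> then \<one>\<^bsub>A\<^esub> else r (w x))"
      have "supp v \<subseteq> R.supp w" by (auto simp: v_def)
      then have "finite (supp v)" using w by (auto simp: R.base_carrier intro: finite_subset)
      then have v: "v \<in> carrier base"
        using r R.base_value[OF w] by (simp add: base_carrier) (auto simp: v_def)
      moreover have "red v = w"
        using r R.base_value[OF w] by (intro R.base_ext[OF red_base[OF v] w]) (auto simp: red_def v_def)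
      ultimately show ?thesis by blast
    qed
    have C_onto: "C.ca ` carrier R.base = carrier R.base"
    proof
      show "C.ca ` carrier R.base \<subseteq> carrier R.base" using C.ca_base by auto
      show "carrier R.base \<subseteq> C.ca ` carrier R.base"
      proof
        fix w assume "w \<in> carrier R.base"
        then obtain v where v: "v \<in> carrier base" "red v = w" using red_onto by blast
        have "v \<in> ca ` carrier base" using v(1) onto by simp
        then obtain v' where v': "v' \<in> carrier base" "ca v' = v" by blast
        have "w = C.ca (red v')" using red_ca v v' by simp
        then show "w \<in> C.ca ` carrier R.base" using red_base v' by blast
      qed
    qed
    have "red zero = R.zero"
      unfolding red_def by (intro restrict_ext) (simp only: restrict_apply' q.hom_one)
    then have "C.ca (red u) = R.zero" by (simp only: red_ca[OF u(1)] u(2))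
    moreover have "hopfian_automata ?Q G"
      using quot[OF N(1)] A.quotient_by_powers_finite[OF T N(1)] by simp
    ultimately have "red u = R.zero"
      using C_onto red_base[OF u(1)] S k' unfolding hopfian_automata_def by blast
    then have "q (u x0) = \<one>\<^bsub>?Q\<^esub>" using x0 by (metis red_def restrict_apply')
    then show False using q_one N(2) x0 base_value[OF u(1)] by blast
  qed
qed

section \<open>Sofic groups: counting in a finite model\<close>

text \<open>A maximal independent set in a graph whose closed neighbourhoods have at most \<open>d\<close> points is dominating.\<close>

lemma independent_subset:
  fixes V :: "'v set"
  assumes V: "finite V"
    and c: "\<And>i. i \<in> V \<Longrightarrow> finite (N i)" "\<And>i. i \<in> V \<Longrightarrow> card (N i) \<le> d"
    and refl: "\<And>i. i \<in> V \<Longrightarrow> i \<in> N i" and sym: "\<And>i j. i \<in> V \<Longrightarrow> j \<in> V \<Longrightarrow> j \<in> N i \<Longrightarrow> i \<in> N j"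
  obtains I where "I \<subseteq> V" "\<And>i j. i \<in> I \<Longrightarrow> j \<in> I \<Longrightarrow> i \<noteq> j \<Longrightarrow> j \<notin> N i" "card V \<le> d * card I"
proof -
  define F where "F = {I. I \<subseteq> V \<and> (\<forall>i\<in>I. \<forall>j\<in>I. i \<noteq> j \<longrightarrow> j \<notin> N i)}"
  have "finite F" unfolding F_def using V by simp
  moreover have "{} \<in> F" by (simp add: F_def)
  ultimately obtain I where I: "I \<in> F" and max: "\<And>K. K \<in> F \<Longrightarrow> I \<subseteq> K \<Longrightarrow> I = K"
    using finite_has_maximal[of F] by (metis empty_iff)
  have IV: "I \<subseteq> V" and ind: "\<And>i j. i \<in> I \<Longrightarrow> j \<in> I \<Longrightarrow> i \<noteq> j \<Longrightarrow> j \<notin> N i"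
    using I by (auto simp: F_def)
  have finI: "finite I" using IV V finite_subset by blast
  have "V \<subseteq> (\<Union>i\<in>I. N i)"
  proof
    fix v assume v: "v \<in> V"
    show "v \<in> (\<Union>i\<in>I. N i)"
    proof (rule ccontr)
      assume no: "v \<notin> (\<Union>i\<in>I. N i)"
      then have vI: "v \<notin> I" using refl v by blast
      have "insert v I \<in> F"
        unfolding F_def
      proof (intro CollectI conjI ballI impI)
        show "insert v I \<subseteq> V" using IV v by simp
        fix i j assume "i \<in> insert v I" "j \<in> insert v I" "i \<noteq> j"
        then consider "i \<in> I" "j \<in> I" | "i = v" "j \<in> I" | "i \<in> I" "j = v" by blast
        then show "j \<notin> N i"
        proof cases
          case 1 then show ?thesis using ind \<open>i \<noteq> j\<close> by blast
        next
          case 2 then show ?thesis using no sym[of v j] v IV by blast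
        next
          case 3 then show ?thesis using no by blast
        qed
      qed
      then show False using max vI by blast
    qed
  qed
  moreover have "finite (\<Union>i\<in>I. N i)" using finI IV c(1) by blast
  ultimately have "card V \<le> card (\<Union>i\<in>I. N i)" using card_mono by blast
  also have "\<dots> \<le> (\<Sum>i\<in>I. card (N i))" by (rule card_UN_le[OF finI])
  also have "\<dots> \<le> (\<Sum>i\<in>I. d)" using c(2) IV by (intro sum_mono) auto
  finally have "card V \<le> d * card I" by (simp add: mult.commute)
  then show thesis using that IV ind by blast
qed

context automaton
begin

text \<open>A copy of the configuration \<open>m\<close> in the model \<open>{1..n}\<close>, placed at \<open>i\<close>: here \<open>\<phi> y p\<close> plays the role of
\<open>p y\<inverse>\<close> and \<open>i\<close> that of the identity, so \<open>\<phi> y p = i\<close> says that \<open>p\<close> is the place of \<open>y\<close> in the copy. If this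
holds for several \<open>y\<close>, their values are multiplied.\<close>

definition transport :: "('g \<Rightarrow> nat \<Rightarrow> nat) \<Rightarrow> ('g \<Rightarrow> 'a) \<Rightarrow> nat \<Rightarrow> nat \<Rightarrow> 'a"
  where "transport \<phi> m i p = (\<Otimes>\<^bsub>A\<^esub>y\<in>supp m. if \<phi> y p = i then m y else \<one>\<^bsub>A\<^esub>)"

text \<open>The automaton on the finite model, with \<open>\<phi> t j\<close> in place of \<open>x t\<inverse>\<close>.\<close>

definition model :: "('g \<Rightarrow> nat \<Rightarrow> nat) \<Rightarrow> (nat \<Rightarrow> 'a) \<Rightarrow> nat \<Rightarrow> 'a"
  where "model \<phi> v j = (\<Otimes>\<^bsub>A\<^esub>t\<in>S. k t (v (\<phi> t j)))"

lemma transport_closed: "m \<in> carrier base \<Longrightarrow> transport \<phi> m i p \<in> carrier A"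
  unfolding transport_def by (intro A.finprod_closed) (auto simp: base_value)

lemma transport_superset:
  assumes "m \<in> carrier base" "finite D" "supp m \<subseteq> D" "D \<subseteq> carrier G"
  shows "transport \<phi> m i p = (\<Otimes>\<^bsub>A\<^esub>y\<in>D. if \<phi> y p = i then m y else \<one>\<^bsub>A\<^esub>)"
  unfolding transport_def using assms base_value[OF assms(1)]
  by (intro A.finprod_mono_neutral_cong_left) (auto split: if_splits)

lemma model_closed: "(\<And>p. v p \<in> carrier A) \<Longrightarrow> model \<phi> v j \<in> carrier A"
  unfolding model_def by (intro A.finprod_closed) (auto simp: k_closed)

lemma model_mult:
  assumes "\<And>p. v p \<in> carrier A" "\<And>p. w p \<in> carrier A"
  shows "model \<phi> (\<lambda>p. v p \<otimes>\<^bsub>A\<^esub> w p) j = model \<phi> v j \<otimes>\<^bsub>A\<^esub> model \<phi> w j"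
proof -
  have "model \<phi> (\<lambda>p. v p \<otimes>\<^bsub>A\<^esub> w p) j = (\<Otimes>\<^bsub>A\<^esub>t\<in>S. k t (v (\<phi> t j)) \<otimes>\<^bsub>A\<^esub> k t (w (\<phi> t j)))"
    unfolding model_def using assms by (intro A.finprod_cong') (auto simp: k_mult k_closed)
  also have "\<dots> = model \<phi> v j \<otimes>\<^bsub>A\<^esub> model \<phi> w j"
    unfolding model_def using assms by (intro A.finprod_multf) (auto simp: k_closed)
  finally show ?thesis .
qed

lemma model_finprod:
  assumes J: "finite J" and v: "\<And>i p. i \<in> J \<Longrightarrow> v i p \<in> carrier A"
  shows "model \<phi> (\<lambda>p. \<Otimes>\<^bsub>A\<^esub>i\<in>J. v i p) j = (\<Otimes>\<^bsub>A\<^esub>i\<in>J. model \<phi> (v i) j)"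
proof -
  have "k t (\<Otimes>\<^bsub>A\<^esub>i\<in>J. v i p) = (\<Otimes>\<^bsub>A\<^esub>i\<in>J. k t (v i p))" if "t \<in> S" for t p
    using v by (intro hom_finprod[OF k_hom[OF that] A.comm_group_axioms A.comm_group_axioms]) auto
  then have "model \<phi> (\<lambda>p. \<Otimes>\<^bsub>A\<^esub>i\<in>J. v i p) j = (\<Otimes>\<^bsub>A\<^esub>t\<in>S. \<Otimes>\<^bsub>A\<^esub>i\<in>J. k t (v i (\<phi> t j)))"
    unfolding model_def using v by (intro A.finprod_cong') (auto simp: k_closed)
  also have "\<dots> = (\<Otimes>\<^bsub>A\<^esub>i\<in>J. model \<phi> (v i) j)"
    unfolding model_def using J finite_S v by (intro A.finprod_swap) (auto simp: k_closed)
  finally show ?thesis .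
qed

text \<open>At a point \<open>i\<close> near which \<open>\<phi>\<close> behaves multiplicatively, the model cannot be told from the automaton itself.\<close>

lemma model_transport:
  assumes m: "m \<in> carrier base" and E: "finite E" "supp m \<subseteq> E" "E \<subseteq> carrier G"
    and good: "\<And>y t. \<lbrakk>y \<in> E; t \<in> S\<rbrakk> \<Longrightarrow> \<phi> y (\<phi> t j) = i \<longleftrightarrow> \<phi> (y \<otimes>\<^bsub>G\<^esub> t) j = i"
  shows "model \<phi> (transport \<phi> m i) j = transport \<phi> (ca m) i j"
proof -
  let ?Z = "\<Union>t\<in>S. (\<lambda>y. y \<otimes>\<^bsub>G\<^esub> t) ` E"
  have Z: "finite ?Z" "?Z \<subseteq> carrier G" using E finite_S S_sub by auto
  have mc: "m y \<in> carrier A" if "y \<in> carrier G" for y using that m base_value by blast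
  have "k t (transport \<phi> m i (\<phi> t j)) = (\<Otimes>\<^bsub>A\<^esub>y\<in>E. if \<phi> (y \<otimes>\<^bsub>G\<^esub> t) j = i then k t (m y) else \<one>\<^bsub>A\<^esub>)"
    if t: "t \<in> S" for t
  proof -
    have "k t (transport \<phi> m i (\<phi> t j)) = (\<Otimes>\<^bsub>A\<^esub>y\<in>E. k t (if \<phi> y (\<phi> t j) = i then m y else \<one>\<^bsub>A\<^esub>))"
      unfolding transport_superset[OF m E] using E mc
      by (intro hom_finprod[OF k_hom[OF t] A.comm_group_axioms A.comm_group_axioms]) auto
    also have "\<dots> = (\<Otimes>\<^bsub>A\<^esub>y\<in>E. if \<phi> (y \<otimes>\<^bsub>G\<^esub> t) j = i then k t (m y) else \<one>\<^bsub>A\<^esub>)"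
      using E mc t good by (intro A.finprod_cong') (auto simp: k_closed k_one)
    finally show ?thesis .
  qed
  then have lhs: "model \<phi> (transport \<phi> m i) j
      = (\<Otimes>\<^bsub>A\<^esub>t\<in>S. \<Otimes>\<^bsub>A\<^esub>y\<in>E. if \<phi> (y \<otimes>\<^bsub>G\<^esub> t) j = i then k t (m y) else \<one>\<^bsub>A\<^esub>)"
    unfolding model_def using E mc by (intro A.finprod_cong') (auto simp: k_closed intro!: A.finprod_closed)
  have sub: "supp (ca m) \<subseteq> ?Z"
  proof (rule order_trans)
    show "supp (ca m) \<subseteq> (\<Union>t\<in>S. (\<lambda>y. y \<otimes>\<^bsub>G\<^esub> t) ` supp m)"
      using m by (intro ca_support) (simp add: base_carrier PiE_def)
    show "\<dots> \<subseteq> ?Z" using E(2) by (intro UN_mono image_mono) auto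
  qed
  have c: "k t (m (z \<otimes>\<^bsub>G\<^esub> inv\<^bsub>G\<^esub> t)) \<in> carrier A" if "t \<in> S" "z \<in> carrier G" for t z
    using that mc by (simp add: k_closed S_carrier)
  have "transport \<phi> (ca m) i j = (\<Otimes>\<^bsub>A\<^esub>z\<in>?Z. if \<phi> z j = i then ca m z else \<one>\<^bsub>A\<^esub>)"
    by (rule transport_superset[OF ca_base[OF m] Z(1) sub Z(2)])
  also have "\<dots> = (\<Otimes>\<^bsub>A\<^esub>z\<in>?Z. \<Otimes>\<^bsub>A\<^esub>t\<in>S. if \<phi> z j = i then k t (m (z \<otimes>\<^bsub>G\<^esub> inv\<^bsub>G\<^esub> t)) else \<one>\<^bsub>A\<^esub>)"
  proof (rule A.finprod_cong'[OF refl])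
    show "(\<lambda>z. \<Otimes>\<^bsub>A\<^esub>t\<in>S. if \<phi> z j = i then k t (m (z \<otimes>\<^bsub>G\<^esub> inv\<^bsub>G\<^esub> t)) else \<one>\<^bsub>A\<^esub>) \<in> ?Z \<rightarrow> carrier A"
      using c Z by (intro funcsetI A.finprod_closed) (auto simp: subset_iff)
    fix z assume "z \<in> ?Z"
    then have z: "z \<in> carrier G" using Z by blast
    show "(if \<phi> z j = i then ca m z else \<one>\<^bsub>A\<^esub>) = (\<Otimes>\<^bsub>A\<^esub>t\<in>S. if \<phi> z j = i then k t (m (z \<otimes>\<^bsub>G\<^esub> inv\<^bsub>G\<^esub> t)) else \<one>\<^bsub>A\<^esub>)"
      using z by (simp add: ca_apply)
  qed
  also have "\<dots> = (\<Otimes>\<^bsub>A\<^esub>t\<in>S. \<Otimes>\<^bsub>A\<^esub>z\<in>?Z. if \<phi> z j = i then k t (m (z \<otimes>\<^bsub>G\<^esub> inv\<^bsub>G\<^esub> t)) else \<one>\<^bsub>A\<^esub>)"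
    using Z finite_S c by (intro A.finprod_swap) (auto simp: subset_iff)
  also have "\<dots> = (\<Otimes>\<^bsub>A\<^esub>t\<in>S. \<Otimes>\<^bsub>A\<^esub>y\<in>E. if \<phi> (y \<otimes>\<^bsub>G\<^esub> t) j = i then k t (m y) else \<one>\<^bsub>A\<^esub>)"
  proof (rule A.finprod_cong'[OF refl])
    show "(\<lambda>t. \<Otimes>\<^bsub>A\<^esub>y\<in>E. if \<phi> (y \<otimes>\<^bsub>G\<^esub> t) j = i then k t (m y) else \<one>\<^bsub>A\<^esub>) \<in> S \<rightarrow> carrier A"
      using E mc by (intro funcsetI A.finprod_closed) (auto simp: k_closed subset_iff)
    fix t assume t: "t \<in> S"
    let ?h = "\<lambda>z. if \<phi> z j = i then k t (m (z \<otimes>\<^bsub>G\<^esub> inv\<^bsub>G\<^esub> t)) else \<one>\<^bsub>A\<^esub>"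
    have "(\<Otimes>\<^bsub>A\<^esub>z\<in>?Z. ?h z) = (\<Otimes>\<^bsub>A\<^esub>z\<in>(\<lambda>y. y \<otimes>\<^bsub>G\<^esub> t) ` E. ?h z)"
    proof (rule A.finprod_mono_neutral_cong_right[OF Z(1)])
      show "(\<lambda>y. y \<otimes>\<^bsub>G\<^esub> t) ` E \<subseteq> ?Z" using t by blast
      show "?h \<in> ?Z \<rightarrow> carrier A" using c t Z by (auto simp: subset_iff)
      fix z assume z: "z \<in> ?Z - (\<lambda>y. y \<otimes>\<^bsub>G\<^esub> t) ` E"
      then have zc: "z \<in> carrier G" using Z by blast
      have "z = (z \<otimes>\<^bsub>G\<^esub> inv\<^bsub>G\<^esub> t) \<otimes>\<^bsub>G\<^esub> t" using zc t by (simp add: G.m_assoc S_carrier)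
      then have "z \<otimes>\<^bsub>G\<^esub> inv\<^bsub>G\<^esub> t \<notin> E" using z by blast
      moreover have "z \<otimes>\<^bsub>G\<^esub> inv\<^bsub>G\<^esub> t \<in> carrier G" using zc t by (simp add: S_carrier)
      ultimately have "m (z \<otimes>\<^bsub>G\<^esub> inv\<^bsub>G\<^esub> t) = \<one>\<^bsub>A\<^esub>" using E(2) by blast
      then show "?h z = \<one>\<^bsub>A\<^esub>" using t by (simp add: k_one)
    qed simp
    also have "\<dots> = (\<Otimes>\<^bsub>A\<^esub>y\<in>E. ?h (y \<otimes>\<^bsub>G\<^esub> t))"
    proof (rule A.finprod_reindex)
      show "?h \<in> (\<lambda>y. y \<otimes>\<^bsub>G\<^esub> t) ` E \<rightarrow> carrier A" using c t E by (auto simp: S_carrier subset_iff)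
      show "inj_on (\<lambda>y. y \<otimes>\<^bsub>G\<^esub> t) E" using t E by (auto simp: inj_on_def S_carrier subset_iff)
    qed
    also have "\<dots> = (\<Otimes>\<^bsub>A\<^esub>y\<in>E. if \<phi> (y \<otimes>\<^bsub>G\<^esub> t) j = i then k t (m y) else \<one>\<^bsub>A\<^esub>)"
      using E t mc by (intro A.finprod_cong') (auto simp: S_carrier G.m_assoc k_closed subset_iff)
    finally show "(\<Otimes>\<^bsub>A\<^esub>z\<in>?Z. ?h z) = (\<Otimes>\<^bsub>A\<^esub>y\<in>E. if \<phi> (y \<otimes>\<^bsub>G\<^esub> t) j = i then k t (m y) else \<one>\<^bsub>A\<^esub>)" .
  qed
  finally show ?thesis using lhs by simp
qed

lemma transport_point_mass:
  assumes "a \<in> carrier A"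
  shows "transport \<phi> (point_mass A G a \<one>\<^bsub>G\<^esub>) i p = (if \<phi> \<one>\<^bsub>G\<^esub> p = i then a else \<one>\<^bsub>A\<^esub>)"
proof -
  have "transport \<phi> (point_mass A G a \<one>\<^bsub>G\<^esub>) i p
      = (\<Otimes>\<^bsub>A\<^esub>y\<in>{\<one>\<^bsub>G\<^esub>}. if \<phi> y p = i then point_mass A G a \<one>\<^bsub>G\<^esub> y else \<one>\<^bsub>A\<^esub>)"
    using assms by (intro transport_superset) (auto simp: point_mass_base, auto simp: point_mass_def split: if_splits)
  then show ?thesis using assms by (simp add: point_mass_def)
qed

lemma preimages_of_point_masses:
  assumes "ca ` carrier base = carrier base"
  obtains w where "\<And>a. a \<in> carrier A \<Longrightarrow> w a \<in> carrier base"
    and "\<And>a. a \<in> carrier A \<Longrightarrow> ca (w a) = point_mass A G a \<one>\<^bsub>G\<^esub>"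
proof -
  have "\<exists>w\<in>carrier base. ca w = point_mass A G a \<one>\<^bsub>G\<^esub>" if "a \<in> carrier A" for a
  proof -
    have "point_mass A G a \<one>\<^bsub>G\<^esub> \<in> ca ` carrier base" using assms that by (simp add: point_mass_base)
    then show ?thesis by (metis (no_types, lifting) imageE)
  qed
  then show thesis using that by metis
qed

text \<open>For \<open>J \<subseteq> I\<close> and \<open>b : D \<rightarrow> A\<close> consider the configuration on \<open>{1..n}\<close> that has a copy of the kernel element \<open>u\<close>
at each \<open>i \<in> J\<close> and a copy of a preimage of the point mass \<open>b i\<close> at each \<open>i \<in> D\<close>. The model automaton
kills the former and maps the latter to \<open>b\<close>, so \<open>b\<close> can be recovered; the point \<open>r j\<close> where the value \<open>u y0\<close> of the
copy of \<open>u\<close> at \<open>j\<close> appears is not touched by the copies at other points of \<open>I\<close>, so \<open>J\<close> can be recovered as well.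
Hence there are at least as many configurations as pairs \<open>(J, b)\<close>.\<close>

lemma counting_bound:
  fixes n :: nat
  assumes fin: "finite (carrier A)"
    and u: "u \<in> carrier base" "ca u = zero" and y0: "y0 \<in> supp u"
    and w: "\<And>a. a \<in> carrier A \<Longrightarrow> w a \<in> carrier base"
      "\<And>a. a \<in> carrier A \<Longrightarrow> ca (w a) = point_mass A G a \<one>\<^bsub>G\<^esub>"
    and E: "finite E" "E \<subseteq> carrier G" "supp u \<subseteq> E" "\<And>a. a \<in> carrier A \<Longrightarrow> supp (w a) \<subseteq> E"
    and perm: "\<And>y. y \<in> S \<Longrightarrow> \<phi> y permutes {1..n}" "\<phi> \<one>\<^bsub>G\<^esub> permutes {1..n}" "\<phi> y0 permutes {1..n}"
    and D: "D \<subseteq> {1..n}"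
    and good: "\<And>i y t p. \<lbrakk>i \<in> D; y \<in> E; t \<in> S; p \<in> {1..n}\<rbrakk> \<Longrightarrow> \<phi> y (\<phi> t p) = i \<longleftrightarrow> \<phi> (y \<otimes>\<^bsub>G\<^esub> t) p = i"
    and I: "I \<subseteq> D"
    and sep: "\<And>i j y. \<lbrakk>i \<in> I; j \<in> I; y \<in> supp u; (i, y) \<noteq> (j, y0)\<rbrakk> \<Longrightarrow> \<phi> y (r j) \<noteq> i"
    and r: "\<And>j. j \<in> I \<Longrightarrow> \<phi> y0 (r j) = j"
  shows "2 ^ card I * card (carrier A) ^ card D \<le> card (carrier A) ^ n"
proof -
  have finD: "finite D" "finite I"
    using finite_subset[OF D] finite_subset[OF I] by simp_all
  have i_sub: "J \<subseteq> D" "finite J" if "J \<in> Pow I" for J using that I finD finite_subset by auto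
  define f where "f = (\<lambda>J p. \<Otimes>\<^bsub>A\<^esub>i\<in>J. transport \<phi> u i p)"
  define g where "g = (\<lambda>b p. \<Otimes>\<^bsub>A\<^esub>i\<in>D. transport \<phi> (w (b i)) i p)"
  have fc: "f J p \<in> carrier A" for J p
    unfolding f_def using u by (intro A.finprod_closed) (auto simp: transport_closed)
  have gc: "g b p \<in> carrier A" if "b \<in> D \<rightarrow>\<^sub>E carrier A" for b p
    unfolding g_def using that w(1) by (intro A.finprod_closed) (auto intro!: transport_closed)
  have mf: "model \<phi> (f J) j = \<one>\<^bsub>A\<^esub>" if J: "J \<in> Pow I" and j: "j \<in> {1..n}" for J j
  proof -
    have "model \<phi> (f J) j = (\<Otimes>\<^bsub>A\<^esub>i\<in>J. model \<phi> (transport \<phi> u i) j)"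
      unfolding f_def using i_sub[OF J] u by (intro model_finprod) (auto simp: transport_closed)
    also have "\<dots> = \<one>\<^bsub>A\<^esub>"
    proof (rule A.finprod_one_eqI)
      fix i assume "i \<in> J"
      then have "model \<phi> (transport \<phi> u i) j = transport \<phi> (ca u) i j"
        using good j i_sub[OF J] by (intro model_transport[OF u(1) E(1,3,2)]) blast
      also have "\<dots> = \<one>\<^bsub>A\<^esub>" unfolding u(2) transport_def by (rule A.finprod_one_eqI) auto
      finally show "model \<phi> (transport \<phi> u i) j = \<one>\<^bsub>A\<^esub>" .
    qed
    finally show ?thesis .
  qed
  have mg: "model \<phi> (g b) j = (\<Otimes>\<^bsub>A\<^esub>i\<in>D. if \<phi> \<one>\<^bsub>G\<^esub> j = i then b i else \<one>\<^bsub>A\<^esub>)"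
    if b: "b \<in> D \<rightarrow>\<^sub>E carrier A" and j: "j \<in> {1..n}" for b j
  proof -
    have "model \<phi> (g b) j = (\<Otimes>\<^bsub>A\<^esub>i\<in>D. model \<phi> (transport \<phi> (w (b i)) i) j)"
      unfolding g_def using finD b w(1) by (intro model_finprod) (auto intro!: transport_closed)
    also have "\<dots> = (\<Otimes>\<^bsub>A\<^esub>i\<in>D. if \<phi> \<one>\<^bsub>G\<^esub> j = i then b i else \<one>\<^bsub>A\<^esub>)"
    proof (rule A.finprod_cong'[OF refl])
      show "(\<lambda>i. if \<phi> \<one>\<^bsub>G\<^esub> j = i then b i else \<one>\<^bsub>A\<^esub>) \<in> D \<rightarrow> carrier A" using b by auto
      fix i assume i: "i \<in> D"
      then have bi: "b i \<in> carrier A" using b by auto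
      have "model \<phi> (transport \<phi> (w (b i)) i) j = transport \<phi> (ca (w (b i))) i j"
        using good[OF i _ _ j] by (intro model_transport[OF w(1)[OF bi] E(1) E(4)[OF bi] E(2)])
      then show "model \<phi> (transport \<phi> (w (b i)) i) j = (if \<phi> \<one>\<^bsub>G\<^esub> j = i then b i else \<one>\<^bsub>A\<^esub>)"
        using bi by (simp add: w(2) transport_point_mass)
    qed
    finally show ?thesis .
  qed
  define h where "h = (\<lambda>(J, b). \<lambda>p\<in>{1..n}. f J p \<otimes>\<^bsub>A\<^esub> g b p)"
  have "inj_on h (Pow I \<times> (D \<rightarrow>\<^sub>E carrier A))"
  proof (rule inj_onI)
    fix x x' assume x: "x \<in> Pow I \<times> (D \<rightarrow>\<^sub>E carrier A)" and x': "x' \<in> Pow I \<times> (D \<rightarrow>\<^sub>E carrier A)" and eq: "h x = h x'"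
    obtain J b where Jb: "x = (J, b)" "J \<in> Pow I" "b \<in> D \<rightarrow>\<^sub>E carrier A" using x by blast
    obtain J' b' where Jb': "x' = (J', b')" "J' \<in> Pow I" "b' \<in> D \<rightarrow>\<^sub>E carrier A" using x' by blast
    have pt: "f J p \<otimes>\<^bsub>A\<^esub> g b p = f J' p \<otimes>\<^bsub>A\<^esub> g b' p" if "p \<in> {1..n}" for p
      using fun_cong[OF eq, of p] that by (simp add: h_def Jb Jb')
    have mod: "model \<phi> (\<lambda>p. f J p \<otimes>\<^bsub>A\<^esub> g b p) j = model \<phi> (\<lambda>p. f J' p \<otimes>\<^bsub>A\<^esub> g b' p) j" if j: "j \<in> {1..n}" for j
      unfolding model_def using pt permutes_in_image[OF perm(1)] j fc gc[OF Jb'(3)]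
      by (intro A.finprod_cong') (auto simp: k_closed)
    \<comment> \<open>Applying the model to the configuration yields \<open>b i\<close> at the point that \<open>\<phi> \<one>\<close> maps to \<open>i\<close>.\<close>
    have bb: "b = b'"
    proof (rule PiE_ext[OF Jb(3) Jb'(3)])
      fix i assume i: "i \<in> D"
      then have "i \<in> \<phi> \<one>\<^bsub>G\<^esub> ` {1..n}" using D permutes_image[OF perm(2)] by auto
      then obtain j where j: "j \<in> {1..n}" "\<phi> \<one>\<^bsub>G\<^esub> j = i" by blast
      have val: "model \<phi> (\<lambda>p. f K p \<otimes>\<^bsub>A\<^esub> g c p) j = c i" if K: "K \<in> Pow I" and c: "c \<in> D \<rightarrow>\<^sub>E carrier A" for K c
      proof -
        have "model \<phi> (\<lambda>p. f K p \<otimes>\<^bsub>A\<^esub> g c p) j = model \<phi> (f K) j \<otimes>\<^bsub>A\<^esub> model \<phi> (g c) j"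
          by (rule model_mult[OF fc gc[OF c]])
        also have "\<dots> = model \<phi> (g c) j"
          using mf[OF K j(1)] model_closed[of "g c", OF gc[OF c]] by simp
        also have "\<dots> = (\<Otimes>\<^bsub>A\<^esub>l\<in>D. if i = l then c l else \<one>\<^bsub>A\<^esub>)"
          using mg[OF c j(1)] j(2) by simp
        also have "\<dots> = c i" using i finD c by (intro A.finprod_singleton) auto
        finally show ?thesis .
      qed
      show "b i = b' i" using mod[OF j(1)] val[OF Jb(2,3)] val[OF Jb'(2,3)] by simp
    qed
    have fJ: "f J p = f J' p" if "p \<in> {1..n}" for p
      using pt[OF that] fc gc[OF Jb(3)] unfolding bb by (simp add: A.r_cancel)
    have fval: "f K (r j) = (if j \<in> K then u y0 else \<one>\<^bsub>A\<^esub>)" if K: "K \<in> Pow I" and j: "j \<in> I" for K j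
    proof -
      let ?p = "r j"
      have tr: "transport \<phi> u i ?p = (if j = i then u y0 else \<one>\<^bsub>A\<^esub>)" if i: "i \<in> I" for i
      proof -
        have "transport \<phi> u i ?p = (\<Otimes>\<^bsub>A\<^esub>y\<in>supp u. if y0 = y then (if j = i then u y else \<one>\<^bsub>A\<^esub>) else \<one>\<^bsub>A\<^esub>)"
          unfolding transport_def using sep[OF i j] r[OF j] base_value[OF u(1)]
          by (intro A.finprod_cong') auto
        also have "\<dots> = (if j = i then u y0 else \<one>\<^bsub>A\<^esub>)"
          using y0 u base_value[OF u(1)] by (intro A.finprod_singleton) (auto simp: base_carrier)
        finally show ?thesis .
      qed
      have "f K ?p = (\<Otimes>\<^bsub>A\<^esub>i\<in>K. if j = i then u y0 else \<one>\<^bsub>A\<^esub>)"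
        unfolding f_def using tr K y0 base_value[OF u(1)] by (intro A.finprod_cong') auto
      also have "\<dots> = (if j \<in> K then u y0 else \<one>\<^bsub>A\<^esub>)"
        using i_sub[OF K] y0 base_value[OF u(1)]
        by (auto intro!: A.finprod_singleton[of j K "\<lambda>_. u y0"] A.finprod_one_eqI)
      finally show ?thesis .
    qed
    have "j \<in> J \<longleftrightarrow> j \<in> J'" if j: "j \<in> I" for j
    proof -
      have "j \<in> {1..n}" using j I D by auto
      then have "r j \<in> {1..n}" using r[OF j] permutes_in_image[OF perm(3)] by metis
      from fJ[OF this] show ?thesis using fval[OF Jb(2) j] fval[OF Jb'(2) j] y0 by (auto split: if_splits)
    qed
    then have "J = J'" using Jb(2) Jb'(2) by auto
    then show "x = x'" using Jb Jb' bb by simp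
  qed
  moreover have "h ` (Pow I \<times> (D \<rightarrow>\<^sub>E carrier A)) \<subseteq> {1..n} \<rightarrow>\<^sub>E carrier A"
    using fc gc by (auto simp: h_def)
  moreover have "finite ({1..n} \<rightarrow>\<^sub>E carrier A)" using fin by (intro finite_PiE) auto
  ultimately have "card (Pow I \<times> (D \<rightarrow>\<^sub>E carrier A)) \<le> card ({1..n} \<rightarrow>\<^sub>E carrier A)"
    by (rule card_inj_on_le)
  then show ?thesis using finD by (simp add: card_cartesian_product card_Pow card_funcsetE)
qed

end

lemma hamming_dist_le_iff:
  "1 \<le> n \<Longrightarrow> hamming_dist n \<sigma> \<tau> \<le> \<epsilon> \<longleftrightarrow> real (card {i \<in> {1..n}. \<sigma> i \<noteq> \<tau> i}) \<le> \<epsilon> * real n"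
  by (simp add: hamming_dist_def divide_le_eq)

text \<open>In a sufficiently good sofic approximation on \<open>n\<close> points, the number of points outside \<open>D\<close>, where \<open>\<phi>\<close> is not
multiplicative on the relevant finite set, is a small fraction of \<open>n\<close>. By \<open>independent_subset\<close> a fixed fraction of
the remaining points, depending on the size of the support of \<open>u\<close> alone, carry copies of the kernel element \<open>u\<close> that
do not disturb each other. This contradicts \<open>counting_bound\<close>.\<close>

theorem (in wreath_factors) sofic_imp_hopfian_automata:
  assumes fin: "finite (carrier A)" and sofic: "sofic G"
  shows "hopfian_automata A G"
  unfolding hopfian_automata_def
proof (intro allI impI ballI, elim conjE)
  fix S :: "'g set" and k u
  assume S: "finite S" "S \<subseteq> carrier G" and k: "\<forall>t\<in>S. k t \<in> hom A A"
    and onto: "cellular_automaton A G S k ` carrier base = carrier base"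
    and u: "u \<in> carrier base" "cellular_automaton A G S k u = zero"
  interpret automaton A G S k by unfold_locales (use S k in auto)
  show "u = zero"
  proof (rule ccontr)
    assume "u \<noteq> zero"
    then obtain y0 where y0: "y0 \<in> supp u" using base_ext[OF u(1) zero_base] by auto
    obtain w where w: "\<And>a. a \<in> carrier A \<Longrightarrow> w a \<in> carrier base"
      "\<And>a. a \<in> carrier A \<Longrightarrow> ca (w a) = point_mass A G a \<one>\<^bsub>G\<^esub>"
      using preimages_of_point_masses[OF onto] by metis
    define U where "U = supp u"
    \<comment> \<open>All points used by the copies: the supports of the kernel element and of the preimages of point masses.\<close>
    define E where "E = (\<Union>a\<in>carrier A. supp (w a)) \<union> U"
    define F where "F = {\<one>\<^bsub>G\<^esub>} \<union> E \<union> S \<union> (\<lambda>(y, t). y \<otimes>\<^bsub>G\<^esub> t) ` (E \<times> S) \<union> (\<lambda>y. inv\<^bsub>G\<^esub> y \<otimes>\<^bsub>G\<^esub> y0) ` U"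
    have U: "finite U" "U \<subseteq> carrier G" "y0 \<in> U" using u(1) y0 by (auto simp: U_def base_carrier)
    have E: "finite E" "E \<subseteq> carrier G" "U \<subseteq> E" using U fin w(1) by (auto simp: E_def base_carrier)
    have F: "finite F" "F \<subseteq> carrier G" using E U S y0 by (auto simp: F_def)
    define q where "q = card (carrier A)"
    define K where "K = real (2 * card E * card S + 2 * card U)"
    \<comment> \<open>At most \<open>K \<epsilon> n\<close> points are lost below, and \<open>\<epsilon>\<close> is chosen so that \<open>K \<epsilon> (1 + 2 card U q) < 1\<close>.\<close>
    define \<epsilon> where "\<epsilon> = 1 / (K * (2 + 2 * card U * q))"
    have "card U \<ge> 1" using U by (metis One_nat_def Suc_leI card_gt_0_iff empty_iff)
    then have "2 \<le> 2 * card E * card S + 2 * card U" by simp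
    then have K2: "K \<ge> 2" unfolding K_def by (metis of_nat_le_iff of_nat_numeral)
    have \<epsilon>: "0 < \<epsilon>" "\<epsilon> < 1"
    proof -
      have "K * (2 + 2 * card U * q) \<ge> 2 * 2" using K2 by (intro mult_mono) auto
      then show "0 < \<epsilon>" "\<epsilon> < 1" by (auto simp: \<epsilon>_def)
    qed
    obtain n \<phi> where n: "n \<ge> 1" and \<phi>: "\<phi> \<in> F \<rightarrow> carrier (sym_group n)"
      and near_mult: "\<And>g h. \<lbrakk>g \<in> F; h \<in> F; g \<otimes>\<^bsub>G\<^esub> h \<in> F\<rbrakk> \<Longrightarrow>
           hamming_dist n (\<phi> (g \<otimes>\<^bsub>G\<^esub> h)) (\<phi> g \<otimes>\<^bsub>sym_group n\<^esub> \<phi> h) \<le> \<epsilon>"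
      and far: "\<And>g. \<lbrakk>g \<in> F; g \<noteq> \<one>\<^bsub>G\<^esub>\<rbrakk> \<Longrightarrow> hamming_dist n (\<phi> g) \<one>\<^bsub>sym_group n\<^esub> \<ge> 1 - \<epsilon>"
      using sofic[unfolded sofic_def, rule_format, of \<epsilon> F] \<epsilon> F by blast
    have perm: "\<phi> g permutes {1..n}" if "g \<in> F" for g
      using \<phi> that by (auto simp: sym_group_def)
    define bad where "bad = (\<lambda>y t. {p \<in> {1..n}. \<phi> (y \<otimes>\<^bsub>G\<^esub> t) p \<noteq> \<phi> y (\<phi> t p)})"
    have bad_card: "real (card (bad y t)) \<le> \<epsilon> * n" if "y \<in> F" "t \<in> F" "y \<otimes>\<^bsub>G\<^esub> t \<in> F" for y t
      using near_mult[OF that] n by (simp add: hamming_dist_le_iff bad_def sym_group_def)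
    have bad_fin: "finite (bad y t)" for y t by (simp add: bad_def)
    have fixed_card: "real (card {p \<in> {1..n}. \<phi> g p = p}) \<le> \<epsilon> * n" if g: "g \<in> F" "g \<noteq> \<one>\<^bsub>G\<^esub>" for g
    proof -
      have "card {1..n} = card ({p \<in> {1..n}. \<phi> g p = p} \<union> {p \<in> {1..n}. \<phi> g p \<noteq> p})"
        by (intro arg_cong[where f = card]) auto
      also have "\<dots> = card {p \<in> {1..n}. \<phi> g p = p} + card {p \<in> {1..n}. \<phi> g p \<noteq> p}"
        by (rule card_Un_disjoint) auto
      finally have "real n = real (card {p \<in> {1..n}. \<phi> g p = p}) + real (card {p \<in> {1..n}. \<phi> g p \<noteq> p})" by simp
      moreover have "(1 - \<epsilon>) * n \<le> real (card {p \<in> {1..n}. \<phi> g p \<noteq> p})"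
        using far[OF g] n by (simp add: hamming_dist_def sym_group_def le_divide_eq)
      ultimately show ?thesis by (simp add: algebra_simps)
    qed
    \<comment> \<open>Targets \<open>i\<close> at which the hypothesis of \<open>model_transport\<close> may fail for some \<open>j\<close>.\<close>
    define B1 where "B1 = (\<Union>(y, t)\<in>E \<times> S. \<phi> (y \<otimes>\<^bsub>G\<^esub> t) ` bad y t \<union> (\<lambda>p. \<phi> y (\<phi> t p)) ` bad y t)"
    define D where "D = {1..n} - B1"
    have inF: "y \<in> F" "t \<in> F" "y \<otimes>\<^bsub>G\<^esub> t \<in> F" if "y \<in> E" "t \<in> S" for y t
      using that by (auto simp: F_def)
    have B1_fin: "finite B1" unfolding B1_def using E S bad_fin by auto
    have B1_card: "real (card B1) \<le> real (card E * card S) * (2 * (\<epsilon> * n))"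
    proof -
      have "card B1 \<le> (\<Sum>x\<in>E \<times> S. card (case x of (y, t) \<Rightarrow> \<phi> (y \<otimes>\<^bsub>G\<^esub> t) ` bad y t \<union> (\<lambda>p. \<phi> y (\<phi> t p)) ` bad y t))"
        unfolding B1_def using E S by (intro card_UN_le) auto
      then have "real (card B1) \<le> (\<Sum>x\<in>E \<times> S. real (card (case x of (y, t) \<Rightarrow> \<phi> (y \<otimes>\<^bsub>G\<^esub> t) ` bad y t \<union> (\<lambda>p. \<phi> y (\<phi> t p)) ` bad y t)))"
        by (simp flip: of_nat_sum)
      also have "\<dots> \<le> (\<Sum>x\<in>E \<times> S. 2 * (\<epsilon> * n))"
      proof (rule sum_mono)
        fix x assume "x \<in> E \<times> S"
        then obtain y t where x: "x = (y, t)" "y \<in> E" "t \<in> S" by blast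
        have "card (\<phi> (y \<otimes>\<^bsub>G\<^esub> t) ` bad y t \<union> (\<lambda>p. \<phi> y (\<phi> t p)) ` bad y t)
            \<le> card (\<phi> (y \<otimes>\<^bsub>G\<^esub> t) ` bad y t) + card ((\<lambda>p. \<phi> y (\<phi> t p)) ` bad y t)" by (rule card_Un_le)
        also have "\<dots> \<le> card (bad y t) + card (bad y t)" using bad_fin by (intro add_mono card_image_le)
        finally show "real (card (case x of (y, t) \<Rightarrow> \<phi> (y \<otimes>\<^bsub>G\<^esub> t) ` bad y t \<union> (\<lambda>p. \<phi> y (\<phi> t p)) ` bad y t)) \<le> 2 * (\<epsilon> * n)"
          using bad_card[OF inF[OF x(2,3)]] x(1) by simp
      qed
      finally show ?thesis by (simp add: card_cartesian_product)
    qed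
    have good: "\<phi> y (\<phi> t p) = i \<longleftrightarrow> \<phi> (y \<otimes>\<^bsub>G\<^esub> t) p = i"
      if i: "i \<in> D" and yt: "y \<in> E" "t \<in> S" and p: "p \<in> {1..n}" for i y t p
    proof (cases "p \<in> bad y t")
      case True
      then have "\<phi> y (\<phi> t p) \<in> B1" "\<phi> (y \<otimes>\<^bsub>G\<^esub> t) p \<in> B1" using yt unfolding B1_def by blast+
      then show ?thesis using i by (auto simp: D_def)
    qed (use p in \<open>auto simp: bad_def\<close>)
    \<comment> \<open>The point where the copy of \<open>u\<close> at \<open>j\<close> shows the value \<open>u y0\<close>.\<close>
    define r where "r = inv_into UNIV (\<phi> y0)"
    have UF: "y \<in> F" if "y \<in> U" for y using that E by (auto simp: F_def)
    have inv1: "\<phi> y (inv_into UNIV (\<phi> y) j) = j" "inv_into UNIV (\<phi> y) (\<phi> y j) = j" if "y \<in> U" for y j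
      using permutes_inverses[OF perm[OF UF[OF that]]] by auto
    have r: "\<phi> y0 (r j) = j" "r (\<phi> y0 j) = j" for j using inv1[OF U(3)] by (auto simp: r_def)
    have r_in: "r j \<in> {1..n}" if "j \<in> {1..n}" for j
      using permutes_in_image[OF perm[OF UF[OF U(3)]], of "r j"] that by (simp add: r)
    \<comment> \<open>Where \<open>\<phi> y\<close> and \<open>\<phi> y0\<close> coincide, two values of one copy of \<open>u\<close> fall together; this is rare because \<open>\<phi> (y\<inverse> y0)\<close> is almost free of fixed points.\<close>
    define coin where "coin = (\<lambda>y. {p \<in> {1..n}. \<phi> y p = \<phi> y0 p})"
    have coin_card: "real (card (coin y)) \<le> 2 * (\<epsilon> * n)" if y: "y \<in> U" "y \<noteq> y0" for y
    proof -
      let ?g = "inv\<^bsub>G\<^esub> y \<otimes>\<^bsub>G\<^esub> y0"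
      have c: "y \<in> carrier G" "y0 \<in> carrier G" using y U by auto
      have g: "?g \<in> F" "y \<otimes>\<^bsub>G\<^esub> ?g = y0" "?g \<noteq> \<one>\<^bsub>G\<^esub>"
      proof -
        show "?g \<in> F" using y by (auto simp: F_def)
        show *: "y \<otimes>\<^bsub>G\<^esub> ?g = y0" using c by (simp flip: G.m_assoc)
        show "?g \<noteq> \<one>\<^bsub>G\<^esub>" using * c y(2) by auto
      qed
      have "coin y \<subseteq> bad y ?g \<union> {p \<in> {1..n}. \<phi> ?g p = p}"
      proof
        fix p assume p: "p \<in> coin y"
        show "p \<in> bad y ?g \<union> {p \<in> {1..n}. \<phi> ?g p = p}"
        proof (cases "p \<in> bad y ?g")
          case False
          then have "\<phi> y (\<phi> ?g p) = \<phi> y p" using p g by (auto simp: bad_def coin_def)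
          then have "\<phi> ?g p = p" using inv1[OF y(1)] by metis
          then show ?thesis using p by (simp add: coin_def)
        qed simp
      qed
      then have "card (coin y) \<le> card (bad y ?g \<union> {p \<in> {1..n}. \<phi> ?g p = p})"
        using bad_fin by (intro card_mono) auto
      also have "\<dots> \<le> card (bad y ?g) + card {p \<in> {1..n}. \<phi> ?g p = p}" by (rule card_Un_le)
      finally have "real (card (coin y)) \<le> real (card (bad y ?g)) + real (card {p \<in> {1..n}. \<phi> ?g p = p})" by linarith
      moreover have "real (card (bad y ?g)) \<le> \<epsilon> * n"
        using g UF[OF y(1)] UF[OF U(3)] by (intro bad_card) auto
      ultimately show ?thesis using fixed_card[OF g(1,3)] by linarith
    qed
    define B2 where "B2 = (\<Union>y\<in>U - {y0}. \<phi> y0 ` coin y)"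
    have B2_card: "real (card B2) \<le> real (card U) * (2 * (\<epsilon> * n))"
    proof -
      have "card B2 \<le> (\<Sum>y\<in>U - {y0}. card (\<phi> y0 ` coin y))"
        unfolding B2_def using U by (intro card_UN_le) auto
      also have "\<dots> \<le> (\<Sum>y\<in>U - {y0}. card (coin y))"
        by (intro sum_mono card_image_le) (simp add: coin_def)
      finally have "real (card B2) \<le> (\<Sum>y\<in>U - {y0}. real (card (coin y)))" by (simp flip: of_nat_sum)
      also have "\<dots> \<le> (\<Sum>y\<in>U - {y0}. 2 * (\<epsilon> * n))" using coin_card by (intro sum_mono) auto
      also have "\<dots> \<le> real (card U) * (2 * (\<epsilon> * n))"
        using U \<epsilon> by (simp add: mult_right_mono card_mono)
      finally show ?thesis .
    qed
    define V where "V = D - B2"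
    have V_card: "real n - K * (\<epsilon> * n) \<le> real (card V)"
    proof -
      have "{1..n} \<subseteq> V \<union> (B1 \<union> B2)" by (auto simp: V_def D_def)
      moreover have finB2: "finite B2" unfolding B2_def using U by (auto simp: coin_def)
      ultimately have "card {1..n} \<le> card (V \<union> (B1 \<union> B2))"
        using B1_fin by (intro card_mono) (auto simp: V_def D_def)
      also have "\<dots> \<le> card V + card (B1 \<union> B2)" by (rule card_Un_le)
      also have "\<dots> \<le> card V + (card B1 + card B2)" by (intro add_left_mono card_Un_le)
      finally have "real n \<le> real (card V) + (real (card B1) + real (card B2))" by simp
      then show ?thesis using B1_card B2_card by (simp add: K_def algebra_simps)
    qed
    have D_card: "real n - real (card D) \<le> K * (\<epsilon> * n)"
    proof -
      have "card {1..n} \<le> card (D \<union> B1)" using B1_fin by (intro card_mono) (auto simp: D_def)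
      also have "\<dots> \<le> card D + card B1" by (rule card_Un_le)
      finally have "real n \<le> real (card D) + real (card B1)" by simp
      moreover have "0 \<le> real (2 * card U) * (\<epsilon> * n)" using \<epsilon> by simp
      ultimately show ?thesis using B1_card by (simp add: K_def algebra_simps)
    qed
    \<comment> \<open>The points \<open>j\<close> for which the copy of \<open>u\<close> at \<open>j\<close> meets the point \<open>r i\<close>, or the copy at \<open>i\<close> meets \<open>r j\<close>.\<close>
    define N where "N = (\<lambda>i. (\<lambda>y. \<phi> y (r i)) ` U \<union> (\<lambda>y. \<phi> y0 (inv_into UNIV (\<phi> y) i)) ` U)"
    have VD: "V \<subseteq> D" "D \<subseteq> {1..n}" by (auto simp: V_def D_def)
    obtain I where I: "I \<subseteq> V" "\<And>i j. i \<in> I \<Longrightarrow> j \<in> I \<Longrightarrow> i \<noteq> j \<Longrightarrow> j \<notin> N i" "card V \<le> 2 * card U * card I"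
    proof (rule independent_subset[of V N "2 * card U"])
      show "finite V" using VD finite_subset[of V "{1..n}"] by auto
      show "finite (N i)" for i using U by (simp add: N_def)
      show "card (N i) \<le> 2 * card U" for i
      proof -
        have "card (N i) \<le> card ((\<lambda>y. \<phi> y (r i)) ` U) + card ((\<lambda>y. \<phi> y0 (inv_into UNIV (\<phi> y) i)) ` U)"
          unfolding N_def by (rule card_Un_le)
        also have "\<dots> \<le> card U + card U" using U by (intro add_mono card_image_le)
        finally show ?thesis by simp
      qed
      show "i \<in> N i" for i
      proof -
        have "i = \<phi> y0 (r i)" by (simp add: r)
        then show ?thesis using U(3) unfolding N_def by blast
      qed
      show "i \<in> N j" if j: "j \<in> N i" for i j
        using j unfolding N_def
      proof
        assume "j \<in> (\<lambda>y. \<phi> y (r i)) ` U"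
        then obtain y where y: "y \<in> U" "j = \<phi> y (r i)" by blast
        have "i = \<phi> y0 (inv_into UNIV (\<phi> y) j)" using inv1[OF y(1)] y(2) r by simp
        then show "i \<in> (\<lambda>y. \<phi> y (r j)) ` U \<union> (\<lambda>y. \<phi> y0 (inv_into UNIV (\<phi> y) j)) ` U" using y(1) by blast
      next
        assume "j \<in> (\<lambda>y. \<phi> y0 (inv_into UNIV (\<phi> y) i)) ` U"
        then obtain y where y: "y \<in> U" "j = \<phi> y0 (inv_into UNIV (\<phi> y) i)" by blast
        have "i = \<phi> y (r j)" using inv1[OF y(1)] y(2) r by simp
        then show "i \<in> (\<lambda>y. \<phi> y (r j)) ` U \<union> (\<lambda>y. \<phi> y0 (inv_into UNIV (\<phi> y) j)) ` U" using y(1) by blast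
      qed
    qed (use that in blast)
    have sep: "\<phi> y (r j) \<noteq> i" if ij: "i \<in> I" "j \<in> I" and y: "y \<in> supp u" and ne: "(i, y) \<noteq> (j, y0)" for i j y
    proof
      assume eq: "\<phi> y (r j) = i"
      have yU: "y \<in> U" using y by (simp add: U_def)
      show False
      proof (cases "i = j")
        case True
        have "j \<in> V" using ij I by blast
        then have "r j \<in> coin y" using r_in[of j] VD eq True by (auto simp: coin_def r)
        then have "\<phi> y0 (r j) \<in> B2" using yU ne True unfolding B2_def by blast
        then show False using \<open>j \<in> V\<close> by (simp add: r V_def)
      next
        case False
        have "i \<in> N j" using eq yU unfolding N_def by blast
        then show False using I(2)[OF ij(2,1)] False by blast
      qed
    qed
    have "2 ^ card I * card (carrier A) ^ card D \<le> card (carrier A) ^ n"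
    proof (rule counting_bound[where \<phi> = \<phi> and r = r and E = E, OF fin u y0 w E(1,2)])
      show "supp u \<subseteq> E" using E by (simp add: U_def)
      show "supp (w a) \<subseteq> E" if "a \<in> carrier A" for a using that unfolding E_def by blast
      show "\<phi> y permutes {1..n}" if "y \<in> S" for y using that by (intro perm) (simp add: F_def)
      show "\<phi> \<one>\<^bsub>G\<^esub> permutes {1..n}" by (intro perm) (simp add: F_def)
      show "\<phi> y0 permutes {1..n}" using U E by (intro perm UF)
      show "D \<subseteq> {1..n}" "I \<subseteq> D" using VD I by auto
    qed (use good sep r in auto)
    then have count: "2 ^ card I * q ^ card D \<le> q ^ n" by (simp add: q_def)
    have "card D \<le> n" using card_mono[of "{1..n}" D] VD by simp
    have q2: "q \<ge> 2"
    proof -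
      have "{\<one>\<^bsub>A\<^esub>, u y0} \<subseteq> carrier A" using y0 base_value[OF u(1)] by auto
      then have "card {\<one>\<^bsub>A\<^esub>, u y0} \<le> q" unfolding q_def using fin by (intro card_mono)
      moreover have "card {\<one>\<^bsub>A\<^esub>, u y0} = 2" using y0 by (subst card_insert_disjoint) auto
      ultimately show ?thesis by simp
    qed
    \<comment> \<open>Here \<open>q < 2\<^sup>q\<close> replaces a logarithm.\<close>
    have "card I \<le> q * (n - card D)"
    proof -
      have "2 ^ card I * q ^ card D \<le> q ^ (n - card D) * q ^ card D"
        using count \<open>card D \<le> n\<close> by (simp flip: power_add)
      then have "2 ^ card I \<le> q ^ (n - card D)" using q2 by simp
      also have "\<dots> \<le> (2 ^ q) ^ (n - card D)" by (intro power_mono) (auto intro: less_imp_le)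
      also have "\<dots> = 2 ^ (q * (n - card D))" by (simp add: power_mult)
      finally show ?thesis by simp
    qed
    then have "real (card V) \<le> 2 * real (card U) * (real q * (real n - real (card D)))"
    proof -
      assume "card I \<le> q * (n - card D)"
      then have "card V \<le> 2 * card U * (q * (n - card D))"
        using I(3) by (meson le_trans mult_le_mono2)
      then have "real (card V) \<le> real (2 * card U * (q * (n - card D)))" by (rule of_nat_mono)
      then show ?thesis using \<open>card D \<le> n\<close> by (simp add: of_nat_diff)
    qed
    also have "\<dots> \<le> 2 * real (card U) * (real q * (K * (\<epsilon> * n)))"
      using D_card by (intro mult_left_mono) auto
    finally have "real n \<le> K * (\<epsilon> * n) + 2 * real (card U) * (real q * (K * (\<epsilon> * n)))"
      using V_card by linarith
    also have "\<dots> = (K * \<epsilon> * (1 + 2 * card U * q)) * n" by (simp add: algebra_simps)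
    finally have "1 \<le> K * \<epsilon> * (1 + 2 * card U * q)" using n by simp
    also have "K * \<epsilon> = 1 / (2 + 2 * card U * q)" using K2 by (simp add: \<epsilon>_def)
    also have "1 / (2 + 2 * card U * q) * (1 + 2 * card U * q) < (1::real)"
      by (simp add: divide_less_eq add_pos_nonneg)
    finally show False by simp
  qed
qed

section \<open>Bi-ordered groups: series with well-ordered support\<close>

locale bi_ordered_group = group G for G :: "('g, 'x) monoid_scheme" (structure) +
  fixes r :: "('g \<times> 'g) set"
  assumes linear: "linear_order_on (carrier G) r"
    and left_mono: "\<And>x y z. \<lbrakk>x \<in> carrier G; y \<in> carrier G; z \<in> carrier G; (x, y) \<in> r\<rbrakk> \<Longrightarrow> (z \<otimes> x, z \<otimes> y) \<in> r"
    and right_mono: "\<And>x y z. \<lbrakk>x \<in> carrier G; y \<in> carrier G; z \<in> carrier G; (x, y) \<in> r\<rbrakk> \<Longrightarrow> (x \<otimes> z, y \<otimes> z) \<in> r"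
begin

text \<open>Well-ordered with respect to the restriction of \<open>r\<close>, like the supports of Hahn series.\<close>

definition well_ordered :: "'g set \<Rightarrow> bool"
  where "well_ordered Y \<longleftrightarrow> Y \<subseteq> carrier G \<and> (\<forall>T. T \<subseteq> Y \<and> T \<noteq> {} \<longrightarrow> (\<exists>m\<in>T. \<forall>t\<in>T. (m, t) \<in> r))"

lemma r_order: "refl_on (carrier G) r" "trans r" "antisym r" "total_on (carrier G) r"
  using linear by (simp_all add: order_on_defs)

lemma le_refl: "x \<in> carrier G \<Longrightarrow> (x, x) \<in> r"
  by (rule refl_onD[OF r_order(1)])

lemma le_trans: "(x, y) \<in> r \<Longrightarrow> (y, z) \<in> r \<Longrightarrow> (x, z) \<in> r"
  by (rule transD[OF r_order(2)])

lemma le_antisym: "(x, y) \<in> r \<Longrightarrow> (y, x) \<in> r \<Longrightarrow> x = y"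
  by (rule antisymD[OF r_order(3)])

lemma le_total: "x \<in> carrier G \<Longrightarrow> y \<in> carrier G \<Longrightarrow> (x, y) \<in> r \<or> (y, x) \<in> r"
  using r_order(4) le_refl by (cases "x = y") (simp_all add: total_on_def)

lemma left_le_iff:
  assumes "x \<in> carrier G" "y \<in> carrier G" "z \<in> carrier G"
  shows "(z \<otimes> x, z \<otimes> y) \<in> r \<longleftrightarrow> (x, y) \<in> r"
proof
  assume "(z \<otimes> x, z \<otimes> y) \<in> r"
  then have "(inv z \<otimes> (z \<otimes> x), inv z \<otimes> (z \<otimes> y)) \<in> r" using left_mono[of "z \<otimes> x" "z \<otimes> y" "inv z"] assms by simp
  moreover have "inv z \<otimes> (z \<otimes> x) = x" "inv z \<otimes> (z \<otimes> y) = y" using assms by (simp_all flip: m_assoc)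
  ultimately show "(x, y) \<in> r" by simp
qed (use assms left_mono in blast)

lemma right_le_iff:
  assumes "x \<in> carrier G" "y \<in> carrier G" "z \<in> carrier G"
  shows "(x \<otimes> z, y \<otimes> z) \<in> r \<longleftrightarrow> (x, y) \<in> r"
proof
  assume "(x \<otimes> z, y \<otimes> z) \<in> r"
  then have "((x \<otimes> z) \<otimes> inv z, (y \<otimes> z) \<otimes> inv z) \<in> r" using right_mono[of "x \<otimes> z" "y \<otimes> z" "inv z"] assms by simp
  moreover have "(x \<otimes> z) \<otimes> inv z = x" "(y \<otimes> z) \<otimes> inv z = y" using assms by (simp_all add: m_assoc)
  ultimately show "(x, y) \<in> r" by simp
qed (use assms right_mono in blast)

lemma well_ordered_carrier: "well_ordered Y \<Longrightarrow> y \<in> Y \<Longrightarrow> y \<in> carrier G"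
  by (auto simp: well_ordered_def)

lemma well_ordered_ex_min:
  assumes "well_ordered Y" "T \<subseteq> Y" "T \<noteq> {}"
  shows "\<exists>m. m \<in> T \<and> (\<forall>t. t \<in> T \<longrightarrow> (m, t) \<in> r)"
  using assms by (simp add: well_ordered_def Bex_def Ball_def)

lemma well_ordered_min:
  assumes "well_ordered Y" "T \<subseteq> Y" "T \<noteq> {}"
  obtains m where "m \<in> T" "\<And>t. t \<in> T \<Longrightarrow> (m, t) \<in> r"
  using well_ordered_ex_min[OF assms] that by (elim exE conjE) simp

lemma well_orderedI:
  assumes "Y \<subseteq> carrier G" "\<And>T. T \<subseteq> Y \<Longrightarrow> T \<noteq> {} \<Longrightarrow> \<exists>m\<in>T. \<forall>t\<in>T. (m, t) \<in> r"
  shows "well_ordered Y"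
  unfolding well_ordered_def using assms by simp

lemma well_ordered_subset:
  assumes "well_ordered Y" "Z \<subseteq> Y" shows "well_ordered Z"
proof -
  have "T \<subseteq> Y" if "T \<subseteq> Z" for T using that assms(2) by (rule subset_trans)
  moreover have "Z \<subseteq> carrier G" using assms(2) well_ordered_carrier[OF assms(1)] by (meson subsetD subsetI)
  ultimately show ?thesis using assms(1) unfolding well_ordered_def by simp
qed

lemma well_ordered_empty: "well_ordered {}" by (simp add: well_ordered_def)

lemma well_ordered_Un:
  assumes "well_ordered Y" "well_ordered Z"
  shows "well_ordered (Y \<union> Z)"
proof (rule well_orderedI)
  show "Y \<union> Z \<subseteq> carrier G" using assms by (auto simp: well_ordered_def)
  fix T assume T: "T \<subseteq> Y \<union> Z" "T \<noteq> {}"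
  show "\<exists>m\<in>T. \<forall>t\<in>T. (m, t) \<in> r"
  proof (cases "T \<inter> Y = {} \<or> T \<inter> Z = {}")
    case True
    then have "T \<subseteq> Z \<or> T \<subseteq> Y" using T by blast
    then show ?thesis using assms T unfolding well_ordered_def by blast
  next
    case False
    obtain m where m: "m \<in> T \<inter> Y" "\<And>t. t \<in> T \<inter> Y \<Longrightarrow> (m, t) \<in> r"
      using well_ordered_min[OF assms(1), of "T \<inter> Y"] False by blast
    obtain l where l: "l \<in> T \<inter> Z" "\<And>t. t \<in> T \<inter> Z \<Longrightarrow> (l, t) \<in> r"
      using well_ordered_min[OF assms(2), of "T \<inter> Z"] False by blast
    have c: "m \<in> carrier G" "l \<in> carrier G" using m l assms well_ordered_carrier by auto
    from le_total[OF c] show ?thesis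
    proof
      assume "(m, l) \<in> r"
      then have "\<forall>t\<in>T. (m, t) \<in> r" using m(2) l(2) le_trans T(1) by blast
      then show ?thesis using m(1) by blast
    next
      assume "(l, m) \<in> r"
      then have "\<forall>t\<in>T. (l, t) \<in> r" using m(2) l(2) le_trans T(1) by blast
      then show ?thesis using l(1) by blast
    qed
  qed
qed

lemma well_ordered_UN:
  assumes "finite J" "\<And>j. j \<in> J \<Longrightarrow> well_ordered (Y j)"
  shows "well_ordered (\<Union>j\<in>J. Y j)"
  using assms
proof (induction J rule: finite_induct)
  case (insert j J)
  then show ?case unfolding UN_insert by (intro well_ordered_Un) simp_all
qed (simp add: well_ordered_empty)

lemma well_ordered_singleton:
  assumes "y \<in> carrier G" shows "well_ordered {y}"
proof (rule well_orderedI)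
  show "{y} \<subseteq> carrier G" using assms by simp
  fix T assume "T \<subseteq> {y}" "T \<noteq> {}"
  then have "T = {y}" by blast
  then show "\<exists>m\<in>T. \<forall>t\<in>T. (m, t) \<in> r" using le_refl[OF assms] by simp
qed

lemma well_ordered_finite:
  assumes "finite Y" "Y \<subseteq> carrier G" shows "well_ordered Y"
proof -
  have "well_ordered (\<Union>y\<in>Y. {y})"
    using assms(2) by (intro well_ordered_UN[OF assms(1)] well_ordered_singleton) (rule subsetD)
  then show ?thesis by simp
qed

lemma well_ordered_image:
  assumes Y: "well_ordered Y" and f: "\<And>y. y \<in> Y \<Longrightarrow> f y \<in> carrier G"
    and mono: "\<And>y z. \<lbrakk>y \<in> Y; z \<in> Y; (y, z) \<in> r\<rbrakk> \<Longrightarrow> (f y, f z) \<in> r"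
  shows "well_ordered (f ` Y)"
proof (rule well_orderedI)
  show "f ` Y \<subseteq> carrier G" by (rule image_subsetI) (rule f)
  fix T assume T: "T \<subseteq> f ` Y" "T \<noteq> {}"
  let ?U = "{y \<in> Y. f y \<in> T}"
  obtain t where "t \<in> T" using T(2) by blast
  moreover from this obtain y where "y \<in> Y" "t = f y" using T(1) by (elim subsetD[THEN imageE]) auto
  ultimately have "?U \<noteq> {}" by blast
  then obtain m where m: "m \<in> ?U" "\<And>t. t \<in> ?U \<Longrightarrow> (m, t) \<in> r"
    using well_ordered_min[OF Y, of ?U] by blast
  have "(f m, t) \<in> r" if t: "t \<in> T" for t
  proof -
    obtain y where y: "y \<in> Y" "t = f y" using t T(1) by blast
    then have "(m, y) \<in> r" using m(2) t by simp
    then show ?thesis using mono m(1) y by simp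
  qed
  then show "\<exists>m\<in>T. \<forall>t\<in>T. (m, t) \<in> r" using m(1) by blast
qed

text \<open>A set that is well-ordered in both directions is finite: otherwise take the least \<open>y\<close> with infinitely many
predecessors; the greatest of the elements strictly below \<open>y\<close> has infinitely many predecessors too.\<close>

lemma finite_if_min_and_max:
  assumes F: "F \<subseteq> carrier G"
    and min: "\<And>T. T \<subseteq> F \<Longrightarrow> T \<noteq> {} \<Longrightarrow> \<exists>m\<in>T. \<forall>t\<in>T. (m, t) \<in> r"
    and max: "\<And>T. T \<subseteq> F \<Longrightarrow> T \<noteq> {} \<Longrightarrow> \<exists>m\<in>T. \<forall>t\<in>T. (t, m) \<in> r"
  shows "finite F"
proof (rule ccontr)
  assume inf: "infinite F"
  define T where "T = {y \<in> F. infinite {z \<in> F. (z, y) \<in> r}}"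
  have "T \<noteq> {}"
  proof -
    have "F \<noteq> {}" using inf by auto
    then obtain m where m: "m \<in> F" "\<forall>t\<in>F. (t, m) \<in> r" using max[of F] by blast
    then have "{z \<in> F. (z, m) \<in> r} = F" by blast
    then show ?thesis using m(1) inf by (auto simp: T_def)
  qed
  then obtain y where y: "y \<in> T" "\<forall>t\<in>T. (y, t) \<in> r" using min[of T] by (auto simp: T_def)
  let ?Z = "{z \<in> F. (z, y) \<in> r} - {y}"
  have Z: "infinite ?Z" using y(1) by (simp add: T_def)
  then have "?Z \<noteq> {}" by (metis finite.emptyI)
  then obtain m where m: "m \<in> ?Z" "\<forall>t\<in>?Z. (t, m) \<in> r" using max[of ?Z] by blast
  have "?Z \<subseteq> {z \<in> F. (z, m) \<in> r}" using m(2) by blast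
  then have "infinite {z \<in> F. (z, m) \<in> r}" using Z finite_subset by blast
  then have "m \<in> T" using m(1) by (simp add: T_def)
  then have "(y, m) \<in> r" using y(2) by blast
  then show False using m(1) le_antisym by blast
qed

text \<open>The elements \<open>y \<in> U\<close> with \<open>x \<in> y W\<close> inherit a minimum from \<open>U\<close>, and a maximum from \<open>W\<close>, because \<open>y \<mapsto> y\<inverse> x\<close>
reverses the order. So convolutions of functions with well-ordered support are finite products.\<close>

lemma finite_factorisations:
  assumes U: "well_ordered U" and W: "well_ordered W" and x: "x \<in> carrier G"
  shows "finite {y \<in> U. inv y \<otimes> x \<in> W}"
proof (rule finite_if_min_and_max)
  show "{y \<in> U. inv y \<otimes> x \<in> W} \<subseteq> carrier G" using U well_ordered_carrier by blast
  fix T assume T: "T \<subseteq> {y \<in> U. inv y \<otimes> x \<in> W}" "T \<noteq> {}"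
  have Tc: "t \<in> carrier G" if "t \<in> T" for t using that T U well_ordered_carrier by blast
  have "T \<subseteq> U" using T(1) by blast
  then show "\<exists>m\<in>T. \<forall>t\<in>T. (m, t) \<in> r" using well_ordered_min[OF U] T(2) by metis
  have "(\<lambda>y. inv y \<otimes> x) ` T \<subseteq> W" "(\<lambda>y. inv y \<otimes> x) ` T \<noteq> {}" using T by auto
  then obtain l where l: "l \<in> (\<lambda>y. inv y \<otimes> x) ` T" "\<And>t. t \<in> (\<lambda>y. inv y \<otimes> x) ` T \<Longrightarrow> (l, t) \<in> r"
    using well_ordered_min[OF W] by metis
  obtain m where m: "m \<in> T" "l = inv m \<otimes> x" using l(1) by blast
  have "(t, m) \<in> r" if t: "t \<in> T" for t
  proof -
    have "(inv m \<otimes> x, inv t \<otimes> x) \<in> r" using l(2) t m(2) by blast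
    then have "(inv m, inv t) \<in> r" using Tc[OF t] Tc[OF m(1)] x right_le_iff by simp
    then have "(t \<otimes> inv m \<otimes> m, t \<otimes> inv t \<otimes> m) \<in> r"
      using Tc[OF t] Tc[OF m(1)] by (intro right_mono left_mono) auto
    then show ?thesis using Tc[OF t] Tc[OF m(1)] by (simp add: m_assoc)
  qed
  then show "\<exists>m\<in>T. \<forall>t\<in>T. (t, m) \<in> r" using m(1) by blast
qed

text \<open>Let \<open>Q\<close> collect the left factors of those products \<open>y w \<in> T\<close> below which no element of \<open>T\<close> has a right factor
smaller than \<open>w\<close>, and choose the least \<open>y \<in> Q\<close>. If some element of \<open>T\<close> were strictly below \<open>y w\<close>, choose among all such
elements one of the form \<open>y\<^sub>1 w\<^sub>1\<close> with the least right factor; then \<open>y\<^sub>1 \<in> Q\<close>, so \<open>y \<le> y\<^sub>1\<close> and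
\<open>w \<le> w\<^sub>1\<close>, whence \<open>y w \<le> y\<^sub>1 w\<^sub>1\<close>, a contradiction.\<close>

lemma well_ordered_product:
  assumes U: "well_ordered U" and W: "well_ordered W"
  shows "well_ordered {y \<otimes> w | y w. y \<in> U \<and> w \<in> W}"
proof (rule well_orderedI)
  have Uc: "y \<in> carrier G" if "y \<in> U" for y using that U well_ordered_carrier by blast
  have Wc: "w \<in> carrier G" if "w \<in> W" for w using that W well_ordered_carrier by blast
  show "{y \<otimes> w | y w. y \<in> U \<and> w \<in> W} \<subseteq> carrier G" using Uc Wc by blast
  fix T assume T: "T \<subseteq> {y \<otimes> w | y w. y \<in> U \<and> w \<in> W}" "T \<noteq> {}"
  have lowest: "\<exists>y\<in>U. \<exists>w\<in>W. y \<otimes> w \<in> T' \<and> (\<forall>y'\<in>U. \<forall>w'\<in>W. y' \<otimes> w' \<in> T' \<longrightarrow> (w, w') \<in> r)"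
    if T': "T' \<subseteq> T" "T' \<noteq> {}" for T'
  proof -
    let ?W = "{w \<in> W. \<exists>y\<in>U. y \<otimes> w \<in> T'}"
    have "?W \<noteq> {}" using T' T(1) by blast
    then obtain w where w: "w \<in> ?W" "\<And>w'. w' \<in> ?W \<Longrightarrow> (w, w') \<in> r"
      using well_ordered_min[OF W, of ?W] by blast
    then show ?thesis by blast
  qed
  define Q where "Q = {y \<in> U. \<exists>w\<in>W. y \<otimes> w \<in> T \<and>
      (\<forall>y'\<in>U. \<forall>w'\<in>W. y' \<otimes> w' \<in> T \<and> (y' \<otimes> w', y \<otimes> w) \<in> r \<longrightarrow> (w, w') \<in> r)}"
  have "Q \<noteq> {}" using lowest[of T] T(2) unfolding Q_def by blast
  moreover have "Q \<subseteq> U" by (auto simp: Q_def)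
  ultimately obtain y where y: "y \<in> Q" "\<And>z. z \<in> Q \<Longrightarrow> (y, z) \<in> r"
    using well_ordered_min[OF U] by blast
  then obtain w where w: "y \<in> U" "w \<in> W" "y \<otimes> w \<in> T"
    "\<And>y' w'. \<lbrakk>y' \<in> U; w' \<in> W; y' \<otimes> w' \<in> T; (y' \<otimes> w', y \<otimes> w) \<in> r\<rbrakk> \<Longrightarrow> (w, w') \<in> r"
    unfolding Q_def by blast
  have "(y \<otimes> w, t) \<in> r" if t: "t \<in> T" for t
  proof (rule ccontr)
    assume no: "(y \<otimes> w, t) \<notin> r"
    have tc: "t \<in> carrier G" using t T(1) Uc Wc by blast
    let ?T = "{t \<in> T. (t, y \<otimes> w) \<in> r \<and> t \<noteq> y \<otimes> w}"
    have "t \<in> ?T" using no t tc w Uc Wc le_total le_refl by (metis (mono_tags, lifting) m_closed mem_Collect_eq)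
    then obtain y1 w1 where 1: "y1 \<in> U" "w1 \<in> W" "y1 \<otimes> w1 \<in> ?T"
      "\<And>y' w'. \<lbrakk>y' \<in> U; w' \<in> W; y' \<otimes> w' \<in> ?T\<rbrakk> \<Longrightarrow> (w1, w') \<in> r"
      using lowest[of ?T] by blast
    have "y1 \<in> Q"
      unfolding Q_def
    proof (intro CollectI conjI bexI[of _ w1] ballI impI)
      fix y' w' assume yw: "y' \<in> U" "w' \<in> W" "y' \<otimes> w' \<in> T \<and> (y' \<otimes> w', y1 \<otimes> w1) \<in> r"
      have "(y' \<otimes> w', y \<otimes> w) \<in> r" using yw(3) 1(3) le_trans by blast
      moreover have "y' \<otimes> w' \<noteq> y \<otimes> w"
        using yw(3) 1(3) le_antisym by (metis (mono_tags, lifting) mem_Collect_eq)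
      ultimately show "(w1, w') \<in> r" using 1(4) yw by blast
    qed (use 1 in auto)
    then have "(y, y1) \<in> r" using y(2) by blast
    moreover have "(w, w1) \<in> r" using w(4)[OF 1(1,2)] 1(3) by blast
    ultimately have "(y \<otimes> w, y1 \<otimes> w) \<in> r" "(y1 \<otimes> w, y1 \<otimes> w1) \<in> r"
      using Uc Wc w 1 by (auto intro: left_mono right_mono)
    then have "(y \<otimes> w, y1 \<otimes> w1) \<in> r" by (rule le_trans)
    then show False using 1(3) le_antisym by blast
  qed
  then show "\<exists>m\<in>T. \<forall>t\<in>T. (m, t) \<in> r" using w(3) by blast
qed

end

locale ordered_automaton = automaton A G S k + bi_ordered_group G r
  for A :: "('a, 'y) monoid_scheme" and G :: "('g, 'x) monoid_scheme" and S k r +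
  assumes finite_A: "finite (carrier A)"
begin

definition series :: "('g \<Rightarrow> 'a) set"
  where "series = {u \<in> carrier G \<rightarrow>\<^sub>E carrier A. well_ordered (supp u)}"

text \<open>The infinite combination \<open>\<Sum>\<^sub>y y \<cdot> l (b y)\<close> of translates, where \<open>b y\<close> says which series of the family \<open>l\<close> is
placed at \<open>y\<close>. The index set is restricted to the nontrivial factors, since \<open>finprod\<close> is trivial on infinite
sets.\<close>

definition comb :: "('a \<Rightarrow> 'g \<Rightarrow> 'a) \<Rightarrow> ('g \<Rightarrow> 'a) \<Rightarrow> 'g \<Rightarrow> 'a"
  where "comb l b = (\<lambda>x\<in>carrier G. \<Otimes>\<^bsub>A\<^esub>y\<in>{y \<in> carrier G. l (b y) (inv\<^bsub>G\<^esub> y \<otimes>\<^bsub>G\<^esub> x) \<noteq> \<one>\<^bsub>A\<^esub>}.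
      l (b y) (inv\<^bsub>G\<^esub> y \<otimes>\<^bsub>G\<^esub> x))"

text \<open>Under these conditions \<open>comb l b\<close> is again a series if \<open>b\<close> is: nothing is placed outside the support of \<open>b\<close>, and
the supports of the finitely many members of the family have a well-ordered union.\<close>

definition family :: "('a \<Rightarrow> 'g \<Rightarrow> 'a) \<Rightarrow> bool"
  where "family l \<longleftrightarrow> (\<forall>a\<in>carrier A. l a \<in> series) \<and> l \<one>\<^bsub>A\<^esub> = zero"

lemma series_value: "u \<in> series \<Longrightarrow> x \<in> carrier G \<Longrightarrow> u x \<in> carrier A"
  by (auto simp: series_def)

lemma series_ext:
  assumes "u \<in> series" "v \<in> series" "\<And>x. x \<in> carrier G \<Longrightarrow> u x = v x" shows "u = v"
  using assms by (auto simp: series_def intro: PiE_ext)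

lemma seriesI:
  assumes "u \<in> carrier G \<rightarrow>\<^sub>E carrier A" "supp u \<subseteq> Y" "well_ordered Y"
  shows "u \<in> series"
  using assms well_ordered_subset by (auto simp: series_def)

lemma series_supp: "u \<in> series \<Longrightarrow> well_ordered (supp u)" by (simp add: series_def)

lemma series_Pi: "u \<in> series \<Longrightarrow> u \<in> carrier G \<rightarrow> carrier A" by (auto simp: series_def)

lemma base_subset_series: "u \<in> carrier base \<Longrightarrow> u \<in> series"
  by (auto simp: series_def base_carrier intro!: well_ordered_finite)

lemma zero_series: "zero \<in> series" using zero_base base_subset_series by blast

lemma shift_series:
  assumes g: "g \<in> carrier G" and u: "u \<in> series"
  shows "shift G g u \<in> series"
proof (rule seriesI)
  show "shift G g u \<in> carrier G \<rightarrow>\<^sub>E carrier A" using g series_Pi[OF u] by (auto simp: shift_def)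
  show "well_ordered ((\<lambda>x. g \<otimes>\<^bsub>G\<^esub> x) ` supp u)"
    using g left_mono by (intro well_ordered_image[OF series_supp[OF u]]) auto
  show "supp (shift G g u) \<subseteq> (\<lambda>x. g \<otimes>\<^bsub>G\<^esub> x) ` supp u"
  proof
    fix x assume x: "x \<in> supp (shift G g u)"
    then have "x = g \<otimes>\<^bsub>G\<^esub> (inv\<^bsub>G\<^esub> g \<otimes>\<^bsub>G\<^esub> x)" using g by (simp flip: G.m_assoc)
    moreover have "inv\<^bsub>G\<^esub> g \<otimes>\<^bsub>G\<^esub> x \<in> supp u" using x g by (auto simp: shift_def)
    ultimately show "x \<in> (\<lambda>x. g \<otimes>\<^bsub>G\<^esub> x) ` supp u" by blast
  qed
qed

lemma ca_series:
  assumes u: "u \<in> series" shows "ca u \<in> series"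
proof (rule seriesI)
  show "ca u \<in> carrier G \<rightarrow>\<^sub>E carrier A" by (rule ca_PiE[OF series_Pi[OF u]])
  show "supp (ca u) \<subseteq> (\<Union>t\<in>S. (\<lambda>y. y \<otimes>\<^bsub>G\<^esub> t) ` supp u)" by (rule ca_support[OF series_Pi[OF u]])
  show "well_ordered (\<Union>t\<in>S. (\<lambda>y. y \<otimes>\<^bsub>G\<^esub> t) ` supp u)"
    using finite_S right_mono S_carrier
    by (intro well_ordered_UN well_ordered_image[OF series_supp[OF u]]) auto
qed

lemma pow_ca_series: "u \<in> series \<Longrightarrow> (ca ^^ n) u \<in> series"
  by (induction n) (auto simp: ca_series)

definition pdiv :: "('g \<Rightarrow> 'a) \<Rightarrow> ('g \<Rightarrow> 'a) \<Rightarrow> 'g \<Rightarrow> 'a"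
  where "pdiv u v = (\<lambda>x\<in>carrier G. u x \<otimes>\<^bsub>A\<^esub> inv\<^bsub>A\<^esub> (v x))"

lemma pdiv_series:
  assumes u: "u \<in> series" and v: "v \<in> series" shows "pdiv u v \<in> series"
proof (rule seriesI)
  show "pdiv u v \<in> carrier G \<rightarrow>\<^sub>E carrier A" using series_value[OF u] series_value[OF v] by (auto simp: pdiv_def)
  show "supp (pdiv u v) \<subseteq> supp u \<union> supp v" by (auto simp: pdiv_def)
  show "well_ordered (supp u \<union> supp v)" by (intro well_ordered_Un series_supp u v)
qed

lemma ca_pdiv:
  assumes u: "u \<in> series" and v: "v \<in> series"
  shows "ca (pdiv u v) = pdiv (ca u) (ca v)"
proof (rule series_ext)
  fix x assume x: "x \<in> carrier G"
  have d: "pdiv u v \<in> series" using u v by (rule pdiv_series)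
  have "(\<lambda>x\<in>carrier G. pdiv u v x \<otimes>\<^bsub>A\<^esub> v x) = u"
  proof
    fix x show "(\<lambda>x\<in>carrier G. pdiv u v x \<otimes>\<^bsub>A\<^esub> v x) x = u x"
      using series_value[OF u] series_value[OF v] u
      by (cases "x \<in> carrier G") (auto simp: pdiv_def A.m_assoc series_def PiE_def extensional_def)
  qed
  then have "ca u x = ca (pdiv u v) x \<otimes>\<^bsub>A\<^esub> ca v x"
    using fun_cong[OF ca_mult[OF series_Pi[OF d] series_Pi[OF v]], of x] x by simp
  then show "ca (pdiv u v) x = pdiv (ca u) (ca v) x"
    using x series_value[OF ca_series[OF d] x] series_value[OF ca_series[OF v] x]
    by (simp add: pdiv_def A.m_assoc)
qed (use u v in \<open>auto simp: pdiv_series ca_series\<close>)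

lemma pow_ca_pdiv:
  assumes "u \<in> series" "v \<in> series"
  shows "(ca ^^ n) (pdiv u v) = pdiv ((ca ^^ n) u) ((ca ^^ n) v)"
  using assms by (induction n) (auto simp: ca_pdiv pow_ca_series)

lemma pow_ca_shift:
  assumes "g \<in> carrier G" "u \<in> series"
  shows "(ca ^^ n) (shift G g u) = shift G g ((ca ^^ n) u)"
  using assms by (induction n) (auto simp: ca_shift series_Pi pow_ca_series)

lemma family_value: "family l \<Longrightarrow> a \<in> carrier A \<Longrightarrow> x \<in> carrier G \<Longrightarrow> l a x \<in> carrier A"
  by (auto simp: family_def intro: series_value)

lemma family_supports: "family l \<Longrightarrow> well_ordered (\<Union>a\<in>carrier A. supp (l a))"
  by (intro well_ordered_UN finite_A series_supp) (simp add: family_def)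

lemma comb_index:
  assumes l: "family l" and b: "b \<in> series" and x: "x \<in> carrier G"
  shows "finite {y \<in> carrier G. l (b y) (inv\<^bsub>G\<^esub> y \<otimes>\<^bsub>G\<^esub> x) \<noteq> \<one>\<^bsub>A\<^esub>}"
proof (rule finite_subset[OF _ finite_factorisations[OF series_supp[OF b] family_supports[OF l] x]])
  show "{y \<in> carrier G. l (b y) (inv\<^bsub>G\<^esub> y \<otimes>\<^bsub>G\<^esub> x) \<noteq> \<one>\<^bsub>A\<^esub>}
      \<subseteq> {y \<in> supp b. inv\<^bsub>G\<^esub> y \<otimes>\<^bsub>G\<^esub> x \<in> (\<Union>a\<in>carrier A. supp (l a))}"
  proof
    fix y assume y: "y \<in> {y \<in> carrier G. l (b y) (inv\<^bsub>G\<^esub> y \<otimes>\<^bsub>G\<^esub> x) \<noteq> \<one>\<^bsub>A\<^esub>}"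
    have "b y \<noteq> \<one>\<^bsub>A\<^esub>" using y l x by (auto simp: family_def)
    then show "y \<in> {y \<in> supp b. inv\<^bsub>G\<^esub> y \<otimes>\<^bsub>G\<^esub> x \<in> (\<Union>a\<in>carrier A. supp (l a))}"
      using y x series_value[OF b] by auto
  qed
qed

lemma comb_term:
  assumes "family l" "b \<in> series" "y \<in> carrier G" "x \<in> carrier G"
  shows "l (b y) (inv\<^bsub>G\<^esub> y \<otimes>\<^bsub>G\<^esub> x) \<in> carrier A"
  by (rule family_value[OF assms(1) series_value[OF assms(2,3)]]) (use assms in simp)

lemma comb_superset:
  assumes l: "family l" and b: "b \<in> series" and x: "x \<in> carrier G"
    and E: "finite E" "E \<subseteq> carrier G" "{y \<in> carrier G. l (b y) (inv\<^bsub>G\<^esub> y \<otimes>\<^bsub>G\<^esub> x) \<noteq> \<one>\<^bsub>A\<^esub>} \<subseteq> E"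
  shows "comb l b x = (\<Otimes>\<^bsub>A\<^esub>y\<in>E. l (b y) (inv\<^bsub>G\<^esub> y \<otimes>\<^bsub>G\<^esub> x))"
  unfolding comb_def restrict_apply'[OF x]
proof (rule A.finprod_mono_neutral_cong_left[OF E(1,3)])
  show "(\<lambda>y. l (b y) (inv\<^bsub>G\<^esub> y \<otimes>\<^bsub>G\<^esub> x)) \<in> E \<rightarrow> carrier A"
    using comb_term[OF l b _ x] E(2) by (intro funcsetI) (simp add: subset_iff)
  fix y assume "y \<in> E - {y \<in> carrier G. l (b y) (inv\<^bsub>G\<^esub> y \<otimes>\<^bsub>G\<^esub> x) \<noteq> \<one>\<^bsub>A\<^esub>}"
  then show "l (b y) (inv\<^bsub>G\<^esub> y \<otimes>\<^bsub>G\<^esub> x) = \<one>\<^bsub>A\<^esub>" using E(2) by blast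
qed simp

lemma comb_series:
  assumes l: "family l" and b: "b \<in> series"
  shows "comb l b \<in> series"
proof (rule seriesI)
  let ?P = "{y \<otimes>\<^bsub>G\<^esub> w | y w. y \<in> supp b \<and> w \<in> (\<Union>a\<in>carrier A. supp (l a))}"
  show "comb l b \<in> carrier G \<rightarrow>\<^sub>E carrier A"
    using comb_term[OF l b] by (auto simp: comb_def intro!: A.finprod_closed)
  show "well_ordered ?P" by (intro well_ordered_product series_supp[OF b] family_supports[OF l])
  show "supp (comb l b) \<subseteq> ?P"
  proof
    fix x assume x: "x \<in> supp (comb l b)"
    have "\<exists>y\<in>carrier G. l (b y) (inv\<^bsub>G\<^esub> y \<otimes>\<^bsub>G\<^esub> x) \<noteq> \<one>\<^bsub>A\<^esub>"
    proof (rule ccontr)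
      assume "\<not> ?thesis"
      then have "comb l b x = \<one>\<^bsub>A\<^esub>" using x by (auto simp: comb_def intro!: A.finprod_one_eqI)
      then show False using x by simp
    qed
    then obtain y where y: "y \<in> carrier G" "l (b y) (inv\<^bsub>G\<^esub> y \<otimes>\<^bsub>G\<^esub> x) \<noteq> \<one>\<^bsub>A\<^esub>" by blast
    have "b y \<noteq> \<one>\<^bsub>A\<^esub>" using y l x by (auto simp: family_def)
    then have "y \<in> supp b" "inv\<^bsub>G\<^esub> y \<otimes>\<^bsub>G\<^esub> x \<in> (\<Union>a\<in>carrier A. supp (l a))"
      using y x series_value[OF b] by auto
    moreover have "x = y \<otimes>\<^bsub>G\<^esub> (inv\<^bsub>G\<^esub> y \<otimes>\<^bsub>G\<^esub> x)" using x y by (simp flip: G.m_assoc)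
    ultimately show "x \<in> ?P" by blast
  qed
qed

lemma family_ca: "family l \<Longrightarrow> family (\<lambda>a. ca (l a))"
  by (simp add: family_def ca_series ca_zero)

text \<open>Automata commute with translations and, by finiteness of all products involved, with infinite combinations of
translates.\<close>

lemma ca_comb:
  assumes l: "family l" and b: "b \<in> series"
  shows "ca (comb l b) = comb (\<lambda>a. ca (l a)) b"
proof (rule series_ext)
  fix x assume x: "x \<in> carrier G"
  let ?I = "\<lambda>x. {y \<in> carrier G. l (b y) (inv\<^bsub>G\<^esub> y \<otimes>\<^bsub>G\<^esub> x) \<noteq> \<one>\<^bsub>A\<^esub>}"
  define E where "E = (\<Union>t\<in>S. ?I (x \<otimes>\<^bsub>G\<^esub> inv\<^bsub>G\<^esub> t)) \<union>
    {y \<in> carrier G. ca (l (b y)) (inv\<^bsub>G\<^esub> y \<otimes>\<^bsub>G\<^esub> x) \<noteq> \<one>\<^bsub>A\<^esub>}"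
  have xt: "x \<otimes>\<^bsub>G\<^esub> inv\<^bsub>G\<^esub> t \<in> carrier G" if "t \<in> S" for t using that x by (simp add: S_carrier)
  have E: "finite E" "E \<subseteq> carrier G"
    using finite_S comb_index[OF l b xt] comb_index[OF family_ca[OF l] b x] by (auto simp: E_def)
  have c: "l (b y) (inv\<^bsub>G\<^esub> y \<otimes>\<^bsub>G\<^esub> (x \<otimes>\<^bsub>G\<^esub> inv\<^bsub>G\<^esub> t)) \<in> carrier A" if "t \<in> S" "y \<in> carrier G" for t y
    using that xt family_value[OF l] series_value[OF b] by simp
  have kt: "k t (comb l b (x \<otimes>\<^bsub>G\<^esub> inv\<^bsub>G\<^esub> t)) = (\<Otimes>\<^bsub>A\<^esub>y\<in>E. k t (l (b y) (inv\<^bsub>G\<^esub> y \<otimes>\<^bsub>G\<^esub> (x \<otimes>\<^bsub>G\<^esub> inv\<^bsub>G\<^esub> t))))"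
    if t: "t \<in> S" for t
  proof -
    have "comb l b (x \<otimes>\<^bsub>G\<^esub> inv\<^bsub>G\<^esub> t) = (\<Otimes>\<^bsub>A\<^esub>y\<in>E. l (b y) (inv\<^bsub>G\<^esub> y \<otimes>\<^bsub>G\<^esub> (x \<otimes>\<^bsub>G\<^esub> inv\<^bsub>G\<^esub> t)))"
      using t E by (intro comb_superset[OF l b xt]) (auto simp: E_def)
    then show ?thesis
      using c[OF t] E by (simp add: subset_iff
        hom_finprod[OF k_hom[OF t] A.comm_group_axioms A.comm_group_axioms] Pi_def)
  qed
  have "ca (comb l b) x = (\<Otimes>\<^bsub>A\<^esub>t\<in>S. \<Otimes>\<^bsub>A\<^esub>y\<in>E. k t (l (b y) (inv\<^bsub>G\<^esub> y \<otimes>\<^bsub>G\<^esub> (x \<otimes>\<^bsub>G\<^esub> inv\<^bsub>G\<^esub> t))))"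
    unfolding ca_apply[OF x] using c E kt
    by (intro A.finprod_cong') (auto simp: subset_iff intro!: A.finprod_closed k_closed)
  also have "\<dots> = (\<Otimes>\<^bsub>A\<^esub>y\<in>E. \<Otimes>\<^bsub>A\<^esub>t\<in>S. k t (l (b y) (inv\<^bsub>G\<^esub> y \<otimes>\<^bsub>G\<^esub> (x \<otimes>\<^bsub>G\<^esub> inv\<^bsub>G\<^esub> t))))"
    using E finite_S c by (intro A.finprod_swap) (auto simp: subset_iff intro!: k_closed)
  also have "\<dots> = (\<Otimes>\<^bsub>A\<^esub>y\<in>E. ca (l (b y)) (inv\<^bsub>G\<^esub> y \<otimes>\<^bsub>G\<^esub> x))"
  proof (rule A.finprod_cong'[OF refl])
    show "(\<lambda>y. ca (l (b y)) (inv\<^bsub>G\<^esub> y \<otimes>\<^bsub>G\<^esub> x)) \<in> E \<rightarrow> carrier A"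
      using E x family_value[OF family_ca[OF l]] series_value[OF b] by (auto simp: subset_iff)
    fix y assume "y \<in> E"
    then have y: "y \<in> carrier G" using E by blast
    show "(\<Otimes>\<^bsub>A\<^esub>t\<in>S. k t (l (b y) (inv\<^bsub>G\<^esub> y \<otimes>\<^bsub>G\<^esub> (x \<otimes>\<^bsub>G\<^esub> inv\<^bsub>G\<^esub> t)))) = ca (l (b y)) (inv\<^bsub>G\<^esub> y \<otimes>\<^bsub>G\<^esub> x)"
      using x y c by (subst ca_apply) (auto simp: S_carrier G.m_assoc intro!: A.finprod_cong' k_closed)
  qed
  also have "\<dots> = comb (\<lambda>a. ca (l a)) b x"
    using E by (intro comb_superset[OF family_ca[OF l] b x, symmetric]) (auto simp: E_def)
  finally show "ca (comb l b) x = comb (\<lambda>a. ca (l a)) b x" .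
qed (use l b in \<open>auto simp: ca_series comb_series family_ca\<close>)

lemma pow_ca_comb:
  assumes "family l" "b \<in> series"
  shows "(ca ^^ n) (comb l b) = comb (\<lambda>a. (ca ^^ n) (l a)) b \<and> family (\<lambda>a. (ca ^^ n) (l a))"
proof (induction n)
  case (Suc n)
  then show ?case using ca_comb[of "\<lambda>a. (ca ^^ n) (l a)" b] family_ca[of "\<lambda>a. (ca ^^ n) (l a)"] assms by simp
qed (use assms in simp)

end

section \<open>Bi-ordered groups: leading coefficients\<close>

context ordered_automaton
begin

definition vanishes_below_one :: "('g \<Rightarrow> 'a) \<Rightarrow> bool"
  where "vanishes_below_one v \<longleftrightarrow> (\<forall>x\<in>carrier G. (x, \<one>\<^bsub>G\<^esub>) \<in> r \<and> x \<noteq> \<one>\<^bsub>G\<^esub> \<longrightarrow> v x = \<one>\<^bsub>A\<^esub>)"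

definition kern :: "nat \<Rightarrow> ('g \<Rightarrow> 'a) set"
  where "kern n = {v \<in> series. (ca ^^ n) v = zero}"

text \<open>For a translation-invariant \<open>L\<close>, the coefficients at the least point of the support of members of \<open>L\<close>, and
\<open>\<one>\<close>: every member can be translated so that its support starts at the identity.\<close>

definition lead :: "('g \<Rightarrow> 'a) set \<Rightarrow> 'a set"
  where "lead L = {a \<in> carrier A. \<exists>v\<in>L. vanishes_below_one v \<and> v \<one>\<^bsub>G\<^esub> = a}"

lemma update_series:
  assumes b: "b \<in> series" and x: "x \<in> carrier G" and a: "a \<in> carrier A"
  shows "b(x := a) \<in> series"
proof (rule seriesI)
  show "b(x := a) \<in> carrier G \<rightarrow>\<^sub>E carrier A"
    using b x a by (auto simp: series_def PiE_def extensional_def)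
  show "supp (b(x := a)) \<subseteq> supp b \<union> {x}" by auto
  show "well_ordered (supp b \<union> {x})" by (intro well_ordered_Un series_supp b well_ordered_singleton x)
qed

text \<open>Translates of series that start at the identity are triangular: the value at \<open>x\<close> only depends on what is placed
at points up to \<open>x\<close>.\<close>

lemma comb_cong_below:
  assumes l: "family l" and pos: "\<And>a. vanishes_below_one (l a)"
    and b: "b \<in> series" "b' \<in> series" and x: "x \<in> carrier G"
    and eq: "\<And>y. \<lbrakk>y \<in> carrier G; (y, x) \<in> r\<rbrakk> \<Longrightarrow> b y = b' y"
  shows "comb l b x = comb l b' x"
proof -
  let ?I = "\<lambda>b. {y \<in> carrier G. l (b y) (inv\<^bsub>G\<^esub> y \<otimes>\<^bsub>G\<^esub> x) \<noteq> \<one>\<^bsub>A\<^esub>}"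
  let ?E = "?I b \<union> ?I b'"
  have E: "finite ?E" "?E \<subseteq> carrier G" using comb_index[OF l b(1) x] comb_index[OF l b(2) x] by auto
  have "comb l b x = (\<Otimes>\<^bsub>A\<^esub>y\<in>?E. l (b y) (inv\<^bsub>G\<^esub> y \<otimes>\<^bsub>G\<^esub> x))"
    by (rule comb_superset[OF l b(1) x E]) simp
  also have "\<dots> = (\<Otimes>\<^bsub>A\<^esub>y\<in>?E. l (b' y) (inv\<^bsub>G\<^esub> y \<otimes>\<^bsub>G\<^esub> x))"
  proof (rule A.finprod_cong'[OF refl])
    show "(\<lambda>y. l (b' y) (inv\<^bsub>G\<^esub> y \<otimes>\<^bsub>G\<^esub> x)) \<in> ?E \<rightarrow> carrier A"
      using comb_term[OF l b(2) _ x] by (intro funcsetI) auto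
    fix y assume "y \<in> ?E"
    then have y: "y \<in> carrier G" by blast
    show "l (b y) (inv\<^bsub>G\<^esub> y \<otimes>\<^bsub>G\<^esub> x) = l (b' y) (inv\<^bsub>G\<^esub> y \<otimes>\<^bsub>G\<^esub> x)"
    proof (cases "(y, x) \<in> r")
      case False
      have yx: "y \<otimes>\<^bsub>G\<^esub> (inv\<^bsub>G\<^esub> y \<otimes>\<^bsub>G\<^esub> x) = x" using x y by (simp flip: G.m_assoc)
      have "(x, y) \<in> r" using False le_total[OF x y] by blast
      then have "(inv\<^bsub>G\<^esub> y \<otimes>\<^bsub>G\<^esub> x, \<one>\<^bsub>G\<^esub>) \<in> r"
        using left_le_iff[of "inv\<^bsub>G\<^esub> y \<otimes>\<^bsub>G\<^esub> x" "\<one>\<^bsub>G\<^esub>" y] x y yx by simp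
      moreover have "inv\<^bsub>G\<^esub> y \<otimes>\<^bsub>G\<^esub> x \<noteq> \<one>\<^bsub>G\<^esub>"
      proof
        assume "inv\<^bsub>G\<^esub> y \<otimes>\<^bsub>G\<^esub> x = \<one>\<^bsub>G\<^esub>"
        then have "x = y" using yx y by simp
        then show False using False le_refl[OF x] by simp
      qed
      ultimately have "l a (inv\<^bsub>G\<^esub> y \<otimes>\<^bsub>G\<^esub> x) = \<one>\<^bsub>A\<^esub>" for a
        using pos[of a] x y unfolding vanishes_below_one_def by simp
      then show ?thesis by simp
    qed (simp add: eq[OF y])
  qed
  also have "\<dots> = comb l b' x"
    by (rule comb_superset[OF l b(2) x E, symmetric]) simp
  finally show ?thesis .
qed

text \<open>The diagonal entries of this triangular system are the coefficients at the identity, so what is placed at \<open>x\<close> can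
be chosen freely to correct the value at \<open>x\<close>.\<close>

lemma comb_update:
  assumes l: "family l" and b: "b \<in> series" and x: "x \<in> carrier G" and bx: "b x = \<one>\<^bsub>A\<^esub>"
    and a: "a \<in> carrier A" "l a \<one>\<^bsub>G\<^esub> = a"
  shows "comb l (b(x := a)) x = comb l b x \<otimes>\<^bsub>A\<^esub> a"
proof -
  let ?c = "b(x := a)"
  have c: "?c \<in> series" by (rule update_series[OF b x a(1)])
  let ?I = "\<lambda>b. {y \<in> carrier G. l (b y) (inv\<^bsub>G\<^esub> y \<otimes>\<^bsub>G\<^esub> x) \<noteq> \<one>\<^bsub>A\<^esub>}"
  define E where "E = ?I b \<union> ?I ?c - {x}"
  have E: "finite E" "E \<subseteq> carrier G" "x \<notin> E"
    using comb_index[OF l b x] comb_index[OF l c x] by (auto simp: E_def)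
  have E': "finite (insert x E)" "insert x E \<subseteq> carrier G" using E x by auto
  have expand: "comb l d x = l (d x) \<one>\<^bsub>G\<^esub> \<otimes>\<^bsub>A\<^esub> (\<Otimes>\<^bsub>A\<^esub>y\<in>E. l (b y) (inv\<^bsub>G\<^esub> y \<otimes>\<^bsub>G\<^esub> x))"
    if d: "d \<in> series" "?I d \<subseteq> insert x E" "\<And>y. y \<noteq> x \<Longrightarrow> d y = b y" for d
  proof -
    have t: "l (d y) (inv\<^bsub>G\<^esub> y \<otimes>\<^bsub>G\<^esub> x) \<in> carrier A" if "y \<in> insert x E" for y
      using comb_term[OF l d(1) _ x] that E' by blast
    have "comb l d x = (\<Otimes>\<^bsub>A\<^esub>y\<in>insert x E. l (d y) (inv\<^bsub>G\<^esub> y \<otimes>\<^bsub>G\<^esub> x))"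
      by (rule comb_superset[OF l d(1) x E' d(2)])
    also have "\<dots> = l (d x) (inv\<^bsub>G\<^esub> x \<otimes>\<^bsub>G\<^esub> x) \<otimes>\<^bsub>A\<^esub> (\<Otimes>\<^bsub>A\<^esub>y\<in>E. l (d y) (inv\<^bsub>G\<^esub> y \<otimes>\<^bsub>G\<^esub> x))"
      using t E by (intro A.finprod_insert) auto
    also have "(\<Otimes>\<^bsub>A\<^esub>y\<in>E. l (d y) (inv\<^bsub>G\<^esub> y \<otimes>\<^bsub>G\<^esub> x)) = (\<Otimes>\<^bsub>A\<^esub>y\<in>E. l (b y) (inv\<^bsub>G\<^esub> y \<otimes>\<^bsub>G\<^esub> x))"
    proof (rule A.finprod_cong'[OF refl])
      show "(\<lambda>y. l (b y) (inv\<^bsub>G\<^esub> y \<otimes>\<^bsub>G\<^esub> x)) \<in> E \<rightarrow> carrier A"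
        using comb_term[OF l b _ x] E(2) by (intro funcsetI) auto
      fix y assume "y \<in> E"
      then have "y \<noteq> x" using E(3) by blast
      then show "l (d y) (inv\<^bsub>G\<^esub> y \<otimes>\<^bsub>G\<^esub> x) = l (b y) (inv\<^bsub>G\<^esub> y \<otimes>\<^bsub>G\<^esub> x)" using d(3) by simp
    qed
    finally show ?thesis using x by simp
  qed
  let ?R = "\<Otimes>\<^bsub>A\<^esub>y\<in>E. l (b y) (inv\<^bsub>G\<^esub> y \<otimes>\<^bsub>G\<^esub> x)"
  have R: "?R \<in> carrier A" using comb_term[OF l b _ x] E(2) by (intro A.finprod_closed funcsetI) auto
  have "l \<one>\<^bsub>A\<^esub> \<one>\<^bsub>G\<^esub> = \<one>\<^bsub>A\<^esub>" using l by (simp add: family_def)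
  moreover have I: "?I b \<subseteq> insert x E" "?I ?c \<subseteq> insert x E" unfolding E_def by blast+
  ultimately have "comb l b x = ?R" using expand[OF b I(1)] bx R by simp
  moreover have "comb l ?c x = a \<otimes>\<^bsub>A\<^esub> ?R" using expand[OF c I(2)] a by (simp add: fun_upd_def)
  ultimately show ?thesis using R a by (simp add: A.m_comm)
qed

lemma kern_series: "v \<in> kern n \<Longrightarrow> v \<in> series" by (simp add: kern_def)

lemma pow_ca_zero: "(ca ^^ n) zero = zero"
  by (induction n) (simp_all add: ca_zero del: restrict_apply)

lemma zero_kern: "zero \<in> kern n"
  unfolding kern_def using zero_series pow_ca_zero by blast

lemma kern_mono: "kern n \<subseteq> kern (Suc n)"
  unfolding kern_def using ca_zero by auto

lemma pdiv_kern:
  assumes "u \<in> kern n" "v \<in> kern n" shows "pdiv u v \<in> kern n"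
proof -
  have "pdiv zero zero = zero" by (auto simp: pdiv_def)
  then show ?thesis using assms pow_ca_pdiv pdiv_series unfolding kern_def by simp
qed

lemma shift_kern:
  assumes "g \<in> carrier G" "u \<in> kern n" shows "shift G g u \<in> kern n"
proof -
  have "shift G g zero = zero" using assms(1) by (auto simp: shift_def)
  then show ?thesis using assms pow_ca_shift shift_series unfolding kern_def by simp
qed

text \<open>Choose for each leading coefficient \<open>a\<close> of \<open>kern n\<close> a member of \<open>kern n\<close> that starts with \<open>a\<close> at the identity. A
given \<open>u \<in> kern (Suc n)\<close> is to be written as a combination of translates of these, which puts it into \<open>kern n\<close>.
Proceed by recursion along the order: having reached \<open>u\<close> at all points below \<open>g\<close>, the error at \<open>g\<close> is a leading
coefficient of \<open>kern (Suc n)\<close>, hence by assumption of \<open>kern n\<close>, and placing the corresponding series at \<open>g\<close>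
removes the error.

The recursion is phrased without ordinals: partial solutions up to a point are unique, so they fit together
to a solution \<open>c\<close> on the set \<open>D\<close> of all points that can be reached, and the least point of the support of the error
would belong to \<open>D\<close>.\<close>

lemma kern_Suc_subset_if_lead_subset:
  assumes lead: "lead (kern (Suc n)) \<subseteq> lead (kern n)"
  shows "kern (Suc n) \<subseteq> kern n"
proof
  fix u assume u: "u \<in> kern (Suc n)"
  define L where "L = lead (kern n)"
  have us: "u \<in> series" using u by (rule kern_series)
  have L1: "\<one>\<^bsub>A\<^esub> \<in> L"
    unfolding L_def lead_def using zero_kern[of n] by (auto simp: vanishes_below_one_def intro!: bexI[of _ zero])
  have LA: "a \<in> carrier A" if "a \<in> L" for a using that by (simp add: L_def lead_def)
  have "\<forall>a\<in>L. \<exists>v\<in>kern n. vanishes_below_one v \<and> v \<one>\<^bsub>G\<^esub> = a" by (simp add: L_def lead_def)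
  then obtain p where p: "\<And>a. a \<in> L \<Longrightarrow> p a \<in> kern n" "\<And>a. a \<in> L \<Longrightarrow> vanishes_below_one (p a)"
    "\<And>a. a \<in> L \<Longrightarrow> p a \<one>\<^bsub>G\<^esub> = a" by metis
  define l where "l = (\<lambda>a. if a \<in> L \<and> a \<noteq> \<one>\<^bsub>A\<^esub> then p a else zero)"
  have l_kern: "l a \<in> kern n" for a using p(1) zero_kern by (simp add: l_def)
  have fam: "family l" unfolding family_def using kern_series[OF l_kern] by (simp add: l_def)
  have pos: "vanishes_below_one (l a)" for a using p(2) by (simp add: l_def vanishes_below_one_def)
  have l_one: "l a \<one>\<^bsub>G\<^esub> = a" if "a \<in> L" for a using that p(3) by (simp add: l_def)
  \<comment> \<open>The power of the automaton kills every member of the family.\<close>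
  have comb_kern: "comb l b \<in> kern n" if b: "b \<in> series" for b
  proof -
    have "(\<lambda>a. (ca ^^ n) (l a)) = (\<lambda>a. zero)" using l_kern by (simp add: kern_def)
    then have "(ca ^^ n) (comb l b) = comb (\<lambda>a. zero) b" using pow_ca_comb[OF fam b, of n] by simp
    also have "comb (\<lambda>a. zero) b = zero"
    proof
      fix x
      have f0: "family (\<lambda>a. zero)" unfolding family_def using zero_series by blast
      show "comb (\<lambda>a. zero) b x = zero x"
      proof (cases "x \<in> carrier G")
        case True
        then show ?thesis using comb_superset[OF f0 b True, of "{}"] by simp
      qed (simp add: comb_def)
    qed
    finally show ?thesis using comb_series[OF fam b] by (simp add: kern_def)
  qed
  \<comment> \<open>Only elements of \<open>L\<close> may be placed, since only there \<open>l a\<close> starts with \<open>a\<close>.\<close>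
  define Sr where "Sr = {b \<in> series. \<forall>x\<in>carrier G. b x \<in> L}"
  have Sr_update: "b(x := a) \<in> Sr" if "b \<in> Sr" "x \<in> carrier G" "a \<in> L" for b x a
    using that update_series LA by (simp add: Sr_def)
  have uniq: "b y = b' y"
    if b: "b \<in> Sr" "b' \<in> Sr" and x: "x \<in> carrier G"
      and eq: "\<And>y. \<lbrakk>y \<in> carrier G; (y, x) \<in> r\<rbrakk> \<Longrightarrow> comb l b y = comb l b' y"
      and y: "y \<in> carrier G" "(y, x) \<in> r" for b b' x y
  proof (rule ccontr)
    assume ne: "b y \<noteq> b' y"
    let ?T = "{y \<in> carrier G. (y, x) \<in> r \<and> b y \<noteq> b' y}"
    have bs: "b \<in> series" "b' \<in> series" using b by (simp_all add: Sr_def)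
    have T_sub: "?T \<subseteq> supp b \<union> supp b'" by auto
    have T_ne: "?T \<noteq> {}" using ne y by blast
    from well_ordered_ex_min[OF well_ordered_Un[OF series_supp[OF bs(1)] series_supp[OF bs(2)]] T_sub T_ne]
    obtain m where m: "m \<in> ?T" "\<And>t. t \<in> ?T \<Longrightarrow> (m, t) \<in> r" by (elim exE conjE) blast
    have mc: "m \<in> carrier G" "(m, x) \<in> r" "b m \<noteq> b' m" using m(1) by auto
    let ?b0 = "b(m := \<one>\<^bsub>A\<^esub>)" and ?b0' = "b'(m := \<one>\<^bsub>A\<^esub>)"
    have b0: "?b0 \<in> series" "?b0' \<in> series" using bs mc by (simp_all add: update_series)
    have bm: "b m \<in> L" "b' m \<in> L" using b mc by (simp_all add: Sr_def)
    have "comb l ?b0 m = comb l ?b0' m"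
    proof (rule comb_cong_below[OF fam pos b0 mc(1)])
      fix z assume z: "z \<in> carrier G" "(z, m) \<in> r"
      show "?b0 z = ?b0' z"
      proof (cases "z = m")
        case False
        have "b z = b' z"
        proof (rule ccontr)
          assume "b z \<noteq> b' z"
          then have "z \<in> ?T" using z le_trans[OF z(2) mc(2)] by blast
          then show False using m(2) z(2) le_antisym False by blast
        qed
        then show ?thesis using False by simp
      qed simp
    qed
    moreover have "comb l b m = comb l ?b0 m \<otimes>\<^bsub>A\<^esub> b m"
      using comb_update[OF fam b0(1) mc(1) _ LA[OF bm(1)] l_one[OF bm(1)]] by simp
    moreover have "comb l b' m = comb l ?b0' m \<otimes>\<^bsub>A\<^esub> b' m"
      using comb_update[OF fam b0(2) mc(1) _ LA[OF bm(2)] l_one[OF bm(2)]] by simp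
    moreover have "comb l b m = comb l b' m" by (rule eq[OF mc(1,2)])
    ultimately have "comb l ?b0' m \<otimes>\<^bsub>A\<^esub> b m = comb l ?b0' m \<otimes>\<^bsub>A\<^esub> b' m" by simp
    then have "b m = b' m"
      using A.l_cancel LA[OF bm(1)] LA[OF bm(2)] series_value[OF comb_series[OF fam b0(2)] mc(1)] by blast
    then show False using mc(3) by simp
  qed
  define D where "D = {x \<in> carrier G. \<exists>b\<in>Sr. \<forall>y\<in>carrier G. (y, x) \<in> r \<longrightarrow> comb l b y = u y}"
  have "\<forall>x\<in>D. \<exists>b. b \<in> Sr \<and> (\<forall>y\<in>carrier G. (y, x) \<in> r \<longrightarrow> comb l b y = u y)" by (auto simp: D_def)
  then obtain \<beta> where \<beta>: "\<And>x. x \<in> D \<Longrightarrow> \<beta> x \<in> Sr"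
    "\<And>x y. \<lbrakk>x \<in> D; y \<in> carrier G; (y, x) \<in> r\<rbrakk> \<Longrightarrow> comb l (\<beta> x) y = u y" by metis
  have D_carrier: "x \<in> carrier G" if "x \<in> D" for x using that by (simp add: D_def)
  have D_down: "y \<in> D" if x: "x \<in> D" and y: "y \<in> carrier G" "(y, x) \<in> r" for x y
    unfolding D_def
  proof (intro CollectI conjI bexI[of _ "\<beta> x"] ballI impI)
    fix z assume z: "z \<in> carrier G" "(z, y) \<in> r"
    show "comb l (\<beta> x) z = u z" by (rule \<beta>(2)[OF x z(1) le_trans[OF z(2) y(2)]])
  qed (use x y \<beta>(1) in auto)
  define c where "c = (\<lambda>y\<in>carrier G. if y \<in> D then \<beta> y y else \<one>\<^bsub>A\<^esub>)"
  have c_eq: "c y = \<beta> x y" if x: "x \<in> D" and y: "y \<in> carrier G" "(y, x) \<in> r" for x y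
  proof -
    have yD: "y \<in> D" by (rule D_down[OF x y])
    have "\<beta> y y = \<beta> x y"
    proof (rule uniq[OF \<beta>(1)[OF yD] \<beta>(1)[OF x] y(1) _ y(1) le_refl[OF y(1)]])
      fix z assume z: "z \<in> carrier G" "(z, y) \<in> r"
      show "comb l (\<beta> y) z = comb l (\<beta> x) z"
        using \<beta>(2)[OF yD z] \<beta>(2)[OF x z(1) le_trans[OF z(2) y(2)]] by simp
    qed
    then show ?thesis using yD y(1) by (simp add: c_def)
  qed
  have cL: "c x \<in> L" if "x \<in> carrier G" for x
    using that \<beta>(1)[of x] L1 by (simp add: c_def Sr_def)
  have "well_ordered (supp c)"
  proof (rule well_orderedI)
    fix T assume T: "T \<subseteq> supp c" "T \<noteq> {}"
    then obtain x where x: "x \<in> T" by blast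
    have TD: "t \<in> D" if "t \<in> T" for t using that T(1) by (auto simp: c_def split: if_splits)
    let ?T = "{t \<in> T. (t, x) \<in> r}"
    have T_sub: "?T \<subseteq> supp (\<beta> x)"
    proof
      fix t assume t: "t \<in> ?T"
      then have "c t = \<beta> x t" "c t \<noteq> \<one>\<^bsub>A\<^esub>" using c_eq[OF TD[OF x]] TD D_carrier T(1) by auto
      then show "t \<in> supp (\<beta> x)" using t TD D_carrier by auto
    qed
    have T_ne: "?T \<noteq> {}" using x le_refl[OF D_carrier[OF TD[OF x]]] by blast
    have "well_ordered (supp (\<beta> x))" using \<beta>(1)[OF TD[OF x]] by (simp add: Sr_def series_supp)
    from well_ordered_ex_min[OF this T_sub T_ne]
    obtain m where m: "m \<in> ?T" "\<And>t. t \<in> ?T \<Longrightarrow> (m, t) \<in> r" by (elim exE conjE) blast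
    have "(m, t) \<in> r" if t: "t \<in> T" for t
    proof (cases "(t, x) \<in> r")
      case True
      then show ?thesis using m(2) t by simp
    next
      case False
      then have "(x, t) \<in> r" using le_total D_carrier TD x t by metis
      then show ?thesis using m(1) le_trans by blast
    qed
    then show "\<exists>m\<in>T. \<forall>t\<in>T. (m, t) \<in> r" using m(1) by blast
  qed auto
  then have cs: "c \<in> series" using cL LA by (simp add: series_def) (auto simp: c_def)
  have cSr: "c \<in> Sr" using cs cL by (simp add: Sr_def)
  have comb_c: "comb l c x = u x" if x: "x \<in> D" for x
  proof -
    have "comb l c x = comb l (\<beta> x) x"
      using \<beta>(1)[OF x] c_eq[OF x] by (intro comb_cong_below[OF fam pos cs _ D_carrier[OF x]]) (auto simp: Sr_def)
    also have "\<dots> = u x" by (rule \<beta>(2)[OF x D_carrier[OF x] le_refl[OF D_carrier[OF x]]])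
    finally show ?thesis .
  qed
  have cc: "comb l c \<in> series" by (rule comb_series[OF fam cs])
  define e where "e = pdiv u (comb l c)"
  have e: "e \<in> kern (Suc n)"
    unfolding e_def using kern_mono comb_kern[OF cs] by (intro pdiv_kern u) blast
  have e_one: "e x = \<one>\<^bsub>A\<^esub> \<longleftrightarrow> comb l c x = u x" if x: "x \<in> carrier G" for x
    using x series_value[OF us x] series_value[OF cc x] by (auto simp: e_def pdiv_def A.inv_solve_right')
  have "supp e = {}"
  proof (rule ccontr)
    assume e_ne: "supp e \<noteq> {}"
    from well_ordered_ex_min[OF series_supp[OF kern_series[OF e]] subset_refl e_ne]
    obtain g where g: "g \<in> supp e" "\<And>t. t \<in> supp e \<Longrightarrow> (g, t) \<in> r" by (elim exE conjE) blast
    have gc: "g \<in> carrier G" using g(1) by simp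
    have below: "e y = \<one>\<^bsub>A\<^esub>" if "y \<in> carrier G" "(y, g) \<in> r" "y \<noteq> g" for y
      using g(2)[of y] that le_antisym by auto
    have gD: "g \<notin> D" using g(1) comb_c e_one[OF gc] by auto
    \<comment> \<open>Translate the error so that its support starts at the identity.\<close>
    have "e g \<in> lead (kern (Suc n))"
      unfolding lead_def
    proof (intro CollectI conjI bexI)
      show "e g \<in> carrier A" by (rule series_value[OF kern_series[OF e] gc])
      show "shift G (inv\<^bsub>G\<^esub> g) e \<in> kern (Suc n)" using gc e by (intro shift_kern) auto
      show "shift G (inv\<^bsub>G\<^esub> g) e \<one>\<^bsub>G\<^esub> = e g" using gc by simp
      show "vanishes_below_one (shift G (inv\<^bsub>G\<^esub> g) e)"
        unfolding vanishes_below_one_def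
      proof (intro ballI impI, elim conjE)
        fix x assume x: "x \<in> carrier G" "(x, \<one>\<^bsub>G\<^esub>) \<in> r" "x \<noteq> \<one>\<^bsub>G\<^esub>"
        have "(g \<otimes>\<^bsub>G\<^esub> x, g) \<in> r" using left_mono[OF x(1) G.one_closed gc x(2)] gc by simp
        moreover have "g \<otimes>\<^bsub>G\<^esub> x \<noteq> g" using x gc by simp
        ultimately show "shift G (inv\<^bsub>G\<^esub> g) e x = \<one>\<^bsub>A\<^esub>" using below x(1) gc by simp
      qed
    qed
    then have egL: "e g \<in> L" using lead by (auto simp: L_def)
    have cg: "c g = \<one>\<^bsub>A\<^esub>" using gD gc by (simp add: c_def)
    let ?c = "c(g := e g)"
    have c': "?c \<in> Sr" by (rule Sr_update[OF cSr gc egL])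
    then have c's: "?c \<in> series" by (simp add: Sr_def)
    have "comb l ?c y = u y" if y: "y \<in> carrier G" "(y, g) \<in> r" for y
    proof (cases "y = g")
      case True
      have "comb l ?c g = comb l c g \<otimes>\<^bsub>A\<^esub> e g"
        by (rule comb_update[OF fam cs gc cg LA[OF egL] l_one[OF egL]])
      also have "\<dots> = u g"
        using gc series_value[OF us gc] series_value[OF cc gc]
        by (simp add: e_def pdiv_def A.m_comm[of "comb l c g"] A.m_assoc)
      finally show ?thesis using True by simp
    next
      case False
      have "comb l ?c y = comb l c y"
      proof (rule comb_cong_below[OF fam pos c's cs y(1)])
        fix z assume z: "z \<in> carrier G" "(z, y) \<in> r"
        then have "z \<noteq> g" using y(2) False le_antisym by blast
        then show "?c z = c z" by simp
      qed
      then show ?thesis using below[OF y False] e_one[OF y(1)] by simp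
    qed
    then have "g \<in> D" unfolding D_def using gc c' by blast
    then show False using gD by blast
  qed
  then have "comb l c x = u x" if "x \<in> carrier G" for x using e_one[OF that] that by blast
  then have "comb l c = u" by (intro series_ext cc us)
  then show "u \<in> kern n" using comb_kern[OF cs] by simp
qed

text \<open>Place at each point \<open>y\<close> a finitely supported preimage of the point mass \<open>v y\<close>.\<close>

lemma ca_onto_series:
  assumes onto: "ca ` carrier base = carrier base" and v: "v \<in> series"
  shows "\<exists>u\<in>series. ca u = v"
proof -
  obtain w where w: "\<And>a. a \<in> carrier A \<Longrightarrow> w a \<in> carrier base"
    "\<And>a. a \<in> carrier A \<Longrightarrow> ca (w a) = point_mass A G a \<one>\<^bsub>G\<^esub>"
    using preimages_of_point_masses[OF onto] by metis
  define l where "l = (\<lambda>a. if a = \<one>\<^bsub>A\<^esub> then zero else w a)"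
  have l: "family l"
    unfolding family_def using zero_series base_subset_series[OF w(1)] by (simp add: l_def)
  have ca_l: "ca (l a) = point_mass A G a \<one>\<^bsub>G\<^esub>" if "a \<in> carrier A" for a
  proof (cases "a = \<one>\<^bsub>A\<^esub>")
    case True
    have "ca (l a) = zero" unfolding l_def using True ca_zero by simp
    then show ?thesis using True by (auto simp: point_mass_def)
  next
    case False
    then show ?thesis using w(2)[OF that] by (simp add: l_def)
  qed
  have cl: "comb l v \<in> series" by (rule comb_series[OF l v])
  have "ca (comb l v) = v"
  proof (rule series_ext[OF ca_series[OF cl] v])
    fix x assume x: "x \<in> carrier G"
    have val: "ca (l (v y)) (inv\<^bsub>G\<^esub> y \<otimes>\<^bsub>G\<^esub> x) = (if y = x then v x else \<one>\<^bsub>A\<^esub>)" if y: "y \<in> carrier G" for y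
    proof -
      have "inv\<^bsub>G\<^esub> y \<otimes>\<^bsub>G\<^esub> x = \<one>\<^bsub>G\<^esub> \<longleftrightarrow> y = x"
        using x y G.inv_solve_left[of "\<one>\<^bsub>G\<^esub>" y x] by auto
      then show ?thesis using x y by (simp add: ca_l[OF series_value[OF v y]] point_mass_def)
    qed
    have "ca (comb l v) x = comb (\<lambda>a. ca (l a)) v x" using ca_comb[OF l v] by simp
    also have "\<dots> = (\<Otimes>\<^bsub>A\<^esub>y\<in>{x}. ca (l (v y)) (inv\<^bsub>G\<^esub> y \<otimes>\<^bsub>G\<^esub> x))"
    proof (rule comb_superset[OF family_ca[OF l] v x])
      show "{y \<in> carrier G. ca (l (v y)) (inv\<^bsub>G\<^esub> y \<otimes>\<^bsub>G\<^esub> x) \<noteq> \<one>\<^bsub>A\<^esub>} \<subseteq> {x}"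
      proof
        fix y assume "y \<in> {y \<in> carrier G. ca (l (v y)) (inv\<^bsub>G\<^esub> y \<otimes>\<^bsub>G\<^esub> x) \<noteq> \<one>\<^bsub>A\<^esub>}"
        then have "y \<in> carrier G" "ca (l (v y)) (inv\<^bsub>G\<^esub> y \<otimes>\<^bsub>G\<^esub> x) \<noteq> \<one>\<^bsub>A\<^esub>" by simp_all
        then show "y \<in> {x}" using val[of y] by (cases "y = x") simp_all
      qed
    qed (use x in simp_all)
    also have "\<dots> = v x" using val[OF x] series_value[OF v x] by simp
    finally show "ca (comb l v) x = v x" .
  qed
  then show ?thesis using cl by blast
qed

text \<open>If a nontrivial \<open>u\<close> is killed, then preimages of \<open>u\<close> under the \<open>n\<close>-th power show that the kernel of the next power is strictly
larger. So the sets of leading coefficients form an infinite strictly increasing chain of subsets of the finite group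
\<open>A\<close>.\<close>

theorem injective_if_onto:
  assumes onto: "ca ` carrier base = carrier base" and u: "u \<in> carrier base" "ca u = zero"
  shows "u = zero"
proof (rule ccontr)
  assume ne: "u \<noteq> zero"
  have us: "u \<in> series" using u(1) by (rule base_subset_series)
  have pow_onto: "\<exists>v\<in>series. (ca ^^ n) v = u" for n
  proof (induction n)
    case (Suc n)
    then obtain v where v: "v \<in> series" "(ca ^^ n) v = u" by blast
    obtain v' where v': "v' \<in> series" "ca v' = v" using ca_onto_series[OF onto v(1)] by blast
    have "(ca ^^ Suc n) v' = (ca ^^ n) (ca v')" by (simp only: funpow_Suc_right comp_apply)
    then show ?case using v v' by auto
  qed (use us in auto)
  have strict: "lead (kern n) \<subset> lead (kern (Suc n))" for n
  proof
    show "lead (kern n) \<subseteq> lead (kern (Suc n))" unfolding lead_def using kern_mono[of n] by blast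
    obtain v where v: "v \<in> series" "(ca ^^ n) v = u" using pow_onto by blast
    have "v \<in> kern (Suc n)" "v \<notin> kern n" using v u(2) ne by (simp_all add: kern_def)
    then show "lead (kern n) \<noteq> lead (kern (Suc n))" using kern_Suc_subset_if_lead_subset[of n] by blast
  qed
  have fin: "finite (lead (kern n))" for n
    by (rule finite_subset[OF _ finite_A]) (auto simp: lead_def)
  have "n \<le> card (lead (kern n))" for n
  proof (induction n)
    case (Suc n)
    have "card (lead (kern n)) < card (lead (kern (Suc n)))" by (rule psubset_card_mono[OF fin strict])
    then show ?case using Suc by simp
  qed simp
  moreover have "card (lead (kern n)) \<le> card (carrier A)" for n
    by (rule card_mono[OF finite_A]) (auto simp: lead_def)
  ultimately have "n \<le> card (carrier A)" for n using order_trans by blast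
  then show False using Suc_n_not_le_n by blast
qed

end

theorem (in wreath_factors) bi_orderable_imp_hopfian_automata:
  assumes fin: "finite (carrier A)" and ord: "bi_orderable G"
  shows "hopfian_automata A G"
  unfolding hopfian_automata_def
proof (intro allI impI ballI, elim conjE)
  fix S :: "'g set" and k u
  assume S: "finite S" "S \<subseteq> carrier G" and k: "\<forall>t\<in>S. k t \<in> hom A A"
    and onto: "cellular_automaton A G S k ` carrier base = carrier base"
    and u: "u \<in> carrier base" "cellular_automaton A G S k u = zero"
  obtain r where r: "linear_order_on (carrier G) r" "\<forall>x\<in>carrier G. \<forall>y\<in>carrier G. \<forall>z\<in>carrier G. (x, y) \<in> r \<longrightarrow>
         (z \<otimes>\<^bsub>G\<^esub> x, z \<otimes>\<^bsub>G\<^esub> y) \<in> r \<and> (x \<otimes>\<^bsub>G\<^esub> z, y \<otimes>\<^bsub>G\<^esub> z) \<in> r"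
    using ord by (auto simp: bi_orderable_def)
  interpret ordered_automaton A G S k r
    by unfold_locales (use S k r fin in auto)
  show "u = zero" by (rule injective_if_onto[OF onto u])
qed

section \<open>Cyclic coefficients and unique products\<close>

text \<open>Each endomorphism \<open>k t\<close> of the cyclic group is the \<open>m t\<close>-th power. Replacing the kernel element by one of its powers,
one may assume that its values are killed by a prime \<open>p\<close>; then only the set \<open>T\<close> of those \<open>t\<close> with \<open>p\<close> not
dividing \<open>m t\<close> matters. It is not empty: otherwise all values of the automaton would be \<open>p\<close>-th powers, so by surjectivity
the \<open>p\<close>-th power map would be onto, hence injective on the finite group \<open>A\<close>, against the choice of \<open>p\<close>. At a
unique product of the support and \<open>T\<close> the image of the kernel element has a single nontrivial factor.\<close>

theorem (in wreath_factors) unique_product_imp_hopfian_automata: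
  assumes fin: "finite (carrier A)" and cyc: "cyclic_group A" and up: "unique_product_property G"
  shows "hopfian_automata A G"
  unfolding hopfian_automata_def
proof (intro allI impI ballI, elim conjE)
  fix S :: "'g set" and k u
  assume S: "finite S" "S \<subseteq> carrier G" and k: "\<forall>t\<in>S. k t \<in> hom A A"
    and onto: "cellular_automaton A G S k ` carrier base = carrier base"
    and u: "u \<in> carrier base" "cellular_automaton A G S k u = zero"
  interpret automaton A G S k by unfold_locales (use S k in auto)
  obtain a0 where a0: "a0 \<in> carrier A" "carrier A = range (\<lambda>n::int. a0 [^]\<^bsub>A\<^esub> n)"
    using cyc A.cyclic_group by blast
  have "\<exists>m::int. \<forall>a\<in>carrier A. k t a = a [^]\<^bsub>A\<^esub> m" if t: "t \<in> S" for t
  proof -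
    have "k t a0 \<in> range (\<lambda>n::int. a0 [^]\<^bsub>A\<^esub> n)" using k_closed[OF t a0(1)] a0(2) by simp
    then obtain m :: int where m: "k t a0 = a0 [^]\<^bsub>A\<^esub> m" by blast
    have "k t a = a [^]\<^bsub>A\<^esub> m" if a: "a \<in> carrier A" for a
    proof -
      have "a \<in> range (\<lambda>n::int. a0 [^]\<^bsub>A\<^esub> n)" using a a0(2) by simp
      then obtain n :: int where n: "a = a0 [^]\<^bsub>A\<^esub> n" by blast
      have "k t a = (k t a0) [^]\<^bsub>A\<^esub> n"
        unfolding n by (rule hom_int_pow[OF k_hom[OF t] a0(1) A.is_group A.is_group])
      then show ?thesis using a0(1) by (simp add: m n A.int_pow_pow mult.commute)
    qed
    then show ?thesis by blast
  qed
  then obtain m where m: "\<And>t a. t \<in> S \<Longrightarrow> a \<in> carrier A \<Longrightarrow> k t a = a [^]\<^bsub>A\<^esub> (m t :: int)" by metis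
  show "u = zero"
  proof (rule ccontr)
    assume ne: "u \<noteq> zero"
    define killed where "killed = (\<lambda>d::nat. 0 < d \<and> (\<forall>x\<in>carrier G. u x [^]\<^bsub>A\<^esub> d = \<one>\<^bsub>A\<^esub>))"
    have "killed (card (carrier A))"
      unfolding killed_def using fin A.power_order_eq_one[OF fin] base_value[OF u(1)]
      by (auto simp: card_gt_0_iff)
    define d where "d = (LEAST d. killed d)"
    have d: "killed d" unfolding d_def by (rule LeastI) fact
    have d_min: "\<not> killed e" if "e < d" for e using that unfolding d_def by (rule not_less_Least)
    have "d \<noteq> 1"
    proof
      assume "d = 1"
      then have "u x = \<one>\<^bsub>A\<^esub>" if "x \<in> carrier G" for x
        using d that base_value[OF u(1)] unfolding killed_def by (simp add: A.nat_pow_eone)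
      then have "u = zero" using base_ext[OF u(1) zero_base] by simp
      then show False using ne by simp
    qed
    then obtain p where p: "Factorial_Ring.prime p" "p dvd d" using prime_factor_nat by blast
    \<comment> \<open>With \<open>d\<close> the exponent of the values of \<open>u\<close>, the values of \<open>u\<^sup>d\<^sup>/\<^sup>p\<close> are killed by \<open>p\<close> but not all trivial.\<close>
    define e where "e = d div p"
    have de: "d = e * p" using p(2) by (simp add: e_def)
    have "0 < d" using d by (simp add: killed_def)
    then have e: "0 < e" "e < d" using de prime_gt_1_nat[OF p(1)] by auto
    define v where "v = (\<lambda>x\<in>carrier G. u x [^]\<^bsub>A\<^esub> e)"
    have "supp v \<subseteq> supp u" by (auto simp: v_def)
    then have fv: "finite (supp v)" using u(1) by (auto simp: base_carrier intro: finite_subset)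
    have v: "v \<in> carrier base" using fv base_value[OF u(1)] by (simp add: base_carrier) (auto simp: v_def)
    have vp: "v x [^]\<^bsub>A\<^esub> p = \<one>\<^bsub>A\<^esub>" if "x \<in> carrier G" for x
      using d that base_value[OF u(1) that] unfolding killed_def by (simp add: v_def A.nat_pow_pow de)
    have "supp v \<noteq> {}" using d_min[OF e(2)] e(1) by (auto simp: killed_def v_def)
    have ca_v: "ca v x = \<one>\<^bsub>A\<^esub>" if x: "x \<in> carrier G" for x
    proof -
      have c: "u (x \<otimes>\<^bsub>G\<^esub> inv\<^bsub>G\<^esub> t) \<in> carrier A" if "t \<in> S" for t
        using that x base_value[OF u(1)] by (simp add: S_carrier)
      have "ca v x = (\<Otimes>\<^bsub>A\<^esub>t\<in>S. (k t (u (x \<otimes>\<^bsub>G\<^esub> inv\<^bsub>G\<^esub> t))) [^]\<^bsub>A\<^esub> e)"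
        unfolding ca_apply[OF x]
      proof (rule A.finprod_cong'[OF refl])
        show "(\<lambda>t. (k t (u (x \<otimes>\<^bsub>G\<^esub> inv\<^bsub>G\<^esub> t))) [^]\<^bsub>A\<^esub> e) \<in> S \<rightarrow> carrier A" using c k_closed by auto
        fix t assume t: "t \<in> S"
        have "k t (v (x \<otimes>\<^bsub>G\<^esub> inv\<^bsub>G\<^esub> t)) = k t (u (x \<otimes>\<^bsub>G\<^esub> inv\<^bsub>G\<^esub> t) [^]\<^bsub>A\<^esub> e)"
          using t x by (simp add: v_def S_carrier)
        also have "\<dots> = (k t (u (x \<otimes>\<^bsub>G\<^esub> inv\<^bsub>G\<^esub> t))) [^]\<^bsub>A\<^esub> e"
          using hom_int_pow[OF k_hom[OF t] c[OF t] A.is_group A.is_group, of "int e"] by (simp add: int_pow_int)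
        finally show "k t (v (x \<otimes>\<^bsub>G\<^esub> inv\<^bsub>G\<^esub> t)) = (k t (u (x \<otimes>\<^bsub>G\<^esub> inv\<^bsub>G\<^esub> t))) [^]\<^bsub>A\<^esub> e" .
      qed
      also have "\<dots> = (ca u x) [^]\<^bsub>A\<^esub> e"
        unfolding ca_apply[OF x] using c k_closed
        by (intro hom_finprod[OF A.pow_hom A.comm_group_axioms A.comm_group_axioms, symmetric]) auto
      also have "\<dots> = \<one>\<^bsub>A\<^esub>" using x by (simp add: u(2))
      finally show ?thesis .
    qed
    define T where "T = {t \<in> S. \<not> int p dvd m t}"
    have "T \<noteq> {}"
    proof
      assume "T = {}"
      then have "\<forall>t\<in>S. int p dvd m t" by (auto simp: T_def)
      then have "\<forall>t\<in>S. \<exists>n. m t = n * int p" by (metis dvd_def mult.commute)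
      then obtain n where n: "\<And>t. t \<in> S \<Longrightarrow> m t = n t * int p" by metis
      have "a \<in> (\<lambda>b. b [^]\<^bsub>A\<^esub> p) ` carrier A" if a: "a \<in> carrier A" for a
      proof -
        have "point_mass A G a \<one>\<^bsub>G\<^esub> \<in> ca ` carrier base" using onto point_mass_base[OF a] by simp
        then obtain w where w: "w \<in> carrier base" "point_mass A G a \<one>\<^bsub>G\<^esub> = ca w" by blast
        let ?b = "\<lambda>t. w (\<one>\<^bsub>G\<^esub> \<otimes>\<^bsub>G\<^esub> inv\<^bsub>G\<^esub> t) [^]\<^bsub>A\<^esub> n t"
        have c: "w (\<one>\<^bsub>G\<^esub> \<otimes>\<^bsub>G\<^esub> inv\<^bsub>G\<^esub> t) \<in> carrier A" if "t \<in> S" for t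
          using that base_value[OF w(1)] by (simp add: S_carrier)
        have "a = ca w \<one>\<^bsub>G\<^esub>" unfolding w(2)[symmetric] by (simp add: point_mass_def)
        also have "\<dots> = (\<Otimes>\<^bsub>A\<^esub>t\<in>S. ?b t [^]\<^bsub>A\<^esub> p)"
          unfolding ca_apply[OF G.one_closed]
        proof (rule A.finprod_cong'[OF refl])
          show "(\<lambda>t. ?b t [^]\<^bsub>A\<^esub> p) \<in> S \<rightarrow> carrier A" using c by auto
          fix t assume t: "t \<in> S"
          show "k t (w (\<one>\<^bsub>G\<^esub> \<otimes>\<^bsub>G\<^esub> inv\<^bsub>G\<^esub> t)) = ?b t [^]\<^bsub>A\<^esub> p"
            using A.int_pow_pow[OF c[OF t], of "n t" "int p"] n[OF t] by (simp add: m[OF t c[OF t]] int_pow_int)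
        qed
        also have "\<dots> = (\<Otimes>\<^bsub>A\<^esub>t\<in>S. ?b t) [^]\<^bsub>A\<^esub> p"
          using c by (intro hom_finprod[OF A.pow_hom A.comm_group_axioms A.comm_group_axioms, symmetric]) auto
        finally show ?thesis using c by (auto intro!: image_eqI A.finprod_closed)
      qed
      then have "(\<lambda>b. b [^]\<^bsub>A\<^esub> p) ` carrier A = carrier A" by auto
      then have inj: "inj_on (\<lambda>b. b [^]\<^bsub>A\<^esub> p) (carrier A)" using fin by (simp add: eq_card_imp_inj_on)
      obtain x where x: "x \<in> carrier G" "v x \<noteq> \<one>\<^bsub>A\<^esub>" using \<open>supp v \<noteq> {}\<close> by blast
      have "v x = \<one>\<^bsub>A\<^esub>" using inj_onD[OF inj, of "v x" "\<one>\<^bsub>A\<^esub>"] vp[OF x(1)] base_value[OF v x(1)] by simp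
      then show False using x(2) by simp
    qed
    moreover have "finite T" "T \<subseteq> carrier G" using S by (auto simp: T_def)
    ultimately obtain g where g: "g \<in> carrier G" "\<exists>!q. q \<in> supp v \<times> T \<and> g = fst q \<otimes>\<^bsub>G\<^esub> snd q"
      using up[unfolded unique_product_property_def, rule_format, of "supp v" T] fv \<open>supp v \<noteq> {}\<close> by blast
    then obtain y t where yt: "y \<in> supp v" "t \<in> T" "g = y \<otimes>\<^bsub>G\<^esub> t" by (metis SigmaE fst_conv snd_conv)
    have only: "y' = y \<and> t' = t" if "y' \<in> supp v" "t' \<in> T" "g = y' \<otimes>\<^bsub>G\<^esub> t'" for y' t'
    proof -
      have "(y', t') = (y, t)" using g(2) that yt by (metis (no_types, lifting) SigmaI fst_conv snd_conv)
      then show ?thesis by simp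
    qed
    have tS: "t \<in> S" "t \<in> carrier G" "\<not> int p dvd m t" using yt(2) S_carrier by (auto simp: T_def)
    have yc: "y \<in> carrier G" "v y \<in> carrier A" using yt(1) base_value[OF v] by auto
    have other: "k t' (v (g \<otimes>\<^bsub>G\<^esub> inv\<^bsub>G\<^esub> t')) = \<one>\<^bsub>A\<^esub>" if t': "t' \<in> S" "t' \<noteq> t" for t'
    proof -
      have gc: "g \<otimes>\<^bsub>G\<^esub> inv\<^bsub>G\<^esub> t' \<in> carrier G" using t' g(1) by (simp add: S_carrier)
      show ?thesis
      proof (cases "t' \<in> T")
        case True
        have "g = (g \<otimes>\<^bsub>G\<^esub> inv\<^bsub>G\<^esub> t') \<otimes>\<^bsub>G\<^esub> t'" using t' g(1) by (simp add: S_carrier G.m_assoc)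
        then have "g \<otimes>\<^bsub>G\<^esub> inv\<^bsub>G\<^esub> t' \<notin> supp v" using only[OF _ True] t'(2) by blast
        then have "v (g \<otimes>\<^bsub>G\<^esub> inv\<^bsub>G\<^esub> t') = \<one>\<^bsub>A\<^esub>" using gc by blast
        then show ?thesis using t' by (simp add: k_one)
      next
        case False
        then obtain n where n: "m t' = int p * n" using t' by (auto simp: T_def)
        have "k t' (v (g \<otimes>\<^bsub>G\<^esub> inv\<^bsub>G\<^esub> t')) = (v (g \<otimes>\<^bsub>G\<^esub> inv\<^bsub>G\<^esub> t') [^]\<^bsub>A\<^esub> int p) [^]\<^bsub>A\<^esub> n"
          using m[OF t'(1) base_value[OF v gc]] n base_value[OF v gc] by (simp add: A.int_pow_pow)
        also have "\<dots> = \<one>\<^bsub>A\<^esub>" using vp[OF gc] by (simp add: int_pow_int)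
        finally show ?thesis .
      qed
    qed
    have gt: "g \<otimes>\<^bsub>G\<^esub> inv\<^bsub>G\<^esub> t = y" using yt(3) yc tS by (simp add: G.m_assoc)
    have "ca v g = (\<Otimes>\<^bsub>A\<^esub>t'\<in>S. if t = t' then k t' (v y) else \<one>\<^bsub>A\<^esub>)"
      unfolding ca_apply[OF g(1)] using other gt yc k_closed by (intro A.finprod_cong') auto
    also have "\<dots> = k t (v y)" using tS finite_S yc k_closed by (intro A.finprod_singleton) auto
    finally have "v y [^]\<^bsub>A\<^esub> m t = \<one>\<^bsub>A\<^esub>" using ca_v[OF g(1)] m[OF tS(1) yc(2)] by simp
    moreover have "v y [^]\<^bsub>A\<^esub> int p = \<one>\<^bsub>A\<^esub>" using vp[OF yc(1)] by (simp add: int_pow_int)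
    moreover obtain a b where ab: "a * int p + b * m t = 1"
    proof -
      have "coprime (int p) (m t)" using p(1) tS(3) by (simp add: prime_imp_coprime)
      then show thesis using that bezout_int[of "int p" "m t"] by auto
    qed
    ultimately have "v y [^]\<^bsub>A\<^esub> (int p * a + m t * b) = \<one>\<^bsub>A\<^esub>"
      using yc(2) by (simp add: A.int_pow_mult flip: A.int_pow_pow)
    moreover have "int p * a + m t * b = 1" using ab by (simp add: mult.commute)
    ultimately have "v y = \<one>\<^bsub>A\<^esub>" using yc(2) by simp
    then show False using yt(1) by simp
  qed
qed

section \<open>Torsion-free coefficients\<close>

context comm_group
begin

definition combination :: "'a set \<Rightarrow> ('a \<Rightarrow> int) \<Rightarrow> 'a"
  where "combination I n = (\<Otimes>i\<in>I. i [^] n i)"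

definition independent :: "'a set \<Rightarrow> bool"
  where "independent I \<longleftrightarrow> (\<forall>n. combination I n = \<one> \<longrightarrow> (\<forall>i\<in>I. n i = 0))"

lemma combination_closed: "I \<subseteq> carrier G \<Longrightarrow> combination I n \<in> carrier G"
  unfolding combination_def by (intro finprod_closed) auto

lemma combination_add:
  assumes "I \<subseteq> carrier G"
  shows "combination I (\<lambda>i. n i + n' i) = combination I n \<otimes> combination I n'"
proof -
  have "combination I (\<lambda>i. n i + n' i) = (\<Otimes>i\<in>I. i [^] n i \<otimes> i [^] n' i)"
    unfolding combination_def using assms by (intro finprod_cong') (auto simp: int_pow_mult subset_iff)
  also have "\<dots> = combination I n \<otimes> combination I n'"
    unfolding combination_def using assms by (intro finprod_multf) auto
  finally show ?thesis .
qed

lemma combination_scale: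
  assumes "I \<subseteq> carrier G"
  shows "combination I (\<lambda>i. z * n i) = combination I n [^] (z::int)"
proof -
  have "combination I (\<lambda>i. z * n i) = (\<Otimes>i\<in>I. (i [^] n i) [^] z)"
    unfolding combination_def using assms
    by (intro finprod_cong') (auto simp: int_pow_pow subset_iff mult.commute)
  also have "\<dots> = combination I n [^] z"
    unfolding combination_def using assms
    by (intro hom_finprod[symmetric, OF homI comm_group_axioms comm_group_axioms]) (auto simp: int_pow_distrib)
  finally show ?thesis .
qed

lemma independent_unique:
  assumes I: "I \<subseteq> carrier G" "independent I" and eq: "combination I n = combination I n'" and i: "i \<in> I"
  shows "n i = n' i"
proof -
  have "combination I (\<lambda>i. n i + (-1) * n' i) = combination I n \<otimes> combination I n' [^] (-1::int)"
    by (simp only: combination_add[OF I(1)] combination_scale[OF I(1)])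
  also have "\<dots> = \<one>" using eq combination_closed[OF I(1)] by (simp add: int_pow_neg)
  finally have "\<forall>i\<in>I. n i + (-1) * n' i = 0" using I(2) unfolding independent_def by blast
  then show ?thesis using i by auto
qed

text \<open>Every further generator satisfies a relation with a maximal independent set of generators. The elements with a
positive power in the span of the independent set form a subgroup.\<close>

lemma generators_over_independent:
  assumes S: "finite S" "S \<subseteq> carrier G" "generate G S = carrier G"
  obtains I where "I \<subseteq> S" "independent I"
    "\<And>a. a \<in> carrier G \<Longrightarrow> \<exists>N>0. \<exists>n. a [^] (N::int) = combination I n"
proof -
  define F where "F = {I. I \<subseteq> S \<and> independent I}"
  have "finite F" using S(1) by (simp add: F_def)
  moreover have "{} \<in> F" by (simp add: F_def independent_def)
  then have "F \<noteq> {}" by blast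
  ultimately obtain I where I: "I \<in> F" and "\<forall>K\<in>F. I \<subseteq> K \<longrightarrow> I = K"
    using finite_has_maximal[of F] by blast
  then have max: "I = K" if "K \<subseteq> S" "independent K" "I \<subseteq> K" for K using that by (simp add: F_def)
  have IS: "I \<subseteq> S" "independent I" using I by (simp_all add: F_def)
  have IG: "I \<subseteq> carrier G" and fI: "finite I" using IS(1) S by (auto intro: finite_subset)
  note cc = combination_closed[OF IG]
  let ?H = "{a \<in> carrier G. \<exists>N>0. \<exists>n. a [^] (N::int) = combination I n}"
  have HI: "a \<in> ?H" if "a \<in> carrier G" "0 < N" "a [^] (N::int) = combination I n" for a N n
    using that by blast
  have "subgroup ?H G"
  proof (rule subgroupI)
    have "combination I (\<lambda>_. 0) = \<one>" by (simp add: combination_def finprod_one_eqI)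
    then have "\<one> [^] (1::int) = combination I (\<lambda>_. 0)" by simp
    then have "\<one> \<in> ?H" by (rule HI[OF one_closed zero_less_one])
    then show "?H \<noteq> {}" by (metis empty_iff)
    fix a assume "a \<in> ?H"
    then obtain N n where a: "a \<in> carrier G" "0 < N" "a [^] (N::int) = combination I n" by blast
    have "(inv a) [^] N = combination I (\<lambda>i. (-1) * n i)"
      unfolding combination_scale[OF IG] using a cc by (simp add: int_pow_inv int_pow_neg)
    then show "inv a \<in> ?H" by (rule HI[OF inv_closed[OF a(1)] a(2)])
    fix b assume "b \<in> ?H"
    then obtain N' n' where b: "b \<in> carrier G" "0 < N'" "b [^] (N'::int) = combination I n'" by blast
    have "(a \<otimes> b) [^] (N * N') = (a [^] N) [^] N' \<otimes> (b [^] N') [^] N"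
      using a(1) b(1) by (simp add: int_pow_distrib int_pow_pow mult.commute)
    also have "\<dots> = combination I (\<lambda>i. N' * n i + N * n' i)"
      by (simp only: a(3) b(3) combination_add[OF IG] combination_scale[OF IG])
    finally show "a \<otimes> b \<in> ?H" by (rule HI[OF m_closed[OF a(1) b(1)] mult_pos_pos[OF a(2) b(2)]])
  qed auto
  moreover have "S \<subseteq> ?H"
  proof
    fix s assume s: "s \<in> S"
    then have sc: "s \<in> carrier G" using S by blast
    have "\<exists>N>0. \<exists>n. s [^] (N::int) = combination I n"
    proof (cases "s \<in> I")
      case True
      have "combination I (\<lambda>i. if i = s then 1 else 0) = (\<Otimes>i\<in>I. if i = s then i else \<one>)"
        unfolding combination_def using IG by (intro finprod_cong') auto
      also have "\<dots> = s" using True IG fI by (intro finprod_singleton_swap) auto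
      finally have "s [^] (1::int) = combination I (\<lambda>i. if i = s then 1 else 0)" using sc by simp
      then show ?thesis using zero_less_one by blast
    next
      case False
      have "\<not> independent (insert s I)" using max[of "insert s I"] s IS(1) False by blast
      then obtain n j where n: "combination (insert s I) n = \<one>" "j \<in> insert s I" "n j \<noteq> 0"
        unfolding independent_def by blast
      have eq: "s [^] n s \<otimes> combination I n = \<one>"
        using n(1) False fI IG sc unfolding combination_def by (subst (asm) finprod_insert) auto
      have "n s \<noteq> 0"
      proof
        assume z: "n s = 0"
        then have "combination I n = \<one>" using eq cc by simp
        then show False using IS(2) n z unfolding independent_def by blast
      qed
      moreover have inv_eq: "s [^] n s = inv (combination I n)"
        using eq cc sc inv_equality[of "s [^] n s" "combination I n"] by simp
      moreover have "s [^] (- n s) = combination I n" using inv_eq cc sc by (simp add: int_pow_neg)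
      moreover have "s [^] n s = combination I (\<lambda>i. (-1) * n i)"
        unfolding combination_scale[OF IG] using inv_eq cc by (simp add: int_pow_neg)
      ultimately show ?thesis by (metis linorder_neqE neg_0_less_iff_less)
    qed
    then show "s \<in> ?H" using sc by blast
  qed
  ultimately have "generate G S \<subseteq> ?H" by (simp add: generate_subgroup_incl)
  then have "\<exists>N>0. \<exists>n. a [^] (N::int) = combination I n" if "a \<in> carrier G" for a using that S(3) by blast
  then show thesis using that IS by blast
qed

text \<open>The embedding of \<open>G\<close> into \<open>\<rat> \<otimes> G\<close>, in coordinates with respect to a basis \<open>I\<close> taken from \<open>G\<close> itself: \<open>c a\<close> is the
vector of exponents of \<open>a\<^sup>N\<close> over \<open>I\<close>, divided by \<open>N\<close>. Its kernel is the torsion subgroup. The last property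
says that endomorphisms of \<open>G\<close> become linear maps.\<close>

theorem torsion_free_coordinates:
  assumes S: "finite S" "S \<subseteq> carrier G" "generate G S = carrier G" and tf: "torsion_free G"
  obtains I and c :: "'a \<Rightarrow> 'a \<Rightarrow> real" where "finite I" "I \<subseteq> carrier G"
    and "\<And>a b i. \<lbrakk>a \<in> carrier G; b \<in> carrier G; i \<in> I\<rbrakk> \<Longrightarrow> c (a \<otimes> b) i = c a i + c b i"
    and "\<And>i j. \<lbrakk>i \<in> I; j \<in> I\<rbrakk> \<Longrightarrow> c j i = (if i = j then 1 else 0)"
    and "\<And>a. \<lbrakk>a \<in> carrier G; \<And>i. i \<in> I \<Longrightarrow> c a i = 0\<rbrakk> \<Longrightarrow> a = \<one>"
    and "\<And>h a i. \<lbrakk>h \<in> hom G G; a \<in> carrier G; i \<in> I\<rbrakk> \<Longrightarrow> c (h a) i = (\<Sum>j\<in>I. c a j * c (h j) i)"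
proof -
  obtain I where I: "I \<subseteq> S" "independent I"
    and gen: "\<And>a. a \<in> carrier G \<Longrightarrow> \<exists>N>0. \<exists>n. a [^] (N::int) = combination I n"
    using generators_over_independent[OF S] by metis
  have IG: "I \<subseteq> carrier G" and fI: "finite I" using I(1) S by (auto intro: finite_subset)
  obtain N n where N: "\<And>a. a \<in> carrier G \<Longrightarrow> 0 < (N a :: int)"
    and n: "\<And>a. a \<in> carrier G \<Longrightarrow> a [^] N a = combination I (n a)" using gen by metis
  define c where "c = (\<lambda>a i. real_of_int (n a i) / real_of_int (N a))"
  \<comment> \<open>The coordinates do not depend on the chosen power of \<open>a\<close>.\<close>
  have c_eq: "c a i = real_of_int (l i) / real_of_int M"
    if a: "a \<in> carrier G" and M: "0 < M" "a [^] (M::int) = combination I l" and i: "i \<in> I" for a M l i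
  proof -
    have "combination I (\<lambda>i. M * n a i) = combination I (\<lambda>i. N a * l i)"
      unfolding combination_scale[OF IG] n[OF a, symmetric] M(2)[symmetric]
      using a by (simp add: int_pow_pow mult.commute)
    then have "M * n a i = N a * l i" by (rule independent_unique[OF IG I(2) _ i])
    then have "real_of_int M * real_of_int (n a i) = real_of_int (N a) * real_of_int (l i)"
      by (metis of_int_mult)
    then show ?thesis using N[OF a] M(1) by (simp add: c_def field_simps)
  qed
  have add: "c (a \<otimes> b) i = c a i + c b i" if a: "a \<in> carrier G" and b: "b \<in> carrier G" and i: "i \<in> I" for a b i
  proof -
    have "(a \<otimes> b) [^] (N a * N b) = (a [^] N a) [^] N b \<otimes> (b [^] N b) [^] N a"
      using a b by (simp add: int_pow_distrib int_pow_pow mult.commute)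
    also have "\<dots> = combination I (\<lambda>i. N b * n a i + N a * n b i)"
      by (simp only: n[OF a] n[OF b] combination_add[OF IG] combination_scale[OF IG])
    finally have "c (a \<otimes> b) i = real_of_int (N b * n a i + N a * n b i) / real_of_int (N a * N b)"
      using a b i N by (intro c_eq) auto
    then show ?thesis using N[OF a] N[OF b] by (simp add: c_def field_simps)
  qed
  have one: "c \<one> i = 0" if "i \<in> I" for i using add[OF one_closed one_closed that] by simp
  have inv: "c (inv a) i = - c a i" if "a \<in> carrier G" "i \<in> I" for a i
    using add[of a "inv a" i] one that by simp
  have npow: "c (a [^] (k::nat)) i = k * c a i" if "a \<in> carrier G" "i \<in> I" for a i k
    using that by (induction k) (auto simp: one add algebra_simps)
  have ipow: "c (a [^] (z::int)) i = z * c a i" if "a \<in> carrier G" "i \<in> I" for a i z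
  proof (cases z)
    case (nonneg k)
    then show ?thesis using npow[OF that, of k] by (simp add: int_pow_int)
  next
    case (neg k)
    show ?thesis
      using npow[OF that, of "Suc k"] inv[of "a [^] Suc k" i] that
      unfolding neg int_pow_neg_int[OF that(1)] by (simp del: nat_pow_Suc of_nat_Suc)
  qed
  have prod: "c (finprod G f J) i = (\<Sum>j\<in>J. c (f j) i)" if "finite J" "f \<in> J \<rightarrow> carrier G" "i \<in> I" for f J i
    using that by (induction J rule: finite_induct) (auto simp: one add Pi_def)
  show thesis
  proof (rule that[OF fI IG, of c])
    show "c (a \<otimes> b) i = c a i + c b i" if "a \<in> carrier G" "b \<in> carrier G" "i \<in> I" for a b i
      using add that .
    show "c j i = (if i = j then 1 else 0)" if ij: "i \<in> I" "j \<in> I" for i j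
    proof -
      have "combination I (\<lambda>i. if i = j then 1 else 0) = (\<Otimes>i\<in>I. if i = j then i else \<one>)"
        unfolding combination_def using IG by (intro finprod_cong') auto
      also have "\<dots> = j" using ij IG fI by (intro finprod_singleton_swap) auto
      finally have "j [^] (1::int) = combination I (\<lambda>i. if i = j then 1 else 0)" using ij IG by auto
      then have "c j i = real_of_int (if i = j then 1 else 0) / real_of_int 1"
        using ij IG by (intro c_eq) auto
      then show ?thesis by simp
    qed
    show "a = \<one>" if a: "a \<in> carrier G" and z: "\<And>i. i \<in> I \<Longrightarrow> c a i = 0" for a
    proof -
      have "n a i = 0" if "i \<in> I" for i using z[OF that] N[OF a] by (simp add: c_def)
      then have "a [^] N a = \<one>" unfolding n[OF a] combination_def by (intro finprod_one_eqI) simp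
      then have "a [^] nat (N a) = \<one>" using N[OF a] by (metis int_pow_int int_nat_eq less_imp_le)
      moreover have "0 < nat (N a)" using N[OF a] by simp
      ultimately show ?thesis using tf a unfolding torsion_free_def by blast
    qed
    show "c (h a) i = (\<Sum>j\<in>I. c a j * c (h j) i)" if h: "h \<in> hom G G" and a: "a \<in> carrier G" and i: "i \<in> I" for h a i
    proof -
      have hc: "h b \<in> carrier G" if "b \<in> carrier G" for b using h that by (auto simp: hom_def)
      have "N a * c (h a) i = c (h a [^] N a) i" using ipow hc a i by simp
      also have "h a [^] N a = h (combination I (n a))"
        unfolding n[OF a, symmetric] by (rule hom_int_pow[OF h a is_group is_group, symmetric])
      also have "\<dots> = (\<Otimes>j\<in>I. h (j [^] n a j))"
        unfolding combination_def using IG by (intro hom_finprod[OF h comm_group_axioms comm_group_axioms]) auto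
      also have "c \<dots> i = (\<Sum>j\<in>I. c (h (j [^] n a j)) i)" using fI i hc IG by (intro prod) auto
      also have "\<dots> = (\<Sum>j\<in>I. n a j * c (h j) i)"
      proof (rule sum.cong[OF refl])
        fix j assume "j \<in> I"
        then have j: "j \<in> carrier G" using IG by blast
        show "c (h (j [^] n a j)) i = n a j * c (h j) i"
          unfolding hom_int_pow[OF h j is_group is_group] by (rule ipow[OF hc[OF j] i])
      qed
      finally have "c (h a) i = (\<Sum>j\<in>I. n a j * c (h j) i) / N a" using N[OF a] by (simp add: field_simps)
      then show ?thesis by (simp add: c_def sum_divide_distrib mult.commute)
    qed
  qed
qed

end

text \<open>In coordinates, the base group becomes a subgroup of the free module over the real group algebra that
contains its basis, and the automaton is the restriction of an equivariant linear map \<open>\<theta>\<close>. Surjectivity gives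
preimages of the basis vectors, that is, a right inverse \<open>\<sigma>\<close> of \<open>\<theta>\<close>; so \<open>\<theta>\<close> is injective.\<close>

theorem (in wreath_factors) torsion_free_imp_hopfian_automata:
  assumes fg: "finitely_generated A" and tf: "torsion_free A"
  shows "hopfian_automata A G"
  unfolding hopfian_automata_def
proof (intro allI impI ballI, elim conjE)
  fix S :: "'g set" and k u
  assume S: "finite S" "S \<subseteq> carrier G" and k: "\<forall>t\<in>S. k t \<in> hom A A"
    and onto: "cellular_automaton A G S k ` carrier base = carrier base"
    and u: "u \<in> carrier base" "cellular_automaton A G S k u = zero"
  interpret automaton A G S k by unfold_locales (use S k in auto)
  obtain T where T: "finite T" "T \<subseteq> carrier A" "generate A T = carrier A"
    using fg by (auto simp: finitely_generated_def)
  show "u = zero"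
  proof (rule A.torsion_free_coordinates[OF T tf])
    fix I and c :: "'a \<Rightarrow> 'a \<Rightarrow> real"
    assume I: "finite I" "I \<subseteq> carrier A"
      and c_add: "\<And>a b i. \<lbrakk>a \<in> carrier A; b \<in> carrier A; i \<in> I\<rbrakk> \<Longrightarrow> c (a \<otimes>\<^bsub>A\<^esub> b) i = c a i + c b i"
      and c_unit: "\<And>i j. \<lbrakk>i \<in> I; j \<in> I\<rbrakk> \<Longrightarrow> c j i = (if i = j then 1 else 0)"
      and c_inj: "\<And>a. \<lbrakk>a \<in> carrier A; \<And>i. i \<in> I \<Longrightarrow> c a i = 0\<rbrakk> \<Longrightarrow> a = \<one>\<^bsub>A\<^esub>"
      and c_hom: "\<And>h a i. \<lbrakk>h \<in> hom A A; a \<in> carrier A; i \<in> I\<rbrakk> \<Longrightarrow> c (h a) i = (\<Sum>j\<in>I. c a j * c (h j) i)"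
    have c_one: "c \<one>\<^bsub>A\<^esub> i = 0" if "i \<in> I" for i using c_add[OF A.one_closed A.one_closed that] by simp
    interpret V: real_group_module G I by unfold_locales (rule I(1))
    define emb where "emb = (\<lambda>m :: 'g \<Rightarrow> 'a. \<lambda>(x, i). if x \<in> carrier G \<and> i \<in> I then c (m x) i else 0)"
    have emb_vectors: "emb m \<in> V.vectors" if m: "m \<in> carrier base" for m
    proof -
      have "{x. emb m x \<noteq> 0} \<subseteq> supp m \<times> I" using c_one by (auto simp: emb_def split: if_splits)
      moreover have "finite (supp m \<times> I)" using m I by (simp add: base_carrier)
      moreover have "supp m \<times> I \<subseteq> carrier G \<times> I" by auto
      ultimately show ?thesis unfolding V.vectors_def by (auto intro: finite_subset)
    qed
    have emb_mult: "emb (m \<otimes>\<^bsub>base\<^esub> n) = (\<lambda>x. emb m x + 1 * emb n x)"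
      if "m \<in> carrier base" "n \<in> carrier base" for m n
      using that by (auto simp: emb_def c_add base_value)
    have emb_shift: "emb (shift G g m) = V.translate g (emb m)" if "g \<in> carrier G" for g m
      using that by (auto simp: emb_def V.translate_def)
    have emb_unit: "emb (point_mass A G j \<one>\<^bsub>G\<^esub>) = V.unit_at (\<one>\<^bsub>G\<^esub>, j)" if "j \<in> I" for j
      using that c_unit c_one by (auto simp: emb_def V.unit_at_def point_mass_def)
    have emb_zero: "emb zero = (\<lambda>x. 0)" using c_one by (auto simp: emb_def)
    have jA: "j \<in> carrier A" if "j \<in> I" for j using that I by blast
    obtain w where w: "\<And>a. a \<in> carrier A \<Longrightarrow> w a \<in> carrier base"
      "\<And>a. a \<in> carrier A \<Longrightarrow> ca (w a) = point_mass A G a \<one>\<^bsub>G\<^esub>"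
      using preimages_of_point_masses[OF onto] by metis
    define \<theta> where "\<theta> = V.extend (\<lambda>j. emb (ca (point_mass A G j \<one>\<^bsub>G\<^esub>)))"
    define \<sigma> where "\<sigma> = V.extend (\<lambda>j. emb (w j))"
    have \<theta>_lin: "V.equivariant_linear \<theta>"
      unfolding \<theta>_def using jA by (intro V.extend_linear emb_vectors ca_base point_mass_base)
    have \<sigma>_lin: "V.equivariant_linear \<sigma>"
      unfolding \<sigma>_def using jA w by (intro V.extend_linear emb_vectors) auto
    have \<theta>_unit: "\<theta> (V.unit_at (\<one>\<^bsub>G\<^esub>, j)) = emb (ca (point_mass A G j \<one>\<^bsub>G\<^esub>))" if "j \<in> I" for j
      unfolding \<theta>_def V.extend_unit
      using that jA by (intro V.translate_one emb_vectors ca_base point_mass_base) auto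
    have \<sigma>_unit: "\<sigma> (V.unit_at (\<one>\<^bsub>G\<^esub>, j)) = emb (w j)" if "j \<in> I" for j
      unfolding \<sigma>_def V.extend_unit using that jA w by (intro V.translate_one emb_vectors) auto
    have \<theta>_point_one: "\<theta> (emb (point_mass A G a \<one>\<^bsub>G\<^esub>)) = emb (ca (point_mass A G a \<one>\<^bsub>G\<^esub>))" if a: "a \<in> carrier A" for a
    proof
      fix xi :: "'g \<times> 'a"
      obtain x i where xi: "xi = (x, i)" by (cases xi)
      let ?v = "emb (point_mass A G a \<one>\<^bsub>G\<^esub>)"
      have vv: "?v \<in> V.vectors" using a by (intro emb_vectors point_mass_base)
      have "\<theta> ?v xi = (\<Sum>y\<in>{\<one>\<^bsub>G\<^esub>} \<times> I. ?v y * \<theta> (V.unit_at y) xi)"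
      proof (rule V.linear_expand[OF \<theta>_lin vv])
        show "{x. ?v x \<noteq> 0} \<subseteq> {\<one>\<^bsub>G\<^esub>} \<times> I" using c_one by (auto simp: emb_def point_mass_def split: if_splits)
      qed (use I in auto)
      also have "\<dots> = (\<Sum>j\<in>I. ?v (\<one>\<^bsub>G\<^esub>, j) * \<theta> (V.unit_at (\<one>\<^bsub>G\<^esub>, j)) xi)"
      proof -
        have "{\<one>\<^bsub>G\<^esub>} \<times> I = (\<lambda>j. (\<one>\<^bsub>G\<^esub>, j)) ` I" by auto
        then show ?thesis by (simp add: sum.reindex inj_on_def)
      qed
      also have "\<dots> = (\<Sum>j\<in>I. c a j * emb (ca (point_mass A G j \<one>\<^bsub>G\<^esub>)) xi)"
        by (intro sum.cong refl) (simp add: \<theta>_unit, simp add: emb_def point_mass_def)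
      also have "\<dots> = emb (ca (point_mass A G a \<one>\<^bsub>G\<^esub>)) xi"
      proof (cases "x \<in> carrier G \<and> i \<in> I")
        case True
        then have val: "emb (ca (point_mass A G b \<one>\<^bsub>G\<^esub>)) xi = (if x \<in> S then c (k x b) i else 0)" if "b \<in> carrier A" for b
          using that by (simp add: xi emb_def ca_point_mass c_one)
        show ?thesis using True val[OF a] val[OF jA] c_hom[OF k_hom a, of x i] by simp
      next
        case False
        then have "emb m xi = 0" for m by (auto simp: xi emb_def)
        then show ?thesis by simp
      qed
      finally show "\<theta> ?v xi = emb (ca (point_mass A G a \<one>\<^bsub>G\<^esub>)) xi" .
    qed
    have \<theta>_emb: "\<theta> (emb m) = emb (ca m)" if "m \<in> carrier base" for m
      using that
    proof (induction rule: base_induct)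
      case zero
      have "\<theta> (\<lambda>x. 0) = (\<lambda>x. 0)" using V.linear_diff[OF \<theta>_lin V.vectors_zero V.vectors_zero] by simp
      then show ?case by (simp only: ca_zero emb_zero)
    next
      case (point a y m)
      have p1: "point_mass A G a \<one>\<^bsub>G\<^esub> \<in> carrier base" and p: "point_mass A G a y \<in> carrier base"
        using point(1) by (simp_all add: point_mass_base)
      have sh: "shift G y (point_mass A G a \<one>\<^bsub>G\<^esub>) = point_mass A G a y" using point(2) by (simp add: shift_point_mass)
      have "\<theta> (emb (point_mass A G a y)) = V.translate y (\<theta> (emb (point_mass A G a \<one>\<^bsub>G\<^esub>)))"
        unfolding sh[symmetric] emb_shift[OF point(2)]
        using \<theta>_lin point(2) emb_vectors[OF p1] by (simp add: V.equivariant_linear_def)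
      also have "\<dots> = emb (ca (point_mass A G a y))"
        unfolding \<theta>_point_one[OF point(1)] emb_shift[OF point(2), symmetric] sh[symmetric]
        using point(2) p1 by (subst ca_shift) (auto simp: base_value)
      finally have tp: "\<theta> (emb (point_mass A G a y)) = emb (ca (point_mass A G a y))" .
      have "\<theta> (emb (point_mass A G a y \<otimes>\<^bsub>base\<^esub> m)) = (\<lambda>x. \<theta> (emb (point_mass A G a y)) x + 1 * \<theta> (emb m) x)"
        unfolding emb_mult[OF p point(3)] by (rule V.linear_comb[OF \<theta>_lin emb_vectors[OF p] emb_vectors[OF point(3)]])
      also have "\<dots> = emb (ca (point_mass A G a y) \<otimes>\<^bsub>base\<^esub> ca m)"
        unfolding tp point(4) by (rule emb_mult[OF ca_base[OF p] ca_base[OF point(3)], symmetric])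
      also have "ca (point_mass A G a y) \<otimes>\<^bsub>base\<^esub> ca m = ca (point_mass A G a y \<otimes>\<^bsub>base\<^esub> m)"
        unfolding mult_sum_group using p point(3) base_value by (intro ca_mult[symmetric]) auto
      finally show ?case .
    qed
    have \<theta>\<sigma>_unit: "\<theta> (\<sigma> (V.unit_at (g, j))) = V.unit_at (g, j)" if g: "g \<in> carrier G" and j: "j \<in> I" for g j
    proof -
      have u1: "V.unit_at (\<one>\<^bsub>G\<^esub>, j) \<in> V.vectors" using j by (simp add: V.unit_at_vectors)
      have "V.unit_at (g, j) = V.translate g (V.unit_at (\<one>\<^bsub>G\<^esub>, j))" using g by (simp add: V.translate_unit_at)
      then have "\<theta> (\<sigma> (V.unit_at (g, j))) = V.translate g (\<theta> (\<sigma> (V.unit_at (\<one>\<^bsub>G\<^esub>, j))))"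
        using \<theta>_lin \<sigma>_lin g u1 by (simp add: V.equivariant_linear_def)
      also have "\<theta> (\<sigma> (V.unit_at (\<one>\<^bsub>G\<^esub>, j))) = V.unit_at (\<one>\<^bsub>G\<^esub>, j)"
        using j jA w by (simp add: \<sigma>_unit \<theta>_emb emb_unit)
      finally show ?thesis using g by (simp add: V.translate_unit_at)
    qed
    have \<theta>\<sigma>: "\<theta> (\<sigma> v) = v" if v: "v \<in> V.vectors" for v
    proof
      fix x
      have lin: "V.equivariant_linear (\<lambda>v. \<theta> (\<sigma> v))"
        using \<theta>_lin \<sigma>_lin by (simp add: V.equivariant_linear_def)
      have E: "finite {x. v x \<noteq> 0}" "{x. v x \<noteq> 0} \<subseteq> carrier G \<times> I" using v by (auto simp: V.vectors_def)
      have "\<theta> (\<sigma> v) x = (\<Sum>y | v y \<noteq> 0. v y * \<theta> (\<sigma> (V.unit_at y)) x)"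
        by (rule V.linear_expand[OF lin v E(1) subset_refl E(2)])
      also have "\<dots> = (\<Sum>y | v y \<noteq> 0. if y = x then v y else 0)"
      proof (rule sum.cong[OF refl])
        fix y assume "y \<in> {y. v y \<noteq> 0}"
        then have "y \<in> carrier G \<times> I" using E(2) by blast
        then have "\<theta> (\<sigma> (V.unit_at y)) = V.unit_at y" using \<theta>\<sigma>_unit by blast
        then show "v y * \<theta> (\<sigma> (V.unit_at y)) x = (if y = x then v y else 0)" by (simp add: V.unit_at_def)
      qed
      also have "\<dots> = v x" using E(1) by simp
      finally show "\<theta> (\<sigma> v) x = v x" .
    qed
    have "\<theta> (emb u) = (\<lambda>x. 0)" unfolding \<theta>_emb[OF u(1)] u(2) by (rule emb_zero)
    with \<theta>\<sigma> emb_vectors[OF u(1)] have emb_u: "emb u = (\<lambda>x. 0)"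
      using V.right_inverse_is_injective[of \<sigma> \<theta> "emb u"] \<sigma>_lin \<theta>_lin by simp
    have zero: "c (u x) i = 0" if "x \<in> carrier G" "i \<in> I" for x i
    proof -
      have "emb u (x, i) = 0" unfolding emb_u by (rule refl)
      then show ?thesis using that by (simp add: emb_def)
    qed
    show "u = zero"
      using c_inj[OF base_value[OF u(1)]] zero by (intro base_ext[OF u(1) zero_base]) simp
  qed
qed

section \<open>The equivalence\<close>

theorem corollary1p6:
  fixes \<Gamma> :: "('g, 'x) monoid_scheme" and A :: "('a, 'y) monoid_scheme"
  assumes "group \<Gamma>" and "finitely_generated \<Gamma>"
    and "comm_group A" and "finitely_generated A"
    and "torsion_free A \<or> sofic \<Gamma> \<or> bi_orderable \<Gamma> \<or>
         (cyclic_group A \<and> unique_product_property \<Gamma>)"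
  shows "hopfian (wreath_product A \<Gamma>) \<longleftrightarrow> hopfian \<Gamma>"
proof -
  interpret wreath_factors A \<Gamma> by (rule wreath_factors.intro) fact+
  let ?Q = "\<lambda>N. A Mod A.powers N"
  have quotient: "wreath_factors (?Q N) \<Gamma>" for N
    by (rule wreath_factors.intro[OF A.abelian_FactGroup[OF A.powers_subgroup] \<open>group \<Gamma>\<close>])
  have "hopfian_automata A \<Gamma>"
    using assms(5)
  proof (elim disjE conjE)
    assume "torsion_free A"
    then show ?thesis by (rule torsion_free_imp_hopfian_automata[OF \<open>finitely_generated A\<close>])
  next
    assume sofic: "sofic \<Gamma>"
    show ?thesis
    proof (rule hopfian_automata_residual[OF \<open>finitely_generated A\<close>])
      fix N :: nat assume "finite (carrier (?Q N))"
      then show "hopfian_automata (?Q N) \<Gamma>"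
        by (rule wreath_factors.sofic_imp_hopfian_automata[OF quotient _ sofic])
    qed
  next
    assume ord: "bi_orderable \<Gamma>"
    show ?thesis
    proof (rule hopfian_automata_residual[OF \<open>finitely_generated A\<close>])
      fix N :: nat assume "finite (carrier (?Q N))"
      then show "hopfian_automata (?Q N) \<Gamma>"
        by (rule wreath_factors.bi_orderable_imp_hopfian_automata[OF quotient _ ord])
    qed
  next
    assume cyc: "cyclic_group A" and up: "unique_product_property \<Gamma>"
    show ?thesis
    proof (rule hopfian_automata_residual[OF \<open>finitely_generated A\<close>])
      fix N :: nat assume fin: "finite (carrier (?Q N))"
      interpret P: normal "A.powers N" A using A.powers_subgroup A.normal_iff_subgroup by simp
      have "(\<lambda>a. A.powers N #>\<^bsub>A\<^esub> a) \<in> epi A (?Q N)"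
        using P.r_coset_hom_Mod by (simp add: epi_def FactGroup_def RCOSETS_def image_def) blast
      then have "cyclic_group (?Q N)"
        by (rule A.cyclic_group_epimorphic_image[OF _ cyc P.factorgroup_is_group])
      then show "hopfian_automata (?Q N) \<Gamma>"
        by (rule wreath_factors.unique_product_imp_hopfian_automata[OF quotient fin _ up])
    qed
  qed
  then show ?thesis
    using hopfian_wreath_if[OF _ _ \<open>finitely_generated A\<close>] hopfian_factor_of_wreath by blast
qed

end
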